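(* For each integer $N\ge 2$, let $$C_N=\sup_{\varphi}\frac{\log(\lambda(\varphi))}{\log(\lambda(\varphi^{-1}))},$$ where $\varphi$ ranges over all fully irreducible elements of $\mathrm{Out}(F_N)$, $F_N$ is the free group of rank $N$, and $\lambda(\cdot)$ denotes the stretch factor. Then $$\limsup_{N\to\infty} C_N=\infty.$$
   Context: Let $F_N$ be the free group of rank $N\ge 2$ and $\mathrm{Out}(F_N)$ its outer automorphism group, which acts on the set of conjugacy classes of elements of $F_N$ and on the set of conjugacy classes of subgroups of $F_N$. An element $\varphi\in\mathrm{Out}(F_N)$ is fully irreducible if no power $\varphi^k$ ($k\ge 1$) preserves the conjugacy class of any proper free factor of $F_N$. Here a proper free factor is a subgroup $A$ with $1\ne A\ne F_N$ such that $F_N=A*B$ for some subgroup $B$. If $\varphi$ is fully irreducible, then so is $\varphi^{-1}$. For a free basis $X$ of $F_N$ and a conjugacy class $\alpha$ in $F_N$, let $\|\alpha\|_X$ denote the cyclically reduced word length of $\alpha$ with respect to $X$. A conjugacy class $\alpha$ is $\varphi$-periodic if $\varphi^n(\alpha)=\alpha$ for some $n\ge 1$. If $\varphi$ is fully irreducible, its stretch factor is $$\lambda(\varphi)=\lim_{n\to\infty}\sqrt[n]{\|\varphi^n(\alpha)\|_X},$$ where $\alpha$ is any conjugacy class in $F_N$ that is not $\varphi$-periodic and $X$ is any free basis of $F_N$. It is a known fact that this limit exists, does not depend on the choices of $\alpha$ and $X$, and satisfies $\lambda(\varphi)>1$. It is also known (Handel–Mosher) that $C_N<\infty$ for every $N\ge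 2$. *)

theory Defs
  imports Complex_Main "HOL-Library.Extended_Real" "HOL-Algebra.Bij" "HOL-Algebra.Coset"
begin

section \<open>Words and free groups\<close>

text \<open>A letter \<open>(x, True)\<close> stands for \<open>x\<close> and \<open>(x, False)\<close> for its formal inverse.\<close>

type_synonym 'a letter = "'a \<times> bool"

definition inv_letter :: "'a letter \<Rightarrow> 'a letter" where
  "inv_letter a = (fst a, \<not> snd a)"

definition reduced :: "'a letter list \<Rightarrow> bool" where
  "reduced w \<longleftrightarrow> successively (\<lambda>a b. b \<noteq> inv_letter a) w"

definition cyclically_reduced :: "'a letter list \<Rightarrow> bool" where
  "cyclically_reduced w \<longleftrightarrow> reduced w \<and> (w \<noteq> [] \<longrightarrow> hd w \<noteq> inv_letter (last w))"

definition reduced_words :: "'a set \<Rightarrow> 'a letter list set" where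
  "reduced_words X = {w. set w \<subseteq> X \<times> UNIV \<and> reduced w}"

fun cancel_cons :: "'a letter \<Rightarrow> 'a letter list \<Rightarrow> 'a letter list" where
  "cancel_cons a [] = [a]"
| "cancel_cons a (b # w) = (if b = inv_letter a then w else a # b # w)"

text \<open>For reduced \<open>u\<close> and \<open>v\<close>, \<open>foldr cancel_cons u v\<close> is the reduced form of \<open>u @ v\<close>.\<close>

definition free_group :: "nat \<Rightarrow> nat letter list monoid" where
  "free_group N = \<lparr>carrier = reduced_words {..<N}, mult = foldr cancel_cons, one = []\<rparr>"

definition word_value :: "('a, 'c) monoid_scheme \<Rightarrow> 'a letter list \<Rightarrow> 'a" where
  "word_value G w =
     foldr (\<lambda>(x, b) y. (if b then x else inv\<^bsub>G\<^esub> x) \<otimes>\<^bsub>G\<^esub> y) w \<one>\<^bsub>G\<^esub>"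

definition free_basis :: "('a, 'c) monoid_scheme \<Rightarrow> 'a set \<Rightarrow> bool" where
  "free_basis G X \<longleftrightarrow>
     X \<subseteq> carrier G \<and> bij_betw (word_value G) (reduced_words X) (carrier G)"


section \<open>Free factors\<close>

text \<open>
  \<open>G\<close> is the internal free product of its subgroups \<open>A\<close> and \<open>B\<close> iff every element of \<open>G\<close> is
  the value of exactly one alternating word in nontrivial elements of \<open>A\<close> and \<open>B\<close>. Syllables carry
  a tag naming their factor (\<open>True\<close> for \<open>A\<close>), so that uniqueness also forces \<open>A \<inter> B = {\<one>}\<close>.
\<close>

definition alternating_words ::
    "('a, 'c) monoid_scheme \<Rightarrow> 'a set \<Rightarrow> 'a set \<Rightarrow> (bool \<times> 'a) list set" where
  "alternating_words G A B =
     {w. (\<forall>(t, g) \<in> set w. g \<in> (if t then A else B) - {\<one>\<^bsub>G\<^esub>}) \<and>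
         successively (\<lambda>p q. fst p \<noteq> fst q) w}"

definition free_product_of :: "('a, 'c) monoid_scheme \<Rightarrow> 'a set \<Rightarrow> 'a set \<Rightarrow> bool" where
  "free_product_of G A B \<longleftrightarrow>
     subgroup A G \<and> subgroup B G \<and>
     bij_betw (\<lambda>w. foldr (\<lambda>p y. snd p \<otimes>\<^bsub>G\<^esub> y) w \<one>\<^bsub>G\<^esub>) (alternating_words G A B) (carrier G)"

definition proper_free_factor :: "('a, 'c) monoid_scheme \<Rightarrow> 'a set \<Rightarrow> bool" where
  "proper_free_factor G A \<longleftrightarrow>
     A \<noteq> {\<one>\<^bsub>G\<^esub>} \<and> A \<noteq> carrier G \<and> (\<exists>B. free_product_of G A B)"


section \<open>Outer automorphisms and their action on conjugacy classes\<close>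

definition conj_by :: "('a, 'c) monoid_scheme \<Rightarrow> 'a \<Rightarrow> 'a \<Rightarrow> 'a" where
  "conj_by G g = (\<lambda>h \<in> carrier G. g \<otimes>\<^bsub>G\<^esub> h \<otimes>\<^bsub>G\<^esub> inv\<^bsub>G\<^esub> g)"

definition Inn :: "('a, 'c) monoid_scheme \<Rightarrow> ('a \<Rightarrow> 'a) set" where
  "Inn G = conj_by G ` carrier G"

definition Out :: "('a, 'c) monoid_scheme \<Rightarrow> ('a \<Rightarrow> 'a) set monoid" where
  "Out G = AutoGroup G Mod Inn G"

definition conj_class :: "('a, 'c) monoid_scheme \<Rightarrow> 'a \<Rightarrow> 'a set" where
  "conj_class G x = (\<lambda>g. conj_by G g x) ` carrier G"

definition subgroup_conj_class :: "('a, 'c) monoid_scheme \<Rightarrow> 'a set \<Rightarrow> 'a set set" where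
  "subgroup_conj_class G H = (\<lambda>g. conj_by G g ` H) ` carrier G"

text \<open>
  An element of \<^term>\<open>Out G\<close> is a coset \<open>\<phi>\<close> of automorphisms. It acts on a conjugacy class by applying
  all representatives of \<open>\<phi>\<close> to all members of the class; \<open>out_act_conj_class\<close> and
  \<open>out_act_subgroup_conj_class\<close> below show that one representative suffices.
\<close>

definition out_act :: "('a \<Rightarrow> 'a) set \<Rightarrow> 'a set \<Rightarrow> 'a set" where
  "out_act \<phi> \<alpha> = (\<Union>f\<in>\<phi>. f ` \<alpha>)"

definition out_act_subgroups :: "('a \<Rightarrow> 'a) set \<Rightarrow> 'a set set \<Rightarrow> 'a set set" where
  "out_act_subgroups \<phi> \<A> = (\<Union>f\<in>\<phi>. (\<lambda>H. f ` H) ` \<A>)"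

definition fully_irreducible :: "('a, 'c) monoid_scheme \<Rightarrow> ('a \<Rightarrow> 'a) set \<Rightarrow> bool" where
  "fully_irreducible G \<phi> \<longleftrightarrow>
     \<phi> \<in> carrier (Out G) \<and>
     (\<forall>k::nat. k \<ge> 1 \<longrightarrow> (\<forall>A. proper_free_factor G A \<longrightarrow>
        out_act_subgroups (\<phi> [^]\<^bsub>Out G\<^esub> k) (subgroup_conj_class G A) \<noteq> subgroup_conj_class G A))"


section \<open>Stretch factors\<close>

definition conj_length :: "('a, 'c) monoid_scheme \<Rightarrow> 'a set \<Rightarrow> 'a set \<Rightarrow> nat" where
  "conj_length G X \<alpha> =
     (THE n. \<exists>w. set w \<subseteq> X \<times> UNIV \<and> cyclically_reduced w \<and> word_value G w \<in> \<alpha> \<and> length w = n)"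

definition periodic_class :: "('a, 'c) monoid_scheme \<Rightarrow> ('a \<Rightarrow> 'a) set \<Rightarrow> 'a set \<Rightarrow> bool" where
  "periodic_class G \<phi> \<alpha> \<longleftrightarrow> (\<exists>n::nat. n \<ge> 1 \<and> out_act (\<phi> [^]\<^bsub>Out G\<^esub> n) \<alpha> = \<alpha>)"

text \<open>
  For fully irreducible \<open>\<phi>\<close> and a free group of finite rank at least 2, there is exactly one such
  \<open>l\<close>: the limit does not depend on the basis or on the nonperiodic class.
\<close>

definition stretch_factor :: "('a, 'c) monoid_scheme \<Rightarrow> ('a \<Rightarrow> 'a) set \<Rightarrow> real" where
  "stretch_factor G \<phi> =
     (THE l. \<forall>X x. free_basis G X \<and> x \<in> carrier G \<and> \<not> periodic_class G \<phi> (conj_class G x) \<longrightarrow>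
        (\<lambda>n. root n (real (conj_length G X (out_act (\<phi> [^]\<^bsub>Out G\<^esub> n) (conj_class G x)))))
          \<longlonglongrightarrow> l)"

text \<open>The values for \<open>N < 2\<close> carry no meaning.\<close>

definition stretch_asymmetry :: "nat \<Rightarrow> ereal" where
  "stretch_asymmetry N =
     (SUP \<phi> \<in> {\<phi>. fully_irreducible (free_group N) \<phi>}.
        ereal (ln (stretch_factor (free_group N) \<phi>) /
               ln (stretch_factor (free_group N) (inv\<^bsub>Out (free_group N)\<^esub> \<phi>))))"


section \<open>The objects above are what they should be\<close>

lemma inv_letter_inv_letter [simp]: "inv_letter (inv_letter a) = a"
  by (simp add: inv_letter_def)

lemma inv_letter_neq [simp]: "inv_letter a \<noteq> a" "a \<noteq> inv_letter a"
  by (auto simp: inv_letter_def prod_eq_iff)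

lemma reduced_Nil [simp]: "reduced []"
  by (simp add: reduced_def)

lemma reduced_Cons: "reduced (a # w) \<longleftrightarrow> (w = [] \<or> hd w \<noteq> inv_letter a) \<and> reduced w"
  by (auto simp: reduced_def successively_Cons)

lemma reduced_cancel_cons: "reduced w \<Longrightarrow> reduced (cancel_cons a w)"
  by (cases w) (auto simp: reduced_Cons)

lemma set_cancel_cons: "set (cancel_cons a w) \<subseteq> insert a (set w)"
  by (cases w) auto

lemma cancel_cons_inverse: "reduced w \<Longrightarrow> cancel_cons a (cancel_cons (inv_letter a) w) = w"
  by (cases w; cases "tl w") (auto simp: reduced_Cons)

lemma cancel_cons_in:
  "a \<in> X \<times> UNIV \<Longrightarrow> w \<in> reduced_words X \<Longrightarrow> cancel_cons a w \<in> reduced_words X"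
  using set_cancel_cons[of a w] by (auto simp: reduced_words_def reduced_cancel_cons)

lemma foldr_cancel_cons_in:
  "set u \<subseteq> X \<times> UNIV \<Longrightarrow> v \<in> reduced_words X \<Longrightarrow> foldr cancel_cons u v \<in> reduced_words X"
  by (induction u) (auto intro!: cancel_cons_in)

lemma foldr_cancel_cons_reduced: "reduced v \<Longrightarrow> reduced (foldr cancel_cons u v)"
  by (induction u) (auto intro: reduced_cancel_cons)

lemma foldr_cancel_cons_step:
  assumes "reduced w"
  shows "foldr cancel_cons (cancel_cons a x) w = cancel_cons a (foldr cancel_cons x w)"
proof (cases x)
  case (Cons b y)
  then show ?thesis
    using cancel_cons_inverse[OF foldr_cancel_cons_reduced[OF assms], of a y] by simp
qed simp

lemma foldr_cancel_cons_assoc: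
  assumes "reduced w"
  shows "foldr cancel_cons (foldr cancel_cons u v) w = foldr cancel_cons u (foldr cancel_cons v w)"
  by (induction u) (simp_all add: foldr_cancel_cons_step[OF assms])

lemma foldr_cancel_cons_Nil: "reduced w \<Longrightarrow> foldr cancel_cons w [] = w"
proof (induction w)
  case (Cons a w)
  then show ?case by (cases w) (auto simp: reduced_Cons)
qed simp

lemma foldr_cancel_cons_inverse:
  "reduced v \<Longrightarrow> foldr cancel_cons (rev (map inv_letter w)) (foldr cancel_cons w v) = v"
proof (induction w arbitrary: v)
  case (Cons a w)
  then show ?case
    using cancel_cons_inverse[OF foldr_cancel_cons_reduced[OF Cons.prems, of w], of "inv_letter a"]
    by simp
qed simp

lemma reduced_rev_inv: "reduced w \<Longrightarrow> reduced (rev (map inv_letter w))"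
  unfolding reduced_def
  by (simp add: successively_map)
     (erule successively_mono, auto dest: arg_cong[where f = inv_letter])

lemma group_free_group: "group (free_group N)"
proof (rule groupI)
  fix x assume x: "x \<in> carrier (free_group N)"
  let ?y = "rev (map inv_letter x)"
  have "?y \<in> carrier (free_group N)"
    using x reduced_rev_inv[of x]
    by (auto simp: free_group_def reduced_words_def inv_letter_def)
  moreover have "?y \<otimes>\<^bsub>free_group N\<^esub> x = \<one>\<^bsub>free_group N\<^esub>"
    using x foldr_cancel_cons_inverse[of "[]" x]
    by (simp add: free_group_def reduced_words_def foldr_cancel_cons_Nil)
  ultimately show "\<exists>y\<in>carrier (free_group N). y \<otimes>\<^bsub>free_group N\<^esub> x = \<one>\<^bsub>free_group N\<^esub>"
    by blast
qed (auto simp: free_group_def reduced_words_def foldr_cancel_cons_assoc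
       intro!: foldr_cancel_cons_in[unfolded reduced_words_def, simplified]
         foldr_cancel_cons_reduced
       dest: foldr_cancel_cons_in[unfolded reduced_words_def, simplified, THEN conjunct1, THEN subsetD])

lemma free_basis_free_group: "free_basis (free_group N) ((\<lambda>i. [(i, True)]) ` {..<N})"
proof -
  let ?G = "free_group N" and ?\<iota> = "\<lambda>i::nat. [(i, True)]"
  let ?h = "map (map_prod ?\<iota> id)"
  interpret group ?G by (rule group_free_group)
  have gen: "?\<iota> i \<in> carrier ?G" if "i < N" for i
    using that by (simp add: free_group_def reduced_words_def reduced_def)
  have inv_gen: "inv\<^bsub>?G\<^esub> (?\<iota> i) = [(i, False)]" if "i < N" for i
    using that gen[OF that]
    by (intro inv_equality)
       (simp_all add: free_group_def reduced_words_def reduced_def inv_letter_def)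
  have val: "word_value ?G (?h w) = w" if "w \<in> reduced_words {..<N}" for w
    using that
  proof (induction w)
    case Nil
    then show ?case by (simp add: word_value_def free_group_def)
  next
    case (Cons a w)
    obtain i b where a: "a = (i, b)" by (cases a)
    from Cons.prems have i: "i < N" and w: "w \<in> reduced_words {..<N}"
      and red: "reduced (a # w)"
      by (auto simp: reduced_words_def reduced_Cons a)
    have "word_value ?G (?h (a # w)) = [(i, b)] \<otimes>\<^bsub>?G\<^esub> word_value ?G (?h w)"
      using inv_gen[OF i] by (simp add: a word_value_def)
    also have "\<dots> = cancel_cons a w"
      by (simp only: Cons.IH[OF w]) (simp add: free_group_def a)
    also have "\<dots> = a # w"
      using red by (cases w) (auto simp: reduced_Cons)
    finally show ?case .
  qed
  have red_h: "reduced (?h w) \<longleftrightarrow> reduced w" for w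
    by (auto simp: reduced_def successively_map inv_letter_def prod_eq_iff)
  have "reduced_words (?\<iota> ` {..<N}) = ?h ` reduced_words {..<N}"
  proof (intro equalityI subsetI)
    fix v assume v: "v \<in> reduced_words (?\<iota> ` {..<N})"
    define w where "w = map (map_prod (\<lambda>x. fst (hd x)) id) v"
    have vs: "\<forall>p\<in>set v. fst p \<in> ?\<iota> ` {..<N}"
      using v by (auto simp: reduced_words_def)
    have "?h w = v"
      unfolding w_def map_map by (rule map_idI) (use vs in \<open>force simp: prod_eq_iff\<close>)
    moreover have "set w \<subseteq> {..<N} \<times> UNIV"
      using vs by (force simp: w_def)
    ultimately show "v \<in> ?h ` reduced_words {..<N}"
      using v red_h[of w] by (auto simp: reduced_words_def image_iff intro!: exI[of _ w])
  qed (use red_h in \<open>fastforce simp: reduced_words_def\<close>)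
  moreover have "bij_betw (word_value ?G) (?h ` reduced_words {..<N}) (carrier ?G)"
    by (rule bij_betw_byWitness[where f' = ?h]) (use val in \<open>auto simp: free_group_def\<close>)
  ultimately show ?thesis
    using gen by (auto simp: free_basis_def)
qed

text \<open>With \<open>group_free_group\<close>, the results below apply to every \<open>free_group N\<close>.\<close>

context group
begin

lemma conj_by_apply: "h \<in> carrier G \<Longrightarrow> conj_by G g h = g \<otimes> h \<otimes> inv g"
  by (simp add: conj_by_def)

lemma conj_by_closed: "g \<in> carrier G \<Longrightarrow> h \<in> carrier G \<Longrightarrow> conj_by G g h \<in> carrier G"
  by (simp add: conj_by_apply)

lemma conj_by_conj_by:
  "g \<in> carrier G \<Longrightarrow> h \<in> carrier G \<Longrightarrow> x \<in> carrier G \<Longrightarrow>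
     conj_by G g (conj_by G h x) = conj_by G (g \<otimes> h) x"
  by (simp add: conj_by_apply inv_mult_group m_assoc)

lemma conj_by_one: "x \<in> carrier G \<Longrightarrow> conj_by G \<one> x = x"
  by (simp add: conj_by_apply)

lemma conj_by_auto:
  assumes "g \<in> carrier G"
  shows "conj_by G g \<in> auto G"
proof -
  have "bij_betw (conj_by G g) (carrier G) (carrier G)"
    using assms by (intro bij_betw_byWitness[where f' = "conj_by G (inv g)"])
      (auto simp: conj_by_conj_by conj_by_one conj_by_closed)
  moreover have "conj_by G g \<in> hom G G"
  proof (rule homI)
    fix x y assume xy: "x \<in> carrier G" "y \<in> carrier G"
    have "inv g \<otimes> (g \<otimes> (y \<otimes> inv g)) = y \<otimes> inv g"
      using assms xy by (simp flip: m_assoc)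
    then show "conj_by G g (x \<otimes> y) = conj_by G g x \<otimes> conj_by G g y"
      using assms xy by (simp add: conj_by_apply m_assoc)
  qed (use assms conj_by_closed in auto)
  ultimately show ?thesis
    by (auto simp: auto_def Bij_def conj_by_def)
qed

lemma carrier_AutoGroup: "carrier (AutoGroup G) = auto G"
  by (simp add: AutoGroup_def)

lemma mult_AutoGroup:
  "f \<in> auto G \<Longrightarrow> h \<in> auto G \<Longrightarrow> f \<otimes>\<^bsub>AutoGroup G\<^esub> h = compose (carrier G) f h"
  by (simp add: AutoGroup_def BijGroup_def auto_def)

lemma one_AutoGroup: "\<one>\<^bsub>AutoGroup G\<^esub> = (\<lambda>x\<in>carrier G. x)"
  by (simp add: AutoGroup_def BijGroup_def)

lemma auto_closed: "f \<in> auto G \<Longrightarrow> x \<in> carrier G \<Longrightarrow> f x \<in> carrier G"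
  by (auto simp: auto_def hom_def)

lemma auto_surj: "f \<in> auto G \<Longrightarrow> f ` carrier G = carrier G"
  by (auto simp: auto_def Bij_def bij_betw_def)

lemma auto_apply_conj_by:
  assumes "f \<in> auto G" "g \<in> carrier G" "h \<in> carrier G"
  shows "f (conj_by G g h) = conj_by G (f g) (f h)"
proof -
  interpret f: group_hom G G f
    using assms(1) by unfold_locales (simp add: auto_def)
  show ?thesis
    using assms by (simp add: conj_by_apply)
qed

lemma conj_by_mult_AutoGroup:
  "g \<in> carrier G \<Longrightarrow> h \<in> carrier G \<Longrightarrow>
     conj_by G g \<otimes>\<^bsub>AutoGroup G\<^esub> conj_by G h = conj_by G (g \<otimes> h)"
  by (rule extensionalityI[where A = "carrier G"])
     (simp_all add: mult_AutoGroup conj_by_auto compose_eq conj_by_conj_by, simp add: conj_by_def)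

lemma Inn_normal: "Inn G \<lhd> AutoGroup G"
proof -
  interpret A: group "AutoGroup G" by (rule AutoGroup)
  have inv_conj: "inv\<^bsub>AutoGroup G\<^esub> conj_by G g = conj_by G (inv g)" if "g \<in> carrier G" for g
  proof (rule A.inv_equality)
    have "conj_by G \<one> = (\<lambda>x\<in>carrier G. x)"
      by (rule extensionalityI[where A = "carrier G"]) (simp_all add: conj_by_one, simp add: conj_by_def)
    then show "conj_by G (inv g) \<otimes>\<^bsub>AutoGroup G\<^esub> conj_by G g = \<one>\<^bsub>AutoGroup G\<^esub>"
      using that by (simp add: conj_by_mult_AutoGroup one_AutoGroup)
  qed (use that in \<open>simp_all add: carrier_AutoGroup conj_by_auto\<close>)
  have "subgroup (Inn G) (AutoGroup G)"
  proof (rule A.subgroupI)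
    show "Inn G \<subseteq> carrier (AutoGroup G)"
      by (auto simp: Inn_def carrier_AutoGroup conj_by_auto)
    show "Inn G \<noteq> {}"
      by (auto simp: Inn_def)
  qed (auto simp: Inn_def inv_conj conj_by_mult_AutoGroup)
  moreover have "f \<otimes>\<^bsub>AutoGroup G\<^esub> c \<otimes>\<^bsub>AutoGroup G\<^esub> inv\<^bsub>AutoGroup G\<^esub> f \<in> Inn G"
    if f: "f \<in> carrier (AutoGroup G)" and "c \<in> Inn G" for f c
  proof -
    obtain g where g: "g \<in> carrier G" and c: "c = conj_by G g"
      using \<open>c \<in> Inn G\<close> by (auto simp: Inn_def)
    have f': "f \<in> auto G" using f by (simp add: carrier_AutoGroup)
    have "f \<otimes>\<^bsub>AutoGroup G\<^esub> c = conj_by G (f g) \<otimes>\<^bsub>AutoGroup G\<^esub> f"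
      by (rule extensionalityI[where A = "carrier G"])
         (use f' g c in \<open>simp_all add: mult_AutoGroup conj_by_auto auto_closed compose_eq
            auto_apply_conj_by\<close>)
    then have "f \<otimes>\<^bsub>AutoGroup G\<^esub> c \<otimes>\<^bsub>AutoGroup G\<^esub> inv\<^bsub>AutoGroup G\<^esub> f = conj_by G (f g)"
      using f A.inv_closed[OF f] A.m_assoc[of "conj_by G (f g)" f "inv\<^bsub>AutoGroup G\<^esub> f"]
        conj_by_auto[OF auto_closed[OF f' g]]
      by (simp add: carrier_AutoGroup)
    then show ?thesis
      using f' g by (auto simp: Inn_def auto_closed)
  qed
  ultimately show ?thesis
    by (simp add: A.normal_inv_iff)
qed

lemma group_Out: "group (Out G)"
  unfolding Out_def using Inn_normal by (rule normal.factorgroup_is_group)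

lemma Out_rep:
  assumes "\<phi> \<in> carrier (Out G)" "f \<in> \<phi>"
  shows "f \<in> auto G" "\<phi> = (\<lambda>g. compose (carrier G) (conj_by G g) f) ` carrier G"
proof -
  interpret A: group "AutoGroup G" by (rule AutoGroup)
  have sub: "subgroup (Inn G) (AutoGroup G)"
    using Inn_normal by (rule normal_imp_subgroup)
  obtain h where h: "h \<in> auto G" "\<phi> = Inn G #>\<^bsub>AutoGroup G\<^esub> h"
    using assms(1) by (auto simp: Out_def FactGroup_def RCOSETS_def carrier_AutoGroup)
  show f: "f \<in> auto G"
    using assms(2) h A.r_coset_subset_G[OF subgroup.subset[OF sub], of h]
    by (auto simp: carrier_AutoGroup)
  have "\<phi> = Inn G #>\<^bsub>AutoGroup G\<^esub> f"
    using A.repr_independence[of f "Inn G" h] assms(2) h sub by (simp add: carrier_AutoGroup)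
  also have "\<dots> = (\<lambda>g. compose (carrier G) (conj_by G g) f) ` carrier G"
    using f by (auto simp: r_coset_def Inn_def mult_AutoGroup conj_by_auto)
  finally show "\<phi> = (\<lambda>g. compose (carrier G) (conj_by G g) f) ` carrier G" .
qed

lemma out_act_conj_class:
  assumes "\<phi> \<in> carrier (Out G)" "f \<in> \<phi>" "x \<in> carrier G"
  shows "out_act \<phi> (conj_class G x) = conj_class G (f x)"
proof -
  note f = Out_rep[OF assms(1,2)]
  have eq: "compose (carrier G) (conj_by G g) f (conj_by G h x) = conj_by G (g \<otimes> f h) (f x)"
    if "g \<in> carrier G" "h \<in> carrier G" for g h
    using that assms(3) f(1)
    by (simp add: compose_eq conj_by_closed auto_apply_conj_by conj_by_conj_by auto_closed)
  show ?thesis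
  proof (intro equalityI subsetI)
    fix y assume "y \<in> out_act \<phi> (conj_class G x)"
    then show "y \<in> conj_class G (f x)"
      using eq f(1) by (force simp: out_act_def conj_class_def f(2) auto_closed)
  next
    fix y assume "y \<in> conj_class G (f x)"
    then obtain k where k: "k \<in> carrier G" "y = conj_by G k (f x)"
      by (auto simp: conj_class_def)
    have "y = compose (carrier G) (conj_by G k) f (conj_by G \<one> x)"
      using k assms(3) by (simp add: conj_by_one compose_eq)
    then show "y \<in> out_act \<phi> (conj_class G x)"
      using k by (auto simp: out_act_def conj_class_def f(2))
  qed
qed

lemma out_act_subgroup_conj_class:
  assumes "\<phi> \<in> carrier (Out G)" "f \<in> \<phi>" "H \<subseteq> carrier G"
  shows "out_act_subgroups \<phi> (subgroup_conj_class G H) = subgroup_conj_class G (f ` H)"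
proof -
  note f = Out_rep[OF assms(1,2)]
  have eq: "compose (carrier G) (conj_by G g) f ` conj_by G h ` H = conj_by G (g \<otimes> f h) ` f ` H"
    if "g \<in> carrier G" "h \<in> carrier G" for g h
    unfolding image_image using that assms(3) f(1)
    by (intro image_cong refl)
       (auto simp: compose_eq conj_by_closed auto_apply_conj_by conj_by_conj_by auto_closed)
  show ?thesis
  proof (intro equalityI subsetI)
    fix K assume "K \<in> out_act_subgroups \<phi> (subgroup_conj_class G H)"
    then obtain g h where gh: "g \<in> carrier G" "h \<in> carrier G"
      and "K = compose (carrier G) (conj_by G g) f ` conj_by G h ` H"
      by (auto simp: out_act_subgroups_def subgroup_conj_class_def f(2))
    then have "K = conj_by G (g \<otimes> f h) ` f ` H"
      using eq by simp
    then show "K \<in> subgroup_conj_class G (f ` H)"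
      using gh f(1) by (auto simp: subgroup_conj_class_def auto_closed)
  next
    fix K assume "K \<in> subgroup_conj_class G (f ` H)"
    then obtain k where k: "k \<in> carrier G" "K = conj_by G k ` f ` H"
      by (auto simp: subgroup_conj_class_def)
    have "f \<one> = \<one>"
      using f(1) hom_one[of f G G] by (simp add: auto_def group_axioms)
    then have "K = compose (carrier G) (conj_by G k) f ` conj_by G \<one> ` H"
      using k eq[of k \<one>] by simp
    then show "K \<in> out_act_subgroups \<phi> (subgroup_conj_class G H)"
      using k by (auto simp: out_act_subgroups_def subgroup_conj_class_def f(2))
  qed
qed

end

end

theory Submission
  imports Defs
begin

text \<open>For \<open>N = M + 1 \<ge> 2\<close> let \<open>\<phi>\<close> be the automorphism \<open>a\<^sub>i \<mapsto> a\<^sub>i\<^sub>+\<^sub>1\<close> for \<open>i < M\<close>, \<open>a\<^sub>M \<mapsto> a\<^sub>0 a\<^sub>M a\<^sub>M\<close>.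
  Its inverse is \<open>a\<^sub>i \<mapsto> a\<^sub>i\<^sub>-\<^sub>1\<close> for \<open>i > 0\<close>, together with \<open>a\<^sub>0 \<mapsto> a\<^sub>M a\<^sub>M\<^sub>-\<^sub>1\<inverse> a\<^sub>M\<^sub>-\<^sub>1\<inverse>\<close>. Both are train track
  maps of the rose, so their stretch factors are the Perron-Frobenius eigenvalues of the two
  transition matrices, the roots greater than 1 of \<open>x ^ (M + 1) = 2 x ^ M + 1\<close> and of
  \<open>x ^ (M + 1) = 2 x + 1\<close>. The first, \<open>lam\<close>, exceeds 2, since \<open>\<phi>\<close> doubles every
  occurrence of \<open>a\<^sub>M\<close> in a positive word at each step and adds further ones. The second
  satisfies \<open>mu ^ M \<le> 3\<close>, since the inverse replaces a letter by three letters only once it has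
  reached \<open>a\<^sub>0\<close>, at most once in \<open>M\<close> steps. Hence \<open>ln lam / ln mu \<ge> M (ln 2 / ln 3)\<close>,
  which is unbounded.

  Two facts have to be proved about these automorphisms. The first is that the stretch factor, as a
  limit over every nonperiodic class and every basis, exists and is that eigenvalue
  (\<open>growth_rate\<close>). A word is a product of finitely many legal pieces, and their number does not
  increase along the orbit. If all pieces stay short, the orbit of the conjugacy class is finite
  and therefore periodic. Otherwise some piece becomes so long that bounded cancellation cannot
  consume it, and from then on it grows exactly like the eigenvalue.

  The second fact is full irreducibility (\<open>fully_irreducible\<close>). Let \<open>F = A * B\<close> with
  \<open>A\<close> and \<open>B\<close> nontrivial. Magnus expansions yield nontrivial homomorphisms from \<open>A\<close> and
  from \<open>B\<close> to the integers (\<open>proper_free_factor_homs\<close>), hence a nonzero integral linear form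
  \<open>h\<close> on the abelianization that vanishes on \<open>A\<close>, and an \<open>a \<in> A\<close> with nonzero image there. If
  \<open>\<phi> ^ k\<close> preserved the conjugacy class of \<open>A\<close>, then \<open>h (\<phi> ^ (k j) a) = 0\<close> for all \<open>j\<close>. But \<open>lam\<close>
  is a Pisot number and a unit of degree \<open>N\<close>, so that the values of \<open>h\<close> along this orbit are
  asymptotic to a nonzero multiple of \<open>lam ^ (k j)\<close> (\<open>no_periodic_zeros\<close>).\<close>


section \<open>Words and their reduced forms\<close>

definition red :: "'a letter list \<Rightarrow> 'a letter list" where
  "red w = foldr cancel_cons w []"

definition inv_word :: "'a letter list \<Rightarrow> 'a letter list" where
  "inv_word w = rev (map inv_letter w)"

lemma reduced_red [simp]: "reduced (red w)"
  by (simp add: red_def foldr_cancel_cons_reduced)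

lemma red_id: "reduced w \<Longrightarrow> red w = w"
  by (simp add: red_def foldr_cancel_cons_Nil)

lemma red_Nil [simp]: "red [] = []"
  by (simp add: red_def)

lemma red_append: "red (u @ v) = foldr cancel_cons u (red v)"
  by (simp add: red_def)

lemma red_red_left [simp]: "red (red u @ v) = red (u @ v)"
  using foldr_cancel_cons_assoc[OF reduced_red[of v], of u "[]"]
  by (simp add: red_append) (simp add: red_def)

lemma red_red_right [simp]: "red (u @ red v) = red (u @ v)"
  by (simp add: red_append red_id)

lemma red_red [simp]: "red (red u) = red u"
  by (simp add: red_id)

lemma red_cong_append: "red u = red u' \<Longrightarrow> red v = red v' \<Longrightarrow> red (u @ v) = red (u' @ v')"
  by (metis red_red_left red_red_right)

lemma set_red: "set (red w) \<subseteq> set w"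
proof (induction w)
  case (Cons a w)
  then show ?case using set_cancel_cons[of a "red w"] by (auto simp: red_def)
qed simp

lemma inv_word_simps [simp]:
  "inv_word [] = []" "inv_word (u @ v) = inv_word v @ inv_word u"
  "inv_word (a # v) = inv_word v @ [inv_letter a]"
  "inv_word (inv_word w) = w" "length (inv_word w) = length w"
  "inv_word w = [] \<longleftrightarrow> w = []"
  by (auto simp: inv_word_def rev_map o_def)

lemma fst_inv_letter [simp]: "fst (inv_letter a) = fst a"
  by (simp add: inv_letter_def)

lemma inv_letter_eq_iff [simp]: "inv_letter a = inv_letter b \<longleftrightarrow> a = b"
  by (auto simp: inv_letter_def prod_eq_iff)

lemma set_inv_word: "set (inv_word w) = inv_letter ` set w"
  by (auto simp: inv_word_def)

lemma set_inv_word_subset [simp]: "set (inv_word w) \<subseteq> X \<times> UNIV \<longleftrightarrow> set w \<subseteq> X \<times> UNIV"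
  by (force simp: set_inv_word inv_letter_def image_subset_iff subset_iff)

lemma reduced_inv_word [simp]: "reduced (inv_word w) \<longleftrightarrow> reduced w"
  using reduced_rev_inv[of w] reduced_rev_inv[of "inv_word w"] inv_word_simps(4)[of w]
  by (auto simp: inv_word_def)

lemma red_inv_word_cancel [simp]:
  "red (inv_word u @ u @ v) = red v" "red (u @ inv_word u @ v) = red v"
proof -
  show *: "red (inv_word u @ u @ v) = red v" for u
    using foldr_cancel_cons_inverse[OF reduced_red[of v], of u]
    by (simp add: red_append inv_word_def)
  show "red (u @ inv_word u @ v) = red v" using *[of "inv_word u"] by simp
qed

lemma red_inv_word_cancel_Nil [simp]:
  "red (inv_word u @ u) = []" "red (u @ inv_word u) = []"
  using red_inv_word_cancel[of u "[]"] by simp_all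

lemma red_inv_word: "red (inv_word w) = inv_word (red w)"
proof -
  have "red (inv_word w) = red (inv_word w @ red w @ inv_word (red w))"
    by (metis append_Nil2 red_cong_append red_inv_word_cancel_Nil(2) red_Nil)
  also have "\<dots> = red (inv_word w @ w @ inv_word (red w))"
    by (intro red_cong_append) simp_all
  also have "\<dots> = inv_word (red w)"
    by (simp add: red_id)
  finally show ?thesis .
qed

lemma reduced_append:
  "reduced (u @ v) \<longleftrightarrow> reduced u \<and> reduced v \<and> (u = [] \<or> v = [] \<or> hd v \<noteq> inv_letter (last u))"
  by (auto simp: reduced_def successively_append_iff)

text \<open>Cancellation between two reduced words is confined to one block \<open>x\<close> where they meet. All
  later cancellation estimates measure this block.\<close>
lemma cancel_split:
  assumes "reduced u" "reduced v"
  obtains p x q where "u = p @ x" "v = inv_word x @ q" "red (u @ v) = p @ q"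
proof -
  have "\<exists>p x q. u = p @ x \<and> v = inv_word x @ q \<and> red (u @ v) = p @ q"
    using assms
  proof (induction u arbitrary: v rule: rev_induct)
    case Nil
    then show ?case by (auto simp: red_id)
  next
    case (snoc a u)
    show ?case
    proof (cases "v \<noteq> [] \<and> hd v = inv_letter a")
      case True
      then obtain v' where v: "v = inv_letter a # v'" by (cases v) auto
      obtain p x q where *: "u = p @ x" "v' = inv_word x @ q" "red (u @ v') = p @ q"
        using snoc.IH[of v'] snoc.prems by (auto simp: v reduced_append reduced_Cons)
      have "red ((u @ [a]) @ v) = red (u @ ([a] @ inv_word [a] @ v'))" by (simp add: v)
      also have "\<dots> = red (u @ v')"
        by (rule red_cong_append[OF refl red_inv_word_cancel(2)])
      finally show ?thesis
        using * by (intro exI[of _ p] exI[of _ "x @ [a]"] exI[of _ q]) (simp add: v)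
    next
      case False
      then have "reduced ((u @ [a]) @ v)"
        using snoc.prems by (simp only: reduced_append[of "u @ [a]" v]) auto
      then show ?thesis
        by (intro exI[of _ "u @ [a]"] exI[of _ "[]"] exI[of _ v]) (simp add: red_id)
    qed
  qed
  then show ?thesis using that by blast
qed

lemma length_red_append: "length (red (u @ v)) \<le> length (red u) + length (red v)"
proof -
  obtain p x q where "red u = p @ x" "red v = inv_word x @ q" "red (red u @ red v) = p @ q"
    using cancel_split[of "red u" "red v"] by auto
  moreover have "red (red u @ red v) = red (u @ v)" by simp
  ultimately have "red (u @ v) = p @ q" by simp
  then show ?thesis using \<open>red u = p @ x\<close> \<open>red v = inv_word x @ q\<close> by (simp del: red_red_left red_red_right)
qed

lemma length_red: "length (red w) \<le> length w"
proof (induction w)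
  case (Cons a w)
  have "length (red [a]) = 1" by (simp add: red_def)
  then show ?case using length_red_append[of "[a]" w] Cons by simp
qed simp

lemma cyclic_split:
  assumes "reduced w"
  obtains c v where "w = c @ v @ inv_word c" "cyclically_reduced v"
proof -
  have "\<exists>c v. w = c @ v @ inv_word c \<and> cyclically_reduced v"
    using assms
  proof (induction w rule: length_induct)
    case (1 w)
    show ?case
    proof (cases "cyclically_reduced w")
      case True
      then show ?thesis by (intro exI[of _ "[]"] exI[of _ w]) simp
    next
      case False
      then have w: "w \<noteq> []" "hd w = inv_letter (last w)"
        using 1 by (auto simp: cyclically_reduced_def)
      then obtain a u where a: "w = a # u" "u \<noteq> []"
        by (cases w) (auto split: if_splits)
      then obtain m b where b: "u = m @ [b]" using rev_exhaust by blast
      have ab: "b = inv_letter a" using w a b by auto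
      have "reduced m" using 1(2) by (auto simp: a b reduced_append reduced_Cons)
      then obtain c v where "m = c @ v @ inv_word c" "cyclically_reduced v"
        using 1(1)[rule_format, of m] by (auto simp: a b)
      then show ?thesis
        by (intro exI[of _ "a # c"] exI[of _ v]) (simp add: a b ab)
    qed
  qed
  then show ?thesis using that by blast
qed

abbreviation wpow :: "nat \<Rightarrow> 'a list \<Rightarrow> 'a list" where
  "wpow k w \<equiv> concat (replicate k w)"

lemma hd_wpow: "w \<noteq> [] \<Longrightarrow> k \<noteq> 0 \<Longrightarrow> hd (wpow k w) = hd w"
  by (cases k) auto

text \<open>The powers of a cyclically reduced word are reduced, so their lengths are exactly linear in
  the exponent. Cyclic lengths are compared through them.\<close>
lemma reduced_wpow: "cyclically_reduced v \<Longrightarrow> reduced (wpow k v)"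
proof (induction k)
  case (Suc k)
  then show ?case
    by (cases "v = []"; cases "k = 0")
       (auto simp: reduced_append cyclically_reduced_def hd_wpow simp del: concat_eq_Nil_conv)
qed simp

lemma length_wpow [simp]: "length (wpow k v) = k * length v"
  by (induction k) auto

lemma cyclically_reduced_rotate:
  "cyclically_reduced (u @ v) \<Longrightarrow> cyclically_reduced (v @ u)"
  by (cases "u = []"; cases "v = []") (auto simp: cyclically_reduced_def reduced_append)

section \<open>Cyclically reduced length with respect to a free basis\<close>

lemma carrier_free_group:
  "w \<in> carrier (free_group N) \<longleftrightarrow> set w \<subseteq> {..<N} \<times> UNIV \<and> reduced w"
  by (simp add: free_group_def reduced_words_def)

lemma mult_free_group: "reduced v \<Longrightarrow> u \<otimes>\<^bsub>free_group N\<^esub> v = red (u @ v)"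
  by (simp add: free_group_def red_append red_id)

lemma one_free_group: "\<one>\<^bsub>free_group N\<^esub> = []"
  by (simp add: free_group_def)

lemma inv_free_group:
  assumes "w \<in> carrier (free_group N)"
  shows "inv\<^bsub>free_group N\<^esub> w = inv_word w"
proof -
  interpret group "free_group N" by (rule group_free_group)
  show ?thesis
    using assms
    by (intro inv_equality) (simp_all add: mult_free_group one_free_group carrier_free_group)
qed

lemma red_in_carrier_free_group:
  "set w \<subseteq> {..<N} \<times> UNIV \<Longrightarrow> red w \<in> carrier (free_group N)"
  using set_red[of w] by (auto simp: carrier_free_group)

lemma pow_free_group:
  assumes "w \<in> carrier (free_group N)"
  shows "w [^]\<^bsub>free_group N\<^esub> k = red (wpow k w)"
proof -
  interpret group "free_group N" by (rule group_free_group)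
  show ?thesis
  proof (induction k)
    case (Suc k)
    have "w [^]\<^bsub>free_group N\<^esub> Suc k = w \<otimes>\<^bsub>free_group N\<^esub> w [^]\<^bsub>free_group N\<^esub> k"
      using assms by (rule nat_pow_Suc2)
    then show ?case by (simp add: Suc mult_free_group)
  qed (simp add: one_free_group)
qed

context group
begin

lemma word_value_Nil [simp]: "word_value G [] = \<one>"
  by (simp add: word_value_def)

lemma word_value_Cons:
  "word_value G (a # w) = (if snd a then fst a else inv (fst a)) \<otimes> word_value G w"
  by (cases a) (simp add: word_value_def)

lemma word_value_closed:
  assumes "X \<subseteq> carrier G" "set w \<subseteq> X \<times> UNIV"
  shows "word_value G w \<in> carrier G"
  using assms(2)
proof (induction w)
  case (Cons a w)
  then show ?case using assms(1) by (cases a) (auto simp: word_value_Cons)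
qed simp

lemma word_value_append:
  assumes X: "X \<subseteq> carrier G" and "set u \<subseteq> X \<times> UNIV" "set v \<subseteq> X \<times> UNIV"
  shows "word_value G (u @ v) = word_value G u \<otimes> word_value G v"
  using assms(2)
proof (induction u)
  case Nil
  show ?case using word_value_closed[OF X assms(3)] by simp
next
  case (Cons a u)
  then have "fst a \<in> carrier G" using X by auto
  then show ?case
    using Cons word_value_closed[OF X assms(3)] word_value_closed[OF X, of u]
    by (auto simp: word_value_Cons m_assoc)
qed

lemma word_value_red:
  assumes X: "X \<subseteq> carrier G" and "set w \<subseteq> X \<times> UNIV"
  shows "word_value G (red w) = word_value G w"
  using assms(2)
proof (induction w)
  case (Cons a w)
  let ?r = "red w"
  have a: "fst a \<in> carrier G" using Cons X by auto
  have r: "set ?r \<subseteq> X \<times> UNIV" using Cons set_red[of w] by auto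
  have "word_value G (cancel_cons a ?r) = word_value G (a # ?r)"
  proof (cases ?r)
    case (Cons b v)
    have v: "word_value G v \<in> carrier G"
      using word_value_closed[OF X, of v] r Cons by simp
    show ?thesis
      using a v by (auto simp: Cons word_value_Cons inv_letter_def simp flip: m_assoc)
  qed simp
  then show ?case using Cons by (simp add: red_def word_value_Cons)
qed simp

lemma word_value_inv_word:
  assumes X: "X \<subseteq> carrier G" and "set w \<subseteq> X \<times> UNIV"
  shows "word_value G (inv_word w) = inv (word_value G w)"
proof -
  have *: "set (inv_word w) \<subseteq> X \<times> UNIV" using assms by simp
  have "word_value G (inv_word w) \<otimes> word_value G w = word_value G (red (inv_word w @ w))"
    using word_value_append[OF X * assms(2)] word_value_red[OF X, of "inv_word w @ w"] assms(2) *
    by (simp del: red_inv_word_cancel_Nil)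
  then show ?thesis
    using word_value_closed[OF X *] word_value_closed[OF assms] inv_equality by simp
qed

lemma set_wpow: "set w \<subseteq> A \<Longrightarrow> set (wpow k w) \<subseteq> A"
  by (induction k) auto

lemma word_value_wpow:
  assumes X: "X \<subseteq> carrier G" and "set w \<subseteq> X \<times> UNIV"
  shows "word_value G (wpow k w) = word_value G w [^] k"
proof (induction k)
  case (Suc k)
  have "word_value G (wpow (Suc k) w) = word_value G w \<otimes> word_value G (wpow k w)"
    using word_value_append[OF X assms(2) set_wpow[OF assms(2)]] by simp
  then show ?case
    using nat_pow_Suc2[OF word_value_closed[OF assms]] by (simp add: Suc)
qed simp

lemma free_basis_word:
  assumes "free_basis G X" "g \<in> carrier G"
  obtains w where "set w \<subseteq> X \<times> UNIV" "reduced w" "word_value G w = g"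
proof -
  have "g \<in> word_value G ` reduced_words X"
    using assms by (simp add: free_basis_def bij_betw_def)
  then show ?thesis using that by (auto simp: reduced_words_def)
qed

lemma free_basis_red_eq:
  assumes "free_basis G X" "set u \<subseteq> X \<times> UNIV" "set v \<subseteq> X \<times> UNIV"
    and "word_value G u = word_value G v"
  shows "red u = red v"
proof -
  have X: "X \<subseteq> carrier G" and inj: "inj_on (word_value G) (reduced_words X)"
    using assms(1) by (auto simp: free_basis_def bij_betw_def)
  have "word_value G (red u) = word_value G (red v)"
    using assms by (simp add: word_value_red[OF X])
  then show ?thesis
    using inj assms(2,3) set_red[of u] set_red[of v]
    by (auto dest!: inj_onD simp: reduced_words_def)
qed

lemma pow_conj_by:
  assumes "g \<in> carrier G" "x \<in> carrier G"
  shows "(conj_by G g x) [^] (k::nat) = conj_by G g (x [^] k)"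
proof (induction k)
  case (Suc k)
  have "g \<otimes> (x [^] k \<otimes> x) \<otimes> inv g = (g \<otimes> x [^] k \<otimes> inv g) \<otimes> (g \<otimes> x \<otimes> inv g)"
    using assms by (metis inv_closed m_assoc m_closed nat_pow_closed inv_solve_left)
  then show ?case using assms Suc by (simp add: conj_by_apply)
qed (use assms in \<open>simp add: conj_by_apply\<close>)

text \<open>A power of \<open>v\<close> is at most as long as the same power of \<open>v'\<close> plus twice the conjugating word, and
  the length of the power of \<open>v\<close> is linear in the exponent.\<close>
lemma cyclically_reduced_length_le:
  assumes fb: "free_basis G X" and v: "set v \<subseteq> X \<times> UNIV" "cyclically_reduced v"
    and v': "set v' \<subseteq> X \<times> UNIV" and g: "g \<in> carrier G"
    and eq: "word_value G v = conj_by G g (word_value G v')"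
  shows "length v \<le> length v'"
proof -
  have X: "X \<subseteq> carrier G" using fb by (simp add: free_basis_def)
  obtain c where c: "set c \<subseteq> X \<times> UNIV" "word_value G c = g"
    using free_basis_word[OF fb g] by blast
  have le: "k * length v \<le> 2 * length c + k * length v'" for k
  proof -
    let ?u = "c @ wpow k v' @ inv_word c"
    have "word_value G ?u = g \<otimes> word_value G v' [^] k \<otimes> inv g"
      using c v' g word_value_closed[OF X v'] set_wpow[OF v', of k]
      by (simp add: word_value_append[OF X] set_wpow[OF v'] word_value_wpow[OF X]
          word_value_inv_word[OF X] m_assoc)
    also have "\<dots> = word_value G (wpow k v)"
      using pow_conj_by[OF g word_value_closed[OF X v'], of k] word_value_closed[OF X v']
      by (simp add: word_value_wpow[OF X v(1)] eq conj_by_apply)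
    finally have "red (wpow k v) = red ?u"
      using v v' c by (intro free_basis_red_eq[OF fb]) (auto simp: set_wpow)
    then have "wpow k v = red ?u"
      by (simp add: red_id reduced_wpow v)
    then have "length (wpow k v) \<le> length ?u" using length_red[of ?u] by metis
    then show ?thesis by simp
  qed
  show ?thesis
  proof (rule ccontr)
    assume "\<not> ?thesis"
    then obtain d where "length v = length v' + Suc d" using less_imp_Suc_add not_le by fastforce
    then show False using le[of "Suc (2 * length c)"] by (simp add: algebra_simps)
  qed
qed

text \<open>Two cyclically reduced words for the same class are not longer than each other, so the
  definite description in \<^const>\<open>conj_length\<close> is well defined.\<close>
lemma conj_length_eq:
  assumes fb: "free_basis G X" and x: "x \<in> carrier G"
    and v: "set v \<subseteq> X \<times> UNIV" "cyclically_reduced v" "word_value G v \<in> conj_class G x"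
  shows "conj_length G X (conj_class G x) = length v"
  unfolding conj_length_def
proof (rule the_equality)
  fix n
  assume "\<exists>w. set w \<subseteq> X \<times> UNIV \<and> cyclically_reduced w \<and> word_value G w \<in> conj_class G x \<and> length w = n"
  then obtain w where w: "set w \<subseteq> X \<times> UNIV" "cyclically_reduced w" "word_value G w \<in> conj_class G x"
    and n: "length w = n" by blast
  have conj: "\<exists>k\<in>carrier G. a = conj_by G k b" if "a \<in> conj_class G x" "b \<in> conj_class G x" for a b
  proof -
    obtain g where g: "g \<in> carrier G" "a = conj_by G g x"
      using \<open>a \<in> conj_class G x\<close> unfolding conj_class_def by (elim imageE)
    obtain h where h: "h \<in> carrier G" "b = conj_by G h x"
      using \<open>b \<in> conj_class G x\<close> unfolding conj_class_def by (elim imageE)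
    note gh = g(1) h(1) g(2) h(2)
    have "conj_by G (g \<otimes> inv h) b = conj_by G (g \<otimes> inv h \<otimes> h) x"
      using x gh by (simp add: conj_by_conj_by)
    also have "g \<otimes> inv h \<otimes> h = g"
      using gh by (simp add: m_assoc)
    finally have "a = conj_by G (g \<otimes> inv h) b" by (simp only: gh(3))
    then show ?thesis using g(1) h(1) by (intro bexI[of _ "g \<otimes> inv h"]) simp_all
  qed
  obtain g where "g \<in> carrier G" "word_value G v = conj_by G g (word_value G w)"
    using conj[OF v(3) w(3)] by blast
  then have "length v \<le> length w"
    by (rule cyclically_reduced_length_le[OF fb v(1,2) w(1)])
  moreover obtain h where "h \<in> carrier G" "word_value G w = conj_by G h (word_value G v)"
    using conj[OF w(3) v(3)] by blast
  then have "length w \<le> length v"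
    by (rule cyclically_reduced_length_le[OF fb w(1,2) v(1)])
  ultimately show "n = length v" using n by simp
qed (intro exI[of _ v], simp add: v)

lemma cyclic_word:
  assumes fb: "free_basis G X" and w: "set w \<subseteq> X \<times> UNIV"
  obtains c v where "set c \<subseteq> X \<times> UNIV" "set v \<subseteq> X \<times> UNIV"
    "cyclically_reduced v" "red w = c @ v @ inv_word c"
    "word_value G w = conj_by G (word_value G c) (word_value G v)"
    "word_value G v \<in> conj_class G (word_value G w)"
proof -
  have X: "X \<subseteq> carrier G" using fb by (simp add: free_basis_def)
  obtain c v where cv: "red w = c @ v @ inv_word c" "cyclically_reduced v"
    using cyclic_split[OF reduced_red] by blast
  have c: "set c \<subseteq> X \<times> UNIV" and v: "set v \<subseteq> X \<times> UNIV"
    using set_red[of w] w by (auto simp: cv)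
  have gc: "word_value G c \<in> carrier G" and gv: "word_value G v \<in> carrier G"
    using c v by (auto intro: word_value_closed[OF X])
  have "word_value G w = word_value G (red w)" by (simp add: word_value_red[OF X w])
  also have "\<dots> = conj_by G (word_value G c) (word_value G v)"
    using c v gc gv by (simp add: cv word_value_append[OF X] word_value_inv_word[OF X]
        conj_by_apply m_assoc)
  finally have eq: "word_value G w = conj_by G (word_value G c) (word_value G v)" .
  then have "word_value G v = conj_by G (inv (word_value G c)) (word_value G w)"
    using gc gv by (simp add: conj_by_conj_by conj_by_one)
  then have "word_value G v \<in> conj_class G (word_value G w)"
    using gc by (auto simp: conj_class_def)
  then show ?thesis using that c v cv eq by blast
qed

lemma conj_length_le:
  assumes fb: "free_basis G X" and w: "set w \<subseteq> X \<times> UNIV"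
  shows "conj_length G X (conj_class G (word_value G w)) \<le> length w"
proof -
  have X: "X \<subseteq> carrier G" using fb by (simp add: free_basis_def)
  obtain c v where cv: "set v \<subseteq> X \<times> UNIV" "cyclically_reduced v"
    "red w = c @ v @ inv_word c" "word_value G v \<in> conj_class G (word_value G w)"
    by (rule cyclic_word[OF assms]) blast
  have "conj_length G X (conj_class G (word_value G w)) = length v"
    using conj_length_eq[OF fb word_value_closed[OF X w] cv(1,2,4)] .
  also have "\<dots> \<le> length (red w)" by (simp add: cv(3))
  finally show ?thesis using length_red[of w] by simp
qed

end

text \<open>A free basis is finite because the finitely many words that spell the standard generators
  involve only finitely many elements of it.\<close>
lemma free_basis_spelling:
  assumes fb: "free_basis (free_group N) X"
  shows "finite X \<and> (\<exists>K. \<forall>g\<in>carrier (free_group N).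
       \<exists>w. set w \<subseteq> X \<times> UNIV \<and> word_value (free_group N) w = g \<and> length w \<le> K * length g)"
proof -
  let ?G = "free_group N"
  interpret group ?G by (rule group_free_group)
  have X: "X \<subseteq> carrier ?G" using fb by (simp add: free_basis_def)
  have gen: "[(i, b)] \<in> carrier ?G" if "i < N" for i b
    using that by (simp add: carrier_free_group reduced_Cons)
  have "\<exists>w. set w \<subseteq> X \<times> UNIV \<and> word_value ?G w = [(i, True)]" if "i < N" for i
    using free_basis_word[OF fb gen[OF that]] by blast
  then have "\<exists>W. \<forall>i<N. set (W i) \<subseteq> X \<times> UNIV \<and> word_value ?G (W i) = [(i, True)]"
    by (intro choice) blast
  then obtain W where W: "\<And>i. i < N \<Longrightarrow> set (W i) \<subseteq> X \<times> UNIV"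
    "\<And>i. i < N \<Longrightarrow> word_value ?G (W i) = [(i, True)]"
    by blast
  \<comment> \<open>the basis elements occurring in words for the standard generators\<close>
  define Y where "Y = (\<Union>i<N. fst ` set (W i))"
  define K where "K = (\<Sum>i<N. length (W i))"
  have YX: "Y \<subseteq> X" using W(1) unfolding Y_def by fastforce
  have Y: "Y \<subseteq> carrier ?G" using YX X by blast
  have fin: "finite Y" by (simp add: Y_def)
  have spell: "\<exists>w. set w \<subseteq> Y \<times> UNIV \<and> word_value ?G w = g \<and> length w \<le> K * length g"
    if "g \<in> carrier ?G" for g
    using that
  proof (induction g)
    case Nil
    then show ?case by (intro exI[of _ "[]"]) (simp add: one_free_group)
  next
    case (Cons a g)
    obtain i b where a: "a = (i, b)" by fastforce
    have i: "i < N" and g: "g \<in> carrier ?G"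
      using Cons.prems by (auto simp: a carrier_free_group reduced_Cons)
    obtain w where w: "set w \<subseteq> Y \<times> UNIV" "word_value ?G w = g" "length w \<le> K * length g"
      using Cons.IH[OF g] by blast
    let ?u = "if b then W i else inv_word (W i)"
    have Wi: "set (W i) \<subseteq> Y \<times> UNIV"
    proof
      fix p assume "p \<in> set (W i)"
      then have "fst p \<in> Y" using i by (auto simp: Y_def)
      then show "p \<in> Y \<times> UNIV" by (cases p) auto
    qed
    have u: "set ?u \<subseteq> Y \<times> UNIV" using Wi by simp
    have "word_value ?G ?u = [(i, b)]"
      using word_value_inv_word[OF Y Wi] inv_free_group[OF gen[OF i, of True]] W(2)[OF i]
      by (simp add: inv_letter_def)
    then have "word_value ?G (?u @ w) = [a] \<otimes>\<^bsub>?G\<^esub> g"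
      using word_value_append[OF Y u w(1)] w(2) by (simp add: a)
    also have "\<dots> = a # g"
      using Cons.prems g by (simp add: mult_free_group carrier_free_group red_id)
    finally have "word_value ?G (?u @ w) = a # g" .
    moreover have "length ?u \<le> K"
      using i using member_le_sum[of i "{..<N}" "\<lambda>i. length (W i)"] by (simp add: K_def)
    ultimately show ?case
      using u w by (intro exI[of _ "?u @ w"]) (auto split: if_splits)
  qed
  have "X \<subseteq> Y"
  proof
    fix x assume x: "x \<in> X"
    then obtain w where w: "set w \<subseteq> Y \<times> UNIV" "word_value ?G w = x"
      using spell X by blast
    have "red [(x, True)] = red w"
      using x X w YX by (intro free_basis_red_eq[OF fb]) (auto simp: word_value_Cons)
    then have "[(x, True)] = red w" by (simp add: red_id reduced_Cons)
    then have "(x, True) \<in> set (red w)" by (metis list.set_intros(1))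
    then have "(x, True) \<in> set w" using set_red[of w] by blast
    then show "x \<in> Y" using w by auto
  qed
  then have "X = Y" using YX by blast
  then show ?thesis using fin spell by blast
qed

lemma length_word_value_le:
  assumes "X \<subseteq> carrier (free_group N)" "finite X"
  shows "\<exists>K>0. \<forall>w. set w \<subseteq> X \<times> UNIV \<longrightarrow> length (word_value (free_group N) w) \<le> K * length w"
proof -
  let ?G = "free_group N"
  interpret group ?G by (rule group_free_group)
  define K where "K = Suc (\<Sum>x\<in>X. length x)"
  have "length (word_value ?G w) \<le> K * length w" if "set w \<subseteq> X \<times> UNIV" for w
    using that
  proof (induction w)
    case (Cons a w)
    let ?h = "if snd a then fst a else inv\<^bsub>?G\<^esub> (fst a)"
    have a: "fst a \<in> X" using Cons.prems by auto
    then have "length (fst a) \<le> (\<Sum>x\<in>X. length x)" using assms by (simp add: member_le_sum)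
    then have "length ?h \<le> K"
      using a assms by (auto simp: K_def inv_free_group)
    moreover have "reduced (word_value ?G w)" 
      using word_value_closed[OF assms(1), of w] Cons.prems by (simp add: carrier_free_group)
    then have "length (word_value ?G (a # w)) \<le> length ?h + length (word_value ?G w)"
      using length_red[of "?h @ word_value ?G w"] by (simp add: word_value_Cons mult_free_group)
    ultimately show ?case using Cons by simp
  qed (simp add: one_free_group)
  moreover have "K > 0" by (simp add: K_def)
  ultimately show ?thesis by blast
qed

text \<open>Bases change cyclic lengths only by bounded factors. The upper bound suffices for the length
  of any representative, the lower bound needs a linear lower bound for the powers, because a
  single word may be long only through a conjugating part.\<close>
lemma conj_length_upper:
  assumes fb: "free_basis (free_group N) X"
  shows "\<exists>K>0. \<forall>x\<in>carrier (free_group N).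
    conj_length (free_group N) X (conj_class (free_group N) x) \<le> K * length x"
proof -
  interpret group "free_group N" by (rule group_free_group)
  obtain K where K: "\<forall>g\<in>carrier (free_group N).
       \<exists>w. set w \<subseteq> X \<times> UNIV \<and> word_value (free_group N) w = g \<and> length w \<le> K * length g"
    using free_basis_spelling[OF fb] by blast
  have "conj_length (free_group N) X (conj_class (free_group N) x) \<le> Suc K * length x"
    if x: "x \<in> carrier (free_group N)" for x
  proof -
    obtain w where "set w \<subseteq> X \<times> UNIV" "word_value (free_group N) w = x" "length w \<le> K * length x"
      using K x by blast
    then show ?thesis using conj_length_le[OF fb, of w] by simp
  qed
  then show ?thesis by blast
qed

lemma conj_length_lower:
  assumes fb: "free_basis (free_group N) X"
  shows "\<exists>K>0. \<forall>x\<in>carrier (free_group N). \<forall>r::real.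
    (\<forall>k. real k * r \<le> length (red (wpow k x))) \<longrightarrow>
    r \<le> real (K * conj_length (free_group N) X (conj_class (free_group N) x))"
proof -
  let ?G = "free_group N"
  interpret group ?G by (rule group_free_group)
  have X: "X \<subseteq> carrier ?G" using fb by (simp add: free_basis_def)
  have fin: "finite X" using free_basis_spelling[OF fb] by blast
  obtain K where K0: "K > 0"
    and K: "\<And>w. set w \<subseteq> X \<times> UNIV \<Longrightarrow> length (word_value ?G w) \<le> K * length w"
    using length_word_value_le[OF X fin] by blast
  have "r \<le> real (K * conj_length ?G X (conj_class ?G x))"
    if x: "x \<in> carrier ?G" and le: "\<And>k. real k * r \<le> length (red (wpow k x))" for x and r :: real
  proof -
    obtain w where w: "set w \<subseteq> X \<times> UNIV" "word_value ?G w = x"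
      using free_basis_word[OF fb x] by blast
    obtain c v where cv: "set c \<subseteq> X \<times> UNIV" "set v \<subseteq> X \<times> UNIV" "cyclically_reduced v"
      "x = conj_by ?G (word_value ?G c) (word_value ?G v)" "word_value ?G v \<in> conj_class ?G x"
      by (rule cyclic_word[OF fb w(1), unfolded w(2)]) blast
    have len: "conj_length ?G X (conj_class ?G x) = length v"
      using conj_length_eq[OF fb x cv(2,3,5)] .
    \<comment> \<open>the conjugating part costs a constant, so that k can go to infinity\<close>
    have bound: "real k * (r - K * length v) \<le> 2 * K * length c" for k
    proof -
      let ?u = "c @ wpow k v @ inv_word c"
      have gc: "word_value ?G c \<in> carrier ?G" and gv: "word_value ?G v \<in> carrier ?G"
        using cv by (auto intro: word_value_closed[OF X])
      have u: "set ?u \<subseteq> X \<times> UNIV" using cv set_wpow[OF cv(2)] by auto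
      have "word_value ?G ?u = conj_by ?G (word_value ?G c) (word_value ?G v [^]\<^bsub>?G\<^esub> k)"
        using cv gc gv set_wpow[OF cv(2), of k]
        by (simp add: word_value_append[OF X] word_value_wpow[OF X]
            word_value_inv_word[OF X] conj_by_apply m_assoc)
      also have "\<dots> = red (wpow k x)"
        using pow_conj_by[OF gc gv, of k] pow_free_group[OF x, of k] by (simp add: cv(4))
      finally have "length (red (wpow k x)) \<le> K * length ?u" using K[OF u] by simp
      then have "real k * r \<le> real (K * length ?u)" using le[of k] of_nat_mono[of "length (red (wpow k x))" "K * length ?u"] by linarith
      then show ?thesis by (simp add: algebra_simps)
    qed
    have "r - K * length v \<le> 0"
    proof (rule ccontr)
      assume "\<not> ?thesis"
      then have pos: "r - K * length v > 0" by simp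
      obtain k :: nat where "real k * (r - K * length v) > 2 * K * length c"
        using reals_Archimedean3[OF pos] by blast
      then show False using bound[of k] by simp
    qed
    then show ?thesis by (simp add: len)
  qed
  then show ?thesis using K0 by blast
qed


section \<open>Substitutions and bounded cancellation\<close>

text \<open>A substitution \<open>s\<close> gives the images of the positive letters. It extends to inverse letters
  and to words; reducing the result gives the homomorphism \<open>ext s\<close> of free groups.\<close>
definition subst_letter :: "('a \<Rightarrow> 'b letter list) \<Rightarrow> 'a letter \<Rightarrow> 'b letter list" where
  "subst_letter s a = (if snd a then s (fst a) else inv_word (s (fst a)))"

definition subst :: "('a \<Rightarrow> 'b letter list) \<Rightarrow> 'a letter list \<Rightarrow> 'b letter list" where
  "subst s w = concat (map (subst_letter s) w)"

definition ext :: "('a \<Rightarrow> 'b letter list) \<Rightarrow> 'a letter list \<Rightarrow> 'b letter list" where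
  "ext s w = red (subst s w)"

lemma subst_simps [simp]:
  "subst s [] = []" "subst s (a # w) = subst_letter s a @ subst s w"
  "subst s (u @ v) = subst s u @ subst s v"
  by (simp_all add: subst_def)

lemma subst_letter_inv_letter [simp]:
  "subst_letter s (inv_letter a) = inv_word (subst_letter s a)"
  by (simp add: subst_letter_def inv_letter_def)

lemma subst_inv_word: "subst s (inv_word w) = inv_word (subst s w)"
  by (induction w) simp_all

lemma ext_Nil [simp]: "ext s [] = []"
  by (simp add: ext_def)

lemma reduced_ext [simp]: "reduced (ext s w)"
  by (simp add: ext_def)

lemma ext_append: "ext s (u @ v) = red (ext s u @ ext s v)"
  by (simp add: ext_def)

lemma ext_red [simp]: "ext s (red w) = ext s w"
proof (induction w)
  case (Cons a w)
  have "ext s (red (a # w)) = ext s (cancel_cons a (red w))" by (simp add: red_def)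
  also have "\<dots> = ext s (a # red w)"
  proof (cases "red w")
    case (Cons b v)
    then show ?thesis by (auto simp: ext_def)
  qed simp
  also have "\<dots> = ext s (a # w)"
    using Cons by (auto simp: ext_def intro: red_cong_append)
  finally show ?case .
qed simp

lemma ext_inv_word: "ext s (inv_word w) = inv_word (ext s w)"
  by (simp add: ext_def subst_inv_word red_inv_word)

lemma ext_ext_id:
  assumes "\<And>i. ext t (s i) = [(i, True)]"
  shows "ext t (ext s w) = red w"
proof -
  have letter: "ext t (subst_letter s a) = [a]" for a
    using assms by (cases a) (auto simp: subst_letter_def ext_inv_word inv_letter_def)
  have "ext t (subst s w) = red w" for w
  proof (induction w)
    case (Cons a w)
    then show ?case
      by (simp add: ext_append letter red_red_right flip: append_Cons)
        (metis append_Cons append_Nil red_red_right)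
  qed simp
  then show ?thesis by (simp add: ext_def[of s])
qed

lemma set_subst:
  assumes "\<And>i. i \<in> X \<Longrightarrow> set (s i) \<subseteq> Y \<times> UNIV" "set w \<subseteq> X \<times> UNIV"
  shows "set (subst s w) \<subseteq> Y \<times> UNIV"
  using assms(2)
proof (induction w)
  case (Cons a w)
  then have "fst a \<in> X" by auto
  then have "set (subst_letter s a) \<subseteq> Y \<times> UNIV" using assms(1) by (simp add: subst_letter_def)
  then show ?case using Cons by simp
qed simp

lemma set_ext:
  assumes "\<And>i. i \<in> X \<Longrightarrow> set (s i) \<subseteq> Y \<times> UNIV" "set w \<subseteq> X \<times> UNIV"
  shows "set (ext s w) \<subseteq> Y \<times> UNIV"
  using set_subst[of X s Y w, OF assms] set_red[of "subst s w"] by (simp add: ext_def)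

lemma length_ext_le:
  assumes "\<And>i. length (s i) \<le> L"
  shows "length (ext s w) \<le> L * length w"
proof -
  have "length (subst s w) \<le> L * length w"
  proof (induction w)
    case (Cons a w)
    have "length (subst_letter s a) \<le> L" using assms by (simp add: subst_letter_def)
    then show ?case using Cons by simp
  qed simp
  then show ?thesis using length_red[of "subst s w"] by (simp add: ext_def)
qed

text \<open>The images of the prefixes of \<open>u\<close> form a path in the Cayley tree with steps of length at most
  \<open>L\<close>; in a tree, such a path passes within \<open>L\<close> of every vertex \<open>y\<close> of the geodesic between its
  ends.\<close>
lemma prefix_near_image:
  assumes L: "\<And>i. length (s i) \<le> L" and "ext s u = y @ z"
  shows "\<exists>u1 u2. u = u1 @ u2 \<and> length (red (inv_word y @ ext s u1)) \<le> L"
  using assms(2)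
proof (induction u arbitrary: z rule: rev_induct)
  case Nil
  then show ?case by (intro exI[of _ "[]"]) simp
next
  case (snoc a u)
  have len: "length (ext s [a]) \<le> L"
    using length_ext_le[of s L "[a]", OF L] by simp
  obtain p x q where *: "ext s u = p @ x" "ext s [a] = inv_word x @ q"
    "red (ext s u @ ext s [a]) = p @ q"
    by (rule cancel_split[OF reduced_ext reduced_ext])
  then have eq: "y @ z = p @ q" using snoc.prems by (simp add: ext_append)
  show ?case
  proof (cases "length y \<le> length p")
    case True
    then obtain p' where "p = y @ p'" using eq by (auto simp: append_eq_append_conv2)
    then have "ext s u = y @ (p' @ x)" using * by simp
    then obtain u1 u2 where "u = u1 @ u2" "length (red (inv_word y @ ext s u1)) \<le> L"
      using snoc.IH by blast
    then show ?thesis by (intro exI[of _ u1] exI[of _ "u2 @ [a]"]) simp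
  next
    \<comment> \<open>the last step jumps over the vertex y\<close>
    case False
    then obtain q' where q': "y = p @ q'" "q = q' @ z"
      using eq by (auto simp: append_eq_append_conv2)
    have "red (inv_word y @ ext s (u @ [a])) = red (inv_word y @ y @ z)"
      using snoc.prems by simp
    also have "\<dots> = red z" by (rule red_inv_word_cancel)
    finally have "length (red (inv_word y @ ext s (u @ [a]))) \<le> length z"
      using length_red[of z] by simp
    also have "length z \<le> L" using len * q' by simp
    finally show ?thesis by (intro exI[of _ "u @ [a]"] exI[of _ "[]"]) simp
  qed
qed

text \<open>This is Thurston's bounded cancellation lemma. The vertex where the cancelled block \<open>x\<close> ends
  lies near the image of a prefix of \<open>v\<close> and near the image of a prefix of the inverse of \<open>u\<close>.
  These images are close to each other, so, as the inverse map is Lipschitz, the two prefixes are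
  close. Because \<open>u @ v\<close> is reduced, their distance is the sum of their lengths. Hence both
  prefixes are short, and so is \<open>x\<close>.\<close>
lemma bounded_cancellation:
  assumes inv: "\<And>i. ext t (s i) = [(i, True)]"
    and L: "\<And>i. length (s i) \<le> L" "\<And>i. length (t i) \<le> L"
    and red: "reduced (u @ v)" and split: "ext s u = p @ x" "ext s v = inv_word x @ q"
  shows "length x \<le> L + 2 * L * L * L"
proof -
  obtain v1 v2 where v: "v = v1 @ v2" "length (red (x @ ext s v1)) \<le> L"
    using prefix_near_image[of s L v "inv_word x" q, OF L(1) split(2)] by auto
  have "ext s (inv_word u) = inv_word x @ inv_word p" using split by (simp add: ext_inv_word)
  then obtain u1 u2 where u: "inv_word u = u1 @ u2" "length (red (x @ ext s u1)) \<le> L"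
    using prefix_near_image[of s L "inv_word u" "inv_word x", OF L(1)] by auto
  have u': "u = inv_word u2 @ inv_word u1"
    using u(1) by (metis inv_word_simps(2,4))
  have "ext s (inv_word u1 @ v1) = red (inv_word (red (x @ ext s u1)) @ red (x @ ext s v1))"
  proof -
    have "red (inv_word (red (x @ ext s u1)) @ red (x @ ext s v1))
        = red (inv_word (x @ ext s u1) @ x @ ext s v1)"
      by (simp flip: red_inv_word)
    also have "\<dots> = red (inv_word (ext s u1) @ inv_word x @ x @ ext s v1)" by simp
    also have "\<dots> = red (inv_word (ext s u1) @ ext s v1)"
      by (rule red_cong_append) simp_all
    finally show ?thesis by (simp add: ext_append ext_inv_word)
  qed
  then have "length (ext s (inv_word u1 @ v1)) \<le> 2 * L"
    using length_red_append[of "inv_word (red (x @ ext s u1))" "red (x @ ext s v1)"] u(2) v(2)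
    by (simp add: red_id)
  moreover have "ext t (ext s (inv_word u1 @ v1)) = inv_word u1 @ v1"
    using red by (simp add: ext_ext_id[OF inv] u' v reduced_append red_id)
      (auto simp: reduced_append intro!: red_id)
  ultimately have "length (inv_word u1 @ v1) \<le> L * (2 * L)"
    using length_ext_le[of t L "ext s (inv_word u1 @ v1)", OF L(2)] mult_le_mono2 order_trans by metis
  then have v1: "length v1 \<le> 2 * L * L" by simp
  have "length x \<le> length (red (x @ ext s v1)) + length (ext s v1)"
  proof -
    have "x = red (red (x @ ext s v1) @ inv_word (ext s v1))"
    proof -
      have "red (red (x @ ext s v1) @ inv_word (ext s v1)) = red (x @ ext s v1 @ inv_word (ext s v1))"
        by simp
      also have "\<dots> = red (x @ [])" by (rule red_cong_append) simp_all
      also have "\<dots> = x" using reduced_ext[of s v] split(2) by (simp add: reduced_append red_id)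
      finally show ?thesis by simp
    qed
    then show ?thesis
      using length_red[of "red (x @ ext s v1) @ inv_word (ext s v1)"] by (metis inv_word_simps(5) length_append)
  qed
  also have "length (ext s v1) \<le> L * (2 * L * L)"
    using length_ext_le[of s L v1, OF L(1)] v1 mult_le_mono2 order_trans by metis
  finally show ?thesis using v(2) by simp
qed

definition wt :: "('a \<Rightarrow> real) \<Rightarrow> 'a letter list \<Rightarrow> real" where
  "wt l w = (\<Sum>a\<leftarrow>w. l (fst a))"

lemma wt_simps [simp]:
  "wt l [] = 0" "wt l (a # w) = l (fst a) + wt l w" "wt l (u @ v) = wt l u + wt l v"
  by (simp_all add: wt_def)

lemma wt_inv_word [simp]: "wt l (inv_word w) = wt l w"
  by (induction w) simp_all

lemma wt_nonneg:
  assumes "\<And>i. i \<in> X \<Longrightarrow> l i \<ge> 0" "set w \<subseteq> X \<times> UNIV"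
  shows "wt l w \<ge> 0"
  using assms(2)
proof (induction w)
  case (Cons a w)
  then show ?case using assms(1)[of "fst a"] by auto
qed simp

lemma wt_bounds:
  fixes m M :: real
  assumes "\<And>i. i \<in> X \<Longrightarrow> m \<le> l i" "\<And>i. i \<in> X \<Longrightarrow> l i \<le> M" "set w \<subseteq> X \<times> UNIV"
  shows "m * length w \<le> wt l w" "wt l w \<le> M * length w"
  using assms(3)
proof (induction w)
  case (Cons a w)
  {
    case 1
    then show ?case using assms(1)[of "fst a"] Cons by (auto simp: algebra_simps)
  next
    case 2
    then show ?case using assms(2)[of "fst a"] Cons by (auto simp: algebra_simps)
  }
qed simp_all

lemma wt_red_append:
  assumes "\<And>i. i \<in> X \<Longrightarrow> l i \<ge> 0" "reduced u" "reduced v" "set u \<subseteq> X \<times> UNIV"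
  shows "wt l (red (u @ v)) \<le> wt l u + wt l v"
proof -
  obtain p x q where *: "u = p @ x" "v = inv_word x @ q" "red (u @ v) = p @ q"
    by (rule cancel_split[OF assms(2,3)])
  have "wt l x \<ge> 0" using assms by (intro wt_nonneg[of X]) (auto simp: *)
  then show ?thesis unfolding *(3) by (simp add: *)
qed

lemma wt_red:
  assumes "\<And>i. i \<in> X \<Longrightarrow> l i \<ge> 0" "set w \<subseteq> X \<times> UNIV"
  shows "wt l (red w) \<le> wt l w"
  using assms(2)
proof (induction w)
  case (Cons a w)
  have "red (a # w) = red ([a] @ red w)" using red_red_right[of "[a]" w] by simp
  also have "wt l \<dots> \<le> wt l [a] + wt l (red w)"
    using Cons.prems by (intro wt_red_append[of X]) (auto simp: assms(1) reduced_Cons)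
  finally show ?case using Cons by simp
qed simp


section \<open>Conjugacy, legal pieces and orbits of substitutions\<close>

text \<open>Conjugacy at the level of words, with conjugating words over the alphabet \<open>X\<close>.
  \<open>conjugate_words_class\<close> and \<open>class_conjugate_words\<close> relate it to conjugacy classes.\<close>
definition conjugate_words :: "'a set \<Rightarrow> 'a letter list \<Rightarrow> 'a letter list \<Rightarrow> bool" where
  "conjugate_words X x y \<longleftrightarrow> (\<exists>g. set g \<subseteq> X \<times> UNIV \<and> x = red (g @ y @ inv_word g))"

lemma conjugate_words_refl: "reduced x \<Longrightarrow> conjugate_words X x x"
  unfolding conjugate_words_def by (intro exI[of _ "[]"]) (simp add: red_id)

lemma conjugate_words_trans:
  assumes "conjugate_words X x y" "conjugate_words X y z"
  shows "conjugate_words X x z"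
proof -
  obtain g h where g: "set g \<subseteq> X \<times> UNIV" "x = red (g @ y @ inv_word g)"
    and h: "set h \<subseteq> X \<times> UNIV" "y = red (h @ z @ inv_word h)"
    using assms unfolding conjugate_words_def by blast
  have "x = red (g @ red (y @ inv_word g))" by (simp add: g(2))
  also have "\<dots> = red (g @ h @ z @ inv_word h @ inv_word g)"
    by (simp add: h(2) del: red_red_right) simp
  finally show ?thesis
    using g(1) h(1) unfolding conjugate_words_def by (intro exI[of _ "g @ h"]) simp
qed

lemma conjugate_words_rotate:
  assumes "set u \<subseteq> X \<times> UNIV" "reduced (u @ v)"
  shows "conjugate_words X (u @ v) (red (v @ u))"
proof -
  have "red (u @ red (v @ u) @ inv_word u) = red (u @ red (red (v @ u) @ inv_word u))"
    unfolding red_red_right ..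
  also have "\<dots> = red ((u @ v) @ u @ inv_word u)" by simp
  also have "\<dots> = red ((u @ v) @ [])" by (rule red_cong_append) simp_all
  also have "\<dots> = u @ v" using assms by (simp add: red_id)
  finally show ?thesis using assms(1) unfolding conjugate_words_def by (intro exI[of _ u]) simp
qed

lemma conjugate_words_class:
  assumes "conjugate_words {..<N} x y" "y \<in> carrier (free_group N)"
  shows "conj_class (free_group N) x = conj_class (free_group N) y"
proof -
  let ?G = "free_group N"
  interpret group ?G by (rule group_free_group)
  obtain g where g: "set g \<subseteq> {..<N} \<times> UNIV" "x = red (g @ y @ inv_word g)"
    using assms unfolding conjugate_words_def by blast
  let ?g = "red g"
  have rg: "?g \<in> carrier ?G" using g(1) by (rule red_in_carrier_free_group)
  have "conj_by ?G ?g y = red (?g @ red (y @ inv_word ?g))"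
    using rg assms(2)
    by (simp add: conj_by_apply m_assoc inv_free_group mult_free_group carrier_free_group)
  also have "\<dots> = red (?g @ red (y @ red (inv_word g)))"
    by (simp only: red_inv_word)
  also have "\<dots> = x" by (simp add: g(2))
  finally have x: "x = conj_by ?G ?g y" by simp
  show ?thesis
  proof (intro equalityI subsetI)
    fix z assume "z \<in> conj_class ?G x"
    then obtain h where h: "h \<in> carrier ?G" "z = conj_by ?G h x"
      unfolding conj_class_def by (elim imageE)
    have "z = conj_by ?G (h \<otimes>\<^bsub>?G\<^esub> ?g) y"
      using h rg assms(2) by (simp add: x conj_by_conj_by)
    moreover have "h \<otimes>\<^bsub>?G\<^esub> ?g \<in> carrier ?G" using h rg by simp
    ultimately show "z \<in> conj_class ?G y" unfolding conj_class_def by (rule image_eqI)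
  next
    fix z assume "z \<in> conj_class ?G y"
    then obtain h where h: "h \<in> carrier ?G" "z = conj_by ?G h y"
      unfolding conj_class_def by (elim imageE)
    have "conj_by ?G (h \<otimes>\<^bsub>?G\<^esub> inv\<^bsub>?G\<^esub> ?g) x = conj_by ?G ((h \<otimes>\<^bsub>?G\<^esub> inv\<^bsub>?G\<^esub> ?g) \<otimes>\<^bsub>?G\<^esub> ?g) y"
      using h rg assms(2) unfolding x by (intro conj_by_conj_by) simp_all
    also have "(h \<otimes>\<^bsub>?G\<^esub> inv\<^bsub>?G\<^esub> ?g) \<otimes>\<^bsub>?G\<^esub> ?g = h"
      using h rg by (simp add: m_assoc)
    finally have "z = conj_by ?G (h \<otimes>\<^bsub>?G\<^esub> inv\<^bsub>?G\<^esub> ?g) x" using h by simp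
    moreover have "h \<otimes>\<^bsub>?G\<^esub> inv\<^bsub>?G\<^esub> ?g \<in> carrier ?G" using h rg by simp
    ultimately show "z \<in> conj_class ?G x" unfolding conj_class_def by (rule image_eqI)
  qed
qed

lemma class_conjugate_words:
  assumes "conj_class (free_group N) x = conj_class (free_group N) y"
    "x \<in> carrier (free_group N)" "y \<in> carrier (free_group N)"
  shows "conjugate_words {..<N} x y"
proof -
  let ?G = "free_group N"
  interpret group ?G by (rule group_free_group)
  have "x \<in> conj_class ?G x"
    unfolding conj_class_def using assms(2) by (intro image_eqI[of _ _ "\<one>\<^bsub>?G\<^esub>"]) (simp_all add: conj_by_one)
  then have "x \<in> conj_class ?G y" by (simp add: assms(1))
  then obtain h where h: "h \<in> carrier ?G" "x = conj_by ?G h y"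
    unfolding conj_class_def by (elim imageE)
  have "x = red (h @ y @ inv_word h)"
    using h assms(3) by (simp add: conj_by_apply m_assoc inv_free_group mult_free_group carrier_free_group)
  then show ?thesis using h(1) unfolding conjugate_words_def carrier_free_group by blast
qed

text \<open>Here \<open>T\<close> is the relation of legal turns. Since empty pieces are allowed, \<open>k\<close> is an upper
  bound for the number of legal pieces.\<close>
definition pieces :: "('a letter \<Rightarrow> 'a letter \<Rightarrow> bool) \<Rightarrow> nat \<Rightarrow> 'a letter list \<Rightarrow> bool" where
  "pieces T k w \<longleftrightarrow> (\<exists>ws. length ws = k \<and> concat ws = w \<and> (\<forall>p\<in>set ws. successively T p))"

lemma pieces_Suc:
  "pieces T (Suc k) w \<longleftrightarrow> (\<exists>p v. w = p @ v \<and> successively T p \<and> pieces T k v)"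
proof
  assume "pieces T (Suc k) w"
  then obtain p ws where "length ws = k" "w = p @ concat ws" "successively T p"
    "\<forall>p\<in>set ws. successively T p"
    unfolding pieces_def by (auto simp: length_Suc_conv)
  then show "\<exists>p v. w = p @ v \<and> successively T p \<and> pieces T k v"
    unfolding pieces_def by blast
next
  assume "\<exists>p v. w = p @ v \<and> successively T p \<and> pieces T k v"
  then obtain p ws where "length ws = k" "w = p @ concat ws" "successively T p"
    "\<forall>p\<in>set ws. successively T p"
    unfolding pieces_def by blast
  then show "pieces T (Suc k) w" unfolding pieces_def by (intro exI[of _ "p # ws"]) simp
qed

lemma pieces_0 [simp]: "pieces T 0 w \<longleftrightarrow> w = []"
  by (auto simp: pieces_def)

lemma pieces_Nil [simp]: "pieces T k []"
  by (induction k) (auto simp: pieces_Suc intro!: exI[of _ "[]"])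

lemma pieces_length: "pieces T (length w) w"
proof (induction w)
  case (Cons a w)
  then show ?case unfolding list.size add_Suc_right add_0_right pieces_Suc
    by (intro exI[of _ "[a]"] exI[of _ w]) simp
qed simp

lemma pieces_append_dest:
  "pieces T k (u @ v) \<Longrightarrow> pieces T k u \<and> pieces T k v"
proof (induction k arbitrary: u v)
  case (Suc k)
  obtain p r where *: "u @ v = p @ r" "successively T p" "pieces T k r"
    using Suc.prems unfolding pieces_Suc by blast
  from *(1) consider m where "u = p @ m" "r = m @ v" | m where "p = u @ m" "v = m @ r"
    by (auto simp: append_eq_append_conv2)
  then show ?case
  proof cases
    case 1
    then have "pieces T k m" "pieces T k v" using Suc.IH[of m v] *(3) by simp_all
    then have "pieces T (Suc k) u" unfolding pieces_Suc using 1 *(2) by blast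
    moreover have "pieces T (Suc k) v"
      unfolding pieces_Suc using \<open>pieces T k v\<close> by (intro exI[of _ "[]"] exI[of _ v]) simp
    ultimately show ?thesis by blast
  next
    case 2
    then have "successively T u" "successively T m" using *(2) by (auto simp: successively_append_iff)
    then have "pieces T (Suc k) v" unfolding pieces_Suc using 2 *(3) by blast
    moreover have "pieces T (Suc k) u"
      unfolding pieces_Suc using \<open>successively T u\<close> by (intro exI[of _ u] exI[of _ "[]"]) simp
    ultimately show ?thesis by blast
  qed
qed simp

text \<open>Cancellation happens only where two legal pieces meet, so it shortens the pieces but
  creates no new ones.\<close>
lemma pieces_red:
  assumes T: "\<And>p. successively T p \<Longrightarrow> reduced p"
  shows "pieces T k w \<Longrightarrow> pieces T k (red w)"
proof (induction k arbitrary: w)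
  case (Suc k)
  obtain p r where *: "w = p @ r" "successively T p" "pieces T k r"
    using Suc.prems unfolding pieces_Suc by blast
  obtain a x b where ab: "p = a @ x" "red r = inv_word x @ b" "red (p @ red r) = a @ b"
    by (rule cancel_split[OF T[OF *(2)] reduced_red])
  have "successively T a" using *(2) ab(1) by (simp add: successively_append_iff)
  moreover have "pieces T k b" using Suc.IH[OF *(3)] pieces_append_dest[of T k "inv_word x" b] by (simp add: ab(2))
  ultimately have "pieces T (Suc k) (a @ b)" unfolding pieces_Suc by blast
  then show ?case using ab(3) by (simp add: *(1))
qed simp

lemma pieces_long:
  fixes K :: real
  assumes "pieces T k w" "wt l w > k * K"
  obtains u p v where "w = u @ p @ v" "successively T p" "wt l p > K"
proof -
  have "\<exists>u p v. w = u @ p @ v \<and> successively T p \<and> wt l p > K"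
    using assms
  proof (induction k arbitrary: w)
    case (Suc k)
    obtain p r where *: "w = p @ r" "successively T p" "pieces T k r"
      using Suc.prems(1) unfolding pieces_Suc by blast
    show ?case
    proof (cases "wt l p > K")
      case True
      then show ?thesis using *(1,2) by (intro exI[of _ "[]"] exI[of _ p] exI[of _ r]) simp
    next
      case False
      have "wt l w = wt l p + wt l r" by (simp add: *(1))
      moreover have "real (Suc k) * K = K + k * K" by (simp add: algebra_simps)
      ultimately have "wt l r > k * K" using Suc.prems(2) False by linarith
      then obtain u q v where "r = u @ q @ v" "successively T q" "wt l q > K"
        using Suc.IH[OF *(3)] by blast
      then show ?thesis using *(1) by (intro exI[of _ "p @ u"] exI[of _ q] exI[of _ v]) simp
    qed
  qed simp
  then show ?thesis using that by blast
qed

text \<open>Substitutions inducing mutually inverse automorphisms of the free group on all naturals that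
  preserve the subgroup on the first \<open>N\<close> letters. The bound \<open>L\<close> is a Lipschitz constant for both.\<close>
locale inverse_substs =
  fixes N :: nat and s t :: "nat \<Rightarrow> nat letter list" and L :: nat
  assumes t_s: "\<And>i. ext t (s i) = [(i, True)]" and s_t: "\<And>i. ext s (t i) = [(i, True)]"
    and length_le: "\<And>i. length (s i) \<le> L" "\<And>i. length (t i) \<le> L"
    and set_s: "\<And>i. i < N \<Longrightarrow> set (s i) \<subseteq> {..<N} \<times> UNIV"
    and set_t: "\<And>i. i < N \<Longrightarrow> set (t i) \<subseteq> {..<N} \<times> UNIV"
begin

lemma inverse: "inverse_substs N t s L"
  by unfold_locales (rule t_s s_t length_le set_s set_t; assumption?)+

lemma ext_in_words: "set w \<subseteq> {..<N} \<times> UNIV \<Longrightarrow> set (ext s w) \<subseteq> {..<N} \<times> UNIV"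
  by (rule set_ext[of "{..<N}"]) (use set_s in auto)

abbreviation iter :: "nat \<Rightarrow> nat letter list \<Rightarrow> nat letter list" where
  "iter n \<equiv> ext s ^^ n"

lemma iter_in_words: "set w \<subseteq> {..<N} \<times> UNIV \<Longrightarrow> set (iter n w) \<subseteq> {..<N} \<times> UNIV"
  by (induction n) (simp_all add: ext_in_words)

lemma reduced_iter: "reduced w \<Longrightarrow> reduced (iter n w)"
  by (cases n) simp_all

lemma iter_carrier: "w \<in> carrier (free_group N) \<Longrightarrow> iter n w \<in> carrier (free_group N)"
  using iter_in_words reduced_iter by (simp add: carrier_free_group)

lemma iter_red_append: "iter n (red (u @ v)) = red (iter n u @ iter n v)"
  by (induction n) (simp_all add: ext_append)

lemma iter_append: "reduced (u @ v) \<Longrightarrow> iter n (u @ v) = red (iter n u @ iter n v)"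
  using iter_red_append[of n u v] by (simp add: red_id)

lemma iter_red: "iter n (red u) = red (iter n u)"
  by (induction n) (simp_all add: red_id)

lemma iter_inv_word: "iter n (inv_word w) = inv_word (iter n w)"
  by (induction n) (simp_all add: ext_inv_word)

lemma iter_wpow: "red (wpow k (iter n w)) = iter n (red (wpow k w))"
proof (induction k)
  case 0
  show ?case by (induction n) simp_all
next
  case (Suc k)
  have "red (wpow (Suc k) (iter n w)) = red (iter n w @ red (wpow k (iter n w)))" by simp
  also have "\<dots> = red (iter n w @ red (iter n (wpow k w)))" by (simp only: Suc iter_red)
  finally show ?case by (simp add: iter_red_append)
qed

lemma conjugate_iter:
  assumes "conjugate_words {..<N} x y"
  shows "conjugate_words {..<N} (iter n x) (iter n y)"
proof -
  obtain g where g: "set g \<subseteq> {..<N} \<times> UNIV" "x = red (g @ y @ inv_word g)"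
    using assms unfolding conjugate_words_def by blast
  have "iter n x = red (iter n g @ iter n (red (y @ inv_word g)))"
    using iter_red_append[of n g "red (y @ inv_word g)"] g(2) by simp
  also have "\<dots> = red (iter n g @ iter n y @ inv_word (iter n g))"
    by (simp add: iter_red_append iter_inv_word)
  finally show ?thesis
    using iter_in_words[OF g(1)] unfolding conjugate_words_def by blast
qed

lemma inverse_iter: "reduced w \<Longrightarrow> (ext t ^^ n) (iter n w) = w"
proof (induction n)
  case (Suc n)
  have "(ext t ^^ Suc n) (iter (Suc n) w) = (ext t ^^ n) (ext t (ext s (iter n w)))"
    by (simp add: funpow_swap1)
  also have "\<dots> = (ext t ^^ n) (iter n w)"
    using Suc.prems by (simp add: ext_ext_id[OF t_s] red_id reduced_iter)
  finally show ?case using Suc by simp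
qed simp

text \<open>Only finitely many conjugacy classes have a representative of bounded length, so an orbit
  of bounded classes repeats; as the map is invertible, the first repetition is the starting
  point.\<close>
lemma bounded_orbit_periodic:
  assumes x: "x \<in> carrier (free_group N)"
    and B: "\<And>n. \<exists>v. v \<in> carrier (free_group N) \<and> length v \<le> B \<and> conjugate_words {..<N} (iter n x) v"
  obtains n where "n \<ge> 1" "conjugate_words {..<N} (iter n x) x"
proof -
  let ?G = "free_group N" and ?A = "{v. set v \<subseteq> {..<N} \<times> (UNIV::bool set) \<and> length v \<le> B}"
  have "finite ?A" by (rule finite_lists_length_le) simp
  have "range (\<lambda>n. conj_class ?G (iter n x)) \<subseteq> conj_class ?G ` ?A"
  proof
    fix c assume "c \<in> range (\<lambda>n. conj_class ?G (iter n x))"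
    then obtain n where c: "c = conj_class ?G (iter n x)" by blast
    obtain v where v: "v \<in> carrier ?G" "length v \<le> B" "conjugate_words {..<N} (iter n x) v"
      using B by blast
    then have "c = conj_class ?G v" using conjugate_words_class c by blast
    then show "c \<in> conj_class ?G ` ?A" using v by (simp add: carrier_free_group)
  qed
  then have "\<not> inj (\<lambda>n. conj_class ?G (iter n x))"
    using \<open>finite ?A\<close> by (meson finite_imageI finite_subset range_inj_infinite)
  then obtain a b where ab: "a \<noteq> b" "conj_class ?G (iter a x) = conj_class ?G (iter b x)"
    by (auto simp: inj_def)
  have "\<exists>i j. i < j \<and> conj_class ?G (iter j x) = conj_class ?G (iter i x)"
  proof (cases "a < b")
    case True
    then show ?thesis using ab(2) by (intro exI[of _ a] exI[of _ b]) simp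
  next
    case False
    then show ?thesis using ab by (intro exI[of _ b] exI[of _ a]) simp
  qed
  then obtain i j where ij: "i < j" "conj_class ?G (iter j x) = conj_class ?G (iter i x)" by blast
  have x': "reduced x" using x by (simp add: carrier_free_group)
  have "conjugate_words {..<N} (iter j x) (iter i x)"
    by (intro class_conjugate_words ij iter_carrier x)
  then have "conjugate_words {..<N} ((ext t ^^ i) (iter j x)) ((ext t ^^ i) (iter i x))"
    by (rule inverse_substs.conjugate_iter[OF inverse])
  moreover have "iter j x = iter i (iter (j - i) x)"
    using ij(1) funpow_add[of i "j - i" "ext s"] by simp
  ultimately have "conjugate_words {..<N} (iter (j - i) x) x"
    using x' by (simp add: inverse_iter reduced_iter)
  then show ?thesis using that[of "j - i"] ij(1) by simp
qed

end


section \<open>Growth under a train track map of the rose\<close>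

lemma successively_inv_word:
  assumes "\<And>a b. T a b \<Longrightarrow> T (inv_letter b) (inv_letter a)" "successively T w"
  shows "successively T (inv_word w)"
proof -
  have "successively (\<lambda>a b. T (inv_letter b) (inv_letter a)) w"
    using assms(2) by (rule successively_mono) (use assms(1) in auto)
  then show ?thesis by (simp add: inv_word_def successively_map)
qed

text \<open>Train track maps of the rose with \<open>N\<close> petals: images of letters are legal words, and legal
  turns go to legal turns, so iterates of legal words never cancel. The lengths \<open>l\<close> of the petals
  form an eigenvector of the transition matrix, so that legal words are stretched by exactly
  \<open>lam\<close>.\<close>
locale train_track = inverse_substs +
  fixes l :: "nat \<Rightarrow> real" and lam :: real and T :: "nat letter \<Rightarrow> nat letter \<Rightarrow> bool"
  assumes N_pos: "N > 0" and l_pos: "\<And>i. i < N \<Longrightarrow> l i > 0" and lam: "lam > 1"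
    and wt_s: "\<And>i. i < N \<Longrightarrow> wt l (s i) = lam * l i"
    and T_reduced: "\<And>a b. T a b \<Longrightarrow> b \<noteq> inv_letter a"
    and T_inv: "\<And>a b. T a b \<Longrightarrow> T (inv_letter b) (inv_letter a)"
    and T_step: "\<And>a b. fst a < N \<Longrightarrow> fst b < N \<Longrightarrow> T a b \<Longrightarrow>
       T (last (subst_letter s a)) (hd (subst_letter s b))"
    and T_s: "\<And>i. i < N \<Longrightarrow> s i \<noteq> [] \<and> successively T (s i)"
begin

lemma legal_reduced: "successively T p \<Longrightarrow> reduced p"
  unfolding reduced_def by (erule successively_mono) (use T_reduced in auto)

lemma legal_subst_letter:
  assumes "fst a < N"
  shows "subst_letter s a \<noteq> []" "successively T (subst_letter s a)"
  using T_s[OF assms] successively_inv_word[of T, OF T_inv] by (auto simp: subst_letter_def)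

lemma legal_subst:
  assumes "set p \<subseteq> {..<N} \<times> UNIV" "successively T p"
  shows "successively T (subst s p)"
  using assms
proof (induction p)
  case (Cons a p)
  have a: "fst a < N" using Cons.prems by auto
  show ?case
  proof (cases p)
    case Nil
    then show ?thesis using legal_subst_letter[OF a] by simp
  next
    case (Cons b q)
    have b: "fst b < N" using Cons.prems Cons by auto
    have "T a b" using Cons.prems Cons by simp
    then have "T (last (subst_letter s a)) (hd (subst s p))"
      using T_step[OF a b] legal_subst_letter[OF b] Cons by simp
    moreover have "successively T (subst s p)"
      using Cons.IH Cons.prems Cons by simp
    ultimately show ?thesis
      using legal_subst_letter[OF a] by (simp add: successively_append_iff)
  qed
qed simp

lemma wt_subst: "set w \<subseteq> {..<N} \<times> UNIV \<Longrightarrow> wt l (subst s w) = lam * wt l w"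
proof (induction w)
  case (Cons a w)
  then have "fst a < N" by auto
  then have "wt l (subst_letter s a) = lam * l (fst a)" by (simp add: subst_letter_def wt_s)
  then show ?case using Cons by (simp add: algebra_simps)
qed simp

lemma legal_ext:
  assumes "set p \<subseteq> {..<N} \<times> UNIV" "successively T p"
  shows "successively T (ext s p)" "wt l (ext s p) = lam * wt l p"
proof -
  have "ext s p = subst s p"
    using legal_reduced[OF legal_subst[OF assms]] by (simp add: ext_def red_id)
  then show "successively T (ext s p)" "wt l (ext s p) = lam * wt l p"
    using legal_subst[OF assms] wt_subst[OF assms(1)] by simp_all
qed

lemma legal_iter:
  assumes "set p \<subseteq> {..<N} \<times> UNIV" "successively T p"
  shows "successively T (iter n p) \<and> wt l (iter n p) = lam ^ n * wt l p"
proof (induction n)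
  case (Suc n)
  then show ?case using legal_ext[of "iter n p"] iter_in_words[OF assms(1)] by simp
qed (use assms in simp)

lemma wt_nonneg_words: "set w \<subseteq> {..<N} \<times> UNIV \<Longrightarrow> wt l w \<ge> 0"
  by (rule wt_nonneg[of "{..<N}"]) (auto intro: less_imp_le l_pos)

lemma wt_red_le: "set w \<subseteq> {..<N} \<times> UNIV \<Longrightarrow> wt l (red w) \<le> wt l w"
  by (rule wt_red[of "{..<N}"]) (auto intro: less_imp_le l_pos)

lemma wt_ext_le: "set w \<subseteq> {..<N} \<times> UNIV \<Longrightarrow> wt l (ext s w) \<le> lam * wt l w"
  unfolding ext_def
  using wt_red_le[of "subst s w"] set_subst[of "{..<N}" s "{..<N}" w] set_s wt_subst[of w] by auto

lemma wt_iter_le: "set w \<subseteq> {..<N} \<times> UNIV \<Longrightarrow> wt l (iter n w) \<le> lam ^ n * wt l w"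
proof (induction n)
  case (Suc n)
  have "wt l (iter (Suc n) w) \<le> lam * wt l (iter n w)"
    using wt_ext_le iter_in_words[OF Suc.prems] by simp
  also have "\<dots> \<le> lam * (lam ^ n * wt l w)"
    using Suc lam by (intro mult_left_mono) auto
  finally show ?case by (simp add: mult_ac)
qed simp

definition l_max :: real where "l_max = Max (l ` {..<N})"
definition l_min :: real where "l_min = Min (l ` {..<N})"

lemma l_max: "i < N \<Longrightarrow> l i \<le> l_max"
  by (simp add: l_max_def)

lemma l_min: "i < N \<Longrightarrow> l_min \<le> l i"
  by (simp add: l_min_def)

lemma l_min_pos: "l_min > 0"
proof -
  have "l ` {..<N} \<noteq> {}" using N_pos by auto
  then show ?thesis unfolding l_min_def using l_pos by (subst Min_gr_iff) auto
qed

lemma l_max_pos: "l_max > 0"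
  using l_max[OF N_pos] l_pos[OF N_pos] by simp

lemma wt_length:
  assumes "set w \<subseteq> {..<N} \<times> UNIV"
  shows "l_min * length w \<le> wt l w" "wt l w \<le> l_max * length w"
  using wt_bounds[of "{..<N}" l_min l l_max w] l_max l_min assms by auto

definition cancellation :: real where
  "cancellation = l_max * real (L + 2 * L * L * L)"

lemma cancellation_nonneg: "cancellation \<ge> 0"
  using l_max_pos by (simp add: cancellation_def)

lemma wt_cancelled:
  assumes "reduced (u @ v)" "set v \<subseteq> {..<N} \<times> UNIV"
    and "ext s u = p @ x" "ext s v = inv_word x @ q"
  shows "wt l x \<le> cancellation"
proof -
  have "set (inv_word x @ q) \<subseteq> {..<N} \<times> UNIV"
    using ext_in_words[OF assms(2)] by (simp only: assms(4))
  then have "set x \<subseteq> {..<N} \<times> UNIV" by simp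
  then have "wt l x \<le> l_max * length x" by (rule wt_length)
  also have "\<dots> \<le> cancellation"
    unfolding cancellation_def
    using bounded_cancellation[OF t_s length_le assms(1,3,4)] l_max_pos
    by (intro mult_left_mono) (simp_all only: of_nat_le_iff less_imp_le)
  finally show ?thesis .
qed

text \<open>The cancellation of \<open>ext s\<close> is at most a constant, and each later application
  stretches the cancelled block by at most \<open>lam\<close>. So the cancellation of the iterate is bounded by a
  geometric sum, which is still comparable with \<open>lam ^ n\<close>.\<close>
lemma iter_cancellation:
  assumes "reduced (u @ v)" "set u \<subseteq> {..<N} \<times> UNIV" "set v \<subseteq> {..<N} \<times> UNIV"
  shows "wt l (iter n u) + wt l (iter n v)
    \<le> wt l (iter n (u @ v)) + 2 * cancellation * (\<Sum>j<n. lam ^ j)"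
  using assms
proof (induction n arbitrary: u v)
  case (Suc n)
  obtain p x q where *: "ext s u = p @ x" "ext s v = inv_word x @ q"
    "red (ext s u @ ext s v) = p @ q"
    by (rule cancel_split[OF reduced_ext reduced_ext])
  have words: "set p \<subseteq> {..<N} \<times> UNIV" "set x \<subseteq> {..<N} \<times> UNIV" "set q \<subseteq> {..<N} \<times> UNIV"
    using ext_in_words[OF Suc.prems(2)] ext_in_words[OF Suc.prems(3)] * by auto
  have red: "reduced (p @ x)" "reduced (inv_word x @ q)"
    using reduced_ext[of s u] reduced_ext[of s v] * by simp_all
  have x: "wt l (iter n x) \<le> lam ^ n * cancellation"
  proof -
    have "wt l (iter n x) \<le> lam ^ n * wt l x" using words(2) by (rule wt_iter_le)
    also have "\<dots> \<le> lam ^ n * cancellation"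
      using wt_cancelled[OF Suc.prems(1,3) *(1,2)] lam by (intro mult_left_mono) auto
    finally show ?thesis .
  qed
  have sub: "wt l (iter n (a @ b)) \<le> wt l (iter n a) + wt l (iter n b)"
    if "reduced (a @ b)" "set a \<subseteq> {..<N} \<times> UNIV" "set b \<subseteq> {..<N} \<times> UNIV" for a b
    unfolding iter_append[OF that(1)]
    using wt_red_le[of "iter n a @ iter n b"] iter_in_words that(2,3) by simp
  have "wt l (iter (Suc n) u) + wt l (iter (Suc n) v)
      = wt l (iter n (p @ x)) + wt l (iter n (inv_word x @ q))"
    by (simp add: funpow_swap1 *)
  also have "\<dots> \<le> wt l (iter n p) + wt l (iter n q) + 2 * (lam ^ n * cancellation)"
    using sub[OF red(1)] sub[OF red(2)] words x by (simp add: iter_inv_word)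
  also have "\<dots> \<le> wt l (iter n (p @ q)) + 2 * cancellation * (\<Sum>j<n. lam ^ j)
      + 2 * (lam ^ n * cancellation)"
    using Suc.IH[of p q] words reduced_red[of "ext s u @ ext s v"] *(3) by simp
  also have "iter n (p @ q) = iter (Suc n) (u @ v)"
    by (simp add: funpow_swap1 ext_append *(3)[symmetric])
  finally show ?case by (simp add: algebra_simps)
qed simp

lemma geometric_le: "(\<Sum>j<n. lam ^ j) \<le> lam ^ n / (lam - 1)"
  using lam geometric_sum[of lam n] by (simp add: divide_right_mono)

text \<open>A legal segment \<open>p\<close> of a cyclic word contributes \<open>lam ^ n\<close> times its length to the image,
  up to the cancellation at its two ends, which costs at most a fixed multiple of \<open>lam ^ n\<close>. The
  constant subtracted from the length of \<open>p\<close> is independent of \<open>n\<close>.\<close>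
lemma wt_iter_wpow:
  assumes "cyclically_reduced (p @ r)" "set (p @ r) \<subseteq> {..<N} \<times> UNIV" "successively T p"
  shows "real k * (lam ^ n * (wt l p - 4 * cancellation / (lam - 1)))
    \<le> wt l (iter n (wpow k (p @ r)))"
proof (induction k)
  case 0
  show ?case using wt_nonneg_words[OF iter_in_words[of "[]"]] by simp
next
  case (Suc k)
  let ?c = "2 * cancellation * (\<Sum>j<n. lam ^ j)" and ?w = "wpow k (p @ r)"
  have c: "?c \<le> 2 * cancellation * (lam ^ n / (lam - 1))"
    using cancellation_nonneg geometric_le by (intro mult_left_mono) auto
  have w: "set ?w \<subseteq> {..<N} \<times> UNIV" using assms(2) by (induction k) auto
  have red: "reduced (p @ r @ ?w)"
    using reduced_wpow[OF assms(1), of "Suc k"] by simp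
  then have red': "reduced (r @ ?w)" by (simp add: reduced_append)
  have "wt l (iter n p) + wt l (iter n (r @ ?w)) \<le> wt l (iter n (p @ r @ ?w)) + ?c"
    using iter_cancellation[OF red] assms(2) w by simp
  moreover have "wt l (iter n r) + wt l (iter n ?w) \<le> wt l (iter n (r @ ?w)) + ?c"
    using iter_cancellation[OF red'] assms(2) w by simp
  moreover have "wt l (iter n p) = lam ^ n * wt l p"
    using legal_iter assms by simp
  moreover have "wt l (iter n r) \<ge> 0"
    using wt_nonneg_words iter_in_words assms(2) by simp
  ultimately have "lam ^ n * wt l p - 2 * (2 * cancellation * (lam ^ n / (lam - 1))) + wt l (iter n ?w)
      \<le> wt l (iter n (p @ r @ ?w))"
    using c by linarith
  moreover have "real (Suc k) * (lam ^ n * (wt l p - 4 * cancellation / (lam - 1)))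
      = real k * (lam ^ n * (wt l p - 4 * cancellation / (lam - 1)))
        + (lam ^ n * wt l p - 2 * (2 * cancellation * (lam ^ n / (lam - 1))))"
    by (simp add: algebra_simps add_divide_distrib)
  ultimately have "real (Suc k) * (lam ^ n * (wt l p - 4 * cancellation / (lam - 1)))
      \<le> wt l (iter n (p @ r @ ?w))"
    using Suc by linarith
  moreover have "wpow (Suc k) (p @ r) = p @ r @ ?w" by simp
  ultimately show ?case by (simp only:)
qed

text \<open>A substitution maps legal pieces to legal pieces, and neither reduction nor cyclic
  reduction increases their number.\<close>
lemma pieces_orbit:
  assumes "x \<in> carrier (free_group N)"
  obtains k where "\<And>n. \<exists>v. cyclically_reduced v \<and> set v \<subseteq> {..<N} \<times> UNIV \<and> pieces T k v \<and>
    conjugate_words {..<N} (iter n x) v"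
proof -
  let ?k = "length x"
  have x: "set x \<subseteq> {..<N} \<times> UNIV" "reduced x" using assms by (auto simp: carrier_free_group)
  have step: "pieces T k (ext s w)" if "pieces T k w" "set w \<subseteq> {..<N} \<times> UNIV" for k w
  proof -
    have "pieces T k (subst s w)"
      using that
    proof (induction k arbitrary: w)
      case (Suc k)
      obtain p v where *: "w = p @ v" "successively T p" "pieces T k v"
        using Suc.prems(1) unfolding pieces_Suc by blast
      have "successively T (subst s p)" "pieces T k (subst s v)"
        using legal_subst[OF _ *(2)] Suc.IH[OF *(3)] Suc.prems(2) *(1) by simp_all
      then show ?case unfolding pieces_Suc *(1) subst_simps by blast
    qed simp
    then show ?thesis unfolding ext_def by (rule pieces_red[rotated]) (rule legal_reduced)
  qed
  have pieces: "pieces T ?k (iter n x)" for n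
    by (induction n) (simp_all add: pieces_length step iter_in_words[OF x(1)])
  have "\<exists>v. cyclically_reduced v \<and> set v \<subseteq> {..<N} \<times> UNIV \<and> pieces T ?k v \<and>
    conjugate_words {..<N} (iter n x) v" for n
  proof -
    obtain c v where cv: "iter n x = c @ v @ inv_word c" "cyclically_reduced v"
      by (rule cyclic_split[OF reduced_iter[OF x(2)]])
    have words: "set c \<subseteq> {..<N} \<times> UNIV" "set v \<subseteq> {..<N} \<times> UNIV"
      using iter_in_words[OF x(1), of n] by (auto simp: cv(1))
    have "pieces T ?k v"
      using pieces[of n] pieces_append_dest[of T ?k c "v @ inv_word c"]
        pieces_append_dest[of T ?k v "inv_word c"] by (simp add: cv(1))
    moreover have "conjugate_words {..<N} (iter n x) v"
      unfolding conjugate_words_def using words(1) reduced_iter[OF x(2), of n]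
      by (intro exI[of _ c]) (simp add: cv(1) red_id)
    ultimately show ?thesis using cv(2) words(2) by blast
  qed
  then show ?thesis using that by blast
qed

text \<open>If a class is not periodic, its orbit contains a cyclic word longer than any given bound. As
  the number of legal pieces stays bounded, one of its pieces is longer than the loss in
  \<open>wt_iter_wpow\<close>; rotating this piece to the front gives \<open>y\<close>.\<close>
lemma orbit_grows:
  assumes x: "x \<in> carrier (free_group N)"
    and aperiodic: "\<And>n. n \<ge> 1 \<Longrightarrow> \<not> conjugate_words {..<N} (iter n x) x"
  obtains \<delta> n0 y where "\<delta> > 0" "y \<in> carrier (free_group N)"
    "conjugate_words {..<N} (iter n0 x) y"
    "\<And>j k. real k * (\<delta> * lam ^ j) \<le> length (red (wpow k (iter j y)))"
proof -
  obtain k where k: "\<And>n. \<exists>v. cyclically_reduced v \<and> set v \<subseteq> {..<N} \<times> UNIV \<and> pieces T k v \<and>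
    conjugate_words {..<N} (iter n x) v"
    by (rule pieces_orbit[OF x]) blast
  define C where "C = 4 * cancellation / (lam - 1)"
  \<comment> \<open>a cyclic word longer than B has a legal piece longer than the critical length C\<close>
  define B where "B = nat \<lceil>k * C / l_min\<rceil>"
  have "\<exists>n. \<not> (\<exists>v. v \<in> carrier (free_group N) \<and> length v \<le> B \<and> conjugate_words {..<N} (iter n x) v)"
  proof (rule ccontr)
    assume "\<not> ?thesis"
    then have "\<And>n. \<exists>v. v \<in> carrier (free_group N) \<and> length v \<le> B \<and> conjugate_words {..<N} (iter n x) v"
      by blast
    then show False
      by (rule bounded_orbit_periodic[OF x]) (use aperiodic in blast)
  qed
  then obtain n0 where n0: "\<And>v. v \<in> carrier (free_group N) \<Longrightarrow>
      conjugate_words {..<N} (iter n0 x) v \<Longrightarrow> length v > B"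
    using not_le by blast
  obtain v where v: "cyclically_reduced v" "set v \<subseteq> {..<N} \<times> UNIV" "pieces T k v"
    "conjugate_words {..<N} (iter n0 x) v"
    using k by blast
  have "length v > B"
    using n0[OF _ v(4)] v(1,2) by (simp add: carrier_free_group cyclically_reduced_def)
  then have "k * C / l_min < length v"
    unfolding B_def by linarith
  then have "k * C < l_min * length v"
    using l_min_pos by (simp add: field_simps)
  also have "\<dots> \<le> wt l v" using v(2) by (rule wt_length)
  finally have "wt l v > k * C" .
  then obtain a p b where p: "v = a @ p @ b" "successively T p" "wt l p > C"
    by (rule pieces_long[OF v(3)])
  define y where "y = p @ b @ a"
  have y: "cyclically_reduced y" "set y \<subseteq> {..<N} \<times> UNIV"
    using cyclically_reduced_rotate[of a "p @ b"] v(1,2) by (auto simp: y_def p(1))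
  have y': "y \<in> carrier (free_group N)"
    using y by (simp add: carrier_free_group cyclically_reduced_def)
  have "conjugate_words {..<N} v (red y)"
    using conjugate_words_rotate[of a "{..<N}" "p @ b"] v(1,2)
    by (simp add: y_def p(1) cyclically_reduced_def)
  then have conj: "conjugate_words {..<N} (iter n0 x) y"
    using conjugate_words_trans[OF v(4)] y(1) by (simp add: red_id cyclically_reduced_def)
  define \<delta> where "\<delta> = (wt l p - C) / l_max"
  have "\<delta> > 0" using p(3) l_max_pos by (simp add: \<delta>_def)
  moreover have "real k * (\<delta> * lam ^ j) \<le> length (red (wpow k (iter j y)))" for j k
  proof -
    have "real k * (lam ^ j * (wt l p - C)) \<le> wt l (iter j (wpow k y))"
      using wt_iter_wpow[of p "b @ a" k j] y p(2) by (simp add: y_def C_def)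
    also have "iter j (wpow k y) = red (wpow k (iter j y))"
      by (simp add: iter_wpow red_id reduced_wpow[OF y(1)])
    also have "wt l (red (wpow k (iter j y))) \<le> l_max * length (red (wpow k (iter j y)))"
    proof (rule wt_length)
      have "set (wpow k (iter j y)) \<subseteq> {..<N} \<times> UNIV"
        using iter_in_words[OF y(2), of j] by (induction k) auto
      then show "set (red (wpow k (iter j y))) \<subseteq> {..<N} \<times> UNIV"
        using set_red[of "wpow k (iter j y)"] by blast
    qed
    finally show ?thesis using l_max_pos by (simp add: \<delta>_def field_simps)
  qed
  ultimately show ?thesis using that[OF _ y' conj] by blast
qed

text \<open>The cyclic lengths lie between two positive multiples of \<open>lam ^ n\<close>: above, because
  the map stretches weighted lengths by at most \<open>lam\<close>, and below by \<open>orbit_grows\<close>. Changing the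
  basis changes only the multiples, which the \<open>n\<close>-th root removes.\<close>
lemma growth_rate:
  assumes fb: "free_basis (free_group N) X" and x: "x \<in> carrier (free_group N)"
    and aperiodic: "\<And>n. n \<ge> 1 \<Longrightarrow> conj_class (free_group N) (iter n x) \<noteq> conj_class (free_group N) x"
  shows "(\<lambda>n. root n (real (conj_length (free_group N) X (conj_class (free_group N) (iter n x)))))
    \<longlonglongrightarrow> lam"
proof -
  let ?G = "free_group N"
  let ?a = "\<lambda>n. real (conj_length ?G X (conj_class ?G (iter n x)))"
  have "\<not> conjugate_words {..<N} (iter n x) x" if "n \<ge> 1" for n
    using aperiodic[OF that] conjugate_words_class x by blast
  then obtain \<delta> n0 y where y: "\<delta> > 0" "y \<in> carrier ?G" "conjugate_words {..<N} (iter n0 x) y"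
    "\<And>j k. real k * (\<delta> * lam ^ j) \<le> length (red (wpow k (iter j y)))"
    by (rule orbit_grows[OF x]) blast+
  obtain K1 where K1: "K1 > 0"
    "\<forall>x\<in>carrier ?G. conj_length ?G X (conj_class ?G x) \<le> K1 * length x"
    using conj_length_upper[OF fb] by blast
  obtain K2 where K2: "K2 > 0" "\<forall>x\<in>carrier ?G. \<forall>r::real.
    (\<forall>k. real k * r \<le> length (red (wpow k x))) \<longrightarrow>
    r \<le> real (K2 * conj_length ?G X (conj_class ?G x))"
    using conj_length_lower[OF fb] by blast
  define c where "c = \<delta> / (K2 * lam ^ n0)"
  define C where "C = K1 * (wt l x + 1) / l_min"
  have c: "c > 0" using y(1) K2(1) lam by (simp add: c_def)
  have wx: "wt l x \<ge> 0" using x by (intro wt_nonneg_words) (simp add: carrier_free_group)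
  then have C: "C > 0" using K1(1) l_min_pos by (simp add: C_def)
  have lower: "c * lam ^ n \<le> ?a n" if "n \<ge> n0" for n
  proof -
    define j where "j = n - n0"
    have "iter n x = iter j (iter n0 x)"
      using that funpow_add[of j n0 "ext s"] by (simp add: j_def)
    then have "conj_class ?G (iter n x) = conj_class ?G (iter j y)"
      using conjugate_iter[OF y(3), of j] conjugate_words_class iter_carrier[OF y(2)] by simp
    moreover have "\<delta> * lam ^ j \<le> real (K2 * conj_length ?G X (conj_class ?G (iter j y)))"
      using K2(2) iter_carrier[OF y(2)] y(4) by blast
    moreover have "c * lam ^ n = \<delta> * lam ^ j / K2"
      using that lam by (simp add: c_def j_def power_diff)
    ultimately have "c * lam ^ n * K2 \<le> ?a n * K2" using K2(1) by (simp add: mult.commute)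
    then show ?thesis using K2(1) by simp
  qed
  have upper: "?a n \<le> C * lam ^ n" for n
  proof -
    have "?a n \<le> real (K1 * length (iter n x))"
      using K1(2) iter_carrier[OF x] by (simp only: of_nat_le_iff)
    also have "\<dots> \<le> K1 * (lam ^ n * wt l x / l_min)"
    proof -
      have "l_min * length (iter n x) \<le> wt l (iter n x)"
        using iter_in_words x by (intro wt_length) (simp add: carrier_free_group)
      also have "\<dots> \<le> lam ^ n * wt l x" using x by (intro wt_iter_le) (simp add: carrier_free_group)
      finally have "length (iter n x) \<le> lam ^ n * wt l x / l_min"
        using l_min_pos by (simp add: field_simps)
      then have "real K1 * length (iter n x) \<le> K1 * (lam ^ n * wt l x / l_min)"
        by (intro mult_left_mono) simp_all
      then show ?thesis by simp
    qed
    also have "\<dots> \<le> C * lam ^ n"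
      using l_min_pos lam K1(1) by (simp add: C_def field_simps)
    finally show ?thesis .
  qed
  have root: "root n (b * lam ^ n) = root n b * lam" if "n > 0" for n b
    using that lam by (simp add: real_root_mult real_root_power_cancel)
  show ?thesis
  proof (rule tendsto_sandwich)
    show "(\<lambda>n. root n c * lam) \<longlonglongrightarrow> lam" "(\<lambda>n. root n C * lam) \<longlonglongrightarrow> lam"
      using tendsto_mult[OF LIMSEQ_root_const[OF c] tendsto_const[of lam]]
        tendsto_mult[OF LIMSEQ_root_const[OF C] tendsto_const[of lam]] by simp_all
    show "\<forall>\<^sub>F n in sequentially. root n c * lam \<le> root n (?a n)"
      using eventually_ge_at_top[of "Suc n0"]
    proof eventually_elim
      case (elim n)
      then have n: "n > 0" "n \<ge> n0" by simp_all
      show ?case using real_root_le_mono[OF n(1) lower[OF n(2)]] root[OF n(1), of c] by simp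
    qed
    show "\<forall>\<^sub>F n in sequentially. root n (?a n) \<le> root n C * lam"
      using eventually_gt_at_top[of 0]
    proof eventually_elim
      case (elim n)
      show ?case using real_root_le_mono[OF elim upper[of n]] root[OF elim, of C] by simp
    qed
  qed
qed

end


section \<open>Outer automorphisms given by substitutions\<close>

context inverse_substs
begin

abbreviation F :: "nat letter list monoid" where "F \<equiv> free_group N"

definition aut :: "nat letter list \<Rightarrow> nat letter list" where
  "aut = (\<lambda>w\<in>carrier F. ext s w)"

definition outer :: "(nat letter list \<Rightarrow> nat letter list) set" where
  "outer = Inn F #>\<^bsub>AutoGroup F\<^esub> aut"

lemma aut_in_auto: "aut \<in> auto F"
proof -
  have closed: "ext s w \<in> carrier F" "ext t w \<in> carrier F" if "w \<in> carrier F" for w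
    using that iter_carrier[of w 1] inverse_substs.iter_carrier[OF inverse, of w 1] by simp_all
  have "bij_betw aut (carrier F) (carrier F)"
    by (rule bij_betw_byWitness[where f' = "ext t"])
      (use closed in \<open>auto simp: aut_def ext_ext_id[OF t_s] ext_ext_id[OF s_t] red_id carrier_free_group\<close>)
  moreover have "aut \<in> hom F F"
  proof (rule homI)
    interpret group F by (rule group_free_group)
    fix u v assume uv: "u \<in> carrier F" "v \<in> carrier F"
    then have "aut (u \<otimes>\<^bsub>F\<^esub> v) = ext s (u \<otimes>\<^bsub>F\<^esub> v)" by (simp add: aut_def)
    also have "\<dots> = red (ext s u @ ext s v)"
      using uv by (simp add: mult_free_group carrier_free_group ext_append)
    finally show "aut (u \<otimes>\<^bsub>F\<^esub> v) = aut u \<otimes>\<^bsub>F\<^esub> aut v"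
      using uv by (simp add: aut_def mult_free_group)
  qed (use closed in \<open>simp add: aut_def\<close>)
  ultimately show ?thesis by (auto simp: auto_def Bij_def aut_def)
qed

lemma outer_carrier: "outer \<in> carrier (Out F)"
proof -
  interpret group F by (rule group_free_group)
  show ?thesis
    using aut_in_auto by (auto simp: outer_def Out_def FactGroup_def RCOSETS_def carrier_AutoGroup)
qed

lemma aut_in_outer: "aut \<in> outer"
proof -
  interpret group F by (rule group_free_group)
  interpret A: group "AutoGroup F" by (rule AutoGroup)
  show ?thesis
    unfolding outer_def using aut_in_auto normal_imp_subgroup[OF Inn_normal]
    by (intro A.rcos_self) (simp_all add: carrier_AutoGroup)
qed

text \<open>Multiplication of cosets is pointwise, so that products of representatives represent the
  product.\<close>
lemma iter_in_outer_pow: "(\<lambda>w\<in>carrier F. iter n w) \<in> outer [^]\<^bsub>Out F\<^esub> n"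
proof -
  interpret group F by (rule group_free_group)
  interpret A: group "AutoGroup F" by (rule AutoGroup)
  interpret O: group "Out F" by (rule group_Out)
  interpret n: normal "Inn F" "AutoGroup F" by (rule Inn_normal)
  show ?thesis
  proof (induction n)
    case 0
    have "\<one>\<^bsub>Out F\<^esub> = Inn F" by (simp add: Out_def FactGroup_def)
    moreover have "(\<lambda>w\<in>carrier F. w) \<in> Inn F"
      using n.one_closed by (simp add: one_AutoGroup)
    ultimately show ?case by (simp add: restrict_def)
  next
    case (Suc n)
    let ?h = "\<lambda>w\<in>carrier F. iter n w"
    have "outer [^]\<^bsub>Out F\<^esub> n \<in> carrier (Out F)" using outer_carrier by simp
    then have h: "?h \<in> auto F" using Out_rep(1) Suc by blast
    have "outer [^]\<^bsub>Out F\<^esub> Suc n = outer \<otimes>\<^bsub>Out F\<^esub> outer [^]\<^bsub>Out F\<^esub> n"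
      using outer_carrier by (rule O.nat_pow_Suc2)
    also have "\<dots> = outer <#>\<^bsub>AutoGroup F\<^esub> (outer [^]\<^bsub>Out F\<^esub> n)"
      by (simp add: Out_def FactGroup_def)
    finally have pow: "outer [^]\<^bsub>Out F\<^esub> Suc n = outer <#>\<^bsub>AutoGroup F\<^esub> (outer [^]\<^bsub>Out F\<^esub> n)" .
    have "aut \<otimes>\<^bsub>AutoGroup F\<^esub> ?h \<in> outer [^]\<^bsub>Out F\<^esub> Suc n"
      unfolding pow set_mult_def using aut_in_outer Suc by blast
    moreover have "aut \<otimes>\<^bsub>AutoGroup F\<^esub> ?h = (\<lambda>w\<in>carrier F. iter (Suc n) w)"
      using aut_in_auto h by (auto simp: mult_AutoGroup compose_def aut_def iter_carrier intro!: restrict_ext)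
    ultimately show ?case by (simp only:)
  qed
qed

lemma inv_outer: "inv\<^bsub>Out F\<^esub> outer = inverse_substs.outer N t"
proof -
  interpret group F by (rule group_free_group)
  interpret A: group "AutoGroup F" by (rule AutoGroup)
  interpret O: group "Out F" by (rule group_Out)
  interpret n: normal "Inn F" "AutoGroup F" by (rule Inn_normal)
  interpret inv: inverse_substs N t s L by (rule inverse)
  have "inv.aut \<otimes>\<^bsub>AutoGroup F\<^esub> aut = (\<lambda>w\<in>carrier F. w)"
    using aut_in_auto inv.aut_in_auto iter_carrier[of _ 1]
    by (auto simp: mult_AutoGroup compose_def aut_def inv.aut_def ext_ext_id[OF t_s] red_id
        carrier_free_group intro!: restrict_ext)
  then have "inv.aut \<otimes>\<^bsub>AutoGroup F\<^esub> aut = \<one>\<^bsub>AutoGroup F\<^esub>" by (simp add: one_AutoGroup)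
  then have "inv.outer \<otimes>\<^bsub>Out F\<^esub> outer = Inn F #>\<^bsub>AutoGroup F\<^esub> \<one>\<^bsub>AutoGroup F\<^esub>"
    using aut_in_auto inv.aut_in_auto
    by (simp add: Out_def FactGroup_def outer_def inv.outer_def n.rcos_sum carrier_AutoGroup)
  also have "\<dots> = \<one>\<^bsub>Out F\<^esub>"
    using A.coset_mult_one[OF n.subset] by (simp add: Out_def FactGroup_def)
  finally show ?thesis
    using O.inv_equality outer_carrier inv.outer_carrier by blast
qed

lemma out_act_outer_pow:
  assumes "x \<in> carrier F"
  shows "out_act (outer [^]\<^bsub>Out F\<^esub> n) (conj_class F x) = conj_class F (iter n x)"
proof -
  interpret group F by (rule group_free_group)
  interpret O: group "Out F" by (rule group_Out)
  show ?thesis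
    using out_act_conj_class[OF _ iter_in_outer_pow assms] outer_carrier assms by simp
qed

lemma fully_irreducibleI:
  assumes "\<And>k A. k \<ge> 1 \<Longrightarrow> proper_free_factor F A \<Longrightarrow>
    (\<And>a. a \<in> A \<Longrightarrow> \<exists>b\<in>A. conjugate_words {..<N} (iter k a) b) \<Longrightarrow> False"
  shows "fully_irreducible F outer"
  unfolding fully_irreducible_def
proof (intro conjI allI impI outer_carrier notI)
  interpret group F by (rule group_free_group)
  interpret O: group "Out F" by (rule group_Out)
  fix k :: nat and A
  assume k: "k \<ge> 1" and A: "proper_free_factor F A"
    and eq: "out_act_subgroups (outer [^]\<^bsub>Out F\<^esub> k) (subgroup_conj_class F A) = subgroup_conj_class F A"
  let ?h = "\<lambda>w\<in>carrier F. iter k w"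
  have sub: "A \<subseteq> carrier F"
    using A by (auto simp: proper_free_factor_def free_product_of_def dest: subgroup.subset)
  have "subgroup_conj_class F A = subgroup_conj_class F (?h ` A)"
    using out_act_subgroup_conj_class[OF _ iter_in_outer_pow sub] outer_carrier eq by simp
  moreover have "?h ` A \<in> subgroup_conj_class F (?h ` A)"
  proof -
    have "conj_by F \<one>\<^bsub>F\<^esub> y = y" if y: "y \<in> ?h ` A" for y
    proof (rule conj_by_one)
      show "y \<in> carrier F" using y sub iter_carrier by auto
    qed
    then have "conj_by F \<one>\<^bsub>F\<^esub> ` ?h ` A = (\<lambda>y. y) ` ?h ` A"
      by (intro image_cong refl)
    then have "conj_by F \<one>\<^bsub>F\<^esub> ` ?h ` A = ?h ` A" by (simp only: image_ident)
    then show ?thesis unfolding subgroup_conj_class_def by (intro image_eqI[of _ _ "\<one>\<^bsub>F\<^esub>"]) simp_all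
  qed
  ultimately have "?h ` A \<in> subgroup_conj_class F A" by simp
  then obtain g where g: "g \<in> carrier F" "?h ` A = conj_by F g ` A"
    unfolding subgroup_conj_class_def by (elim imageE)
  have "\<exists>b\<in>A. conjugate_words {..<N} (iter k a) b" if a: "a \<in> A" for a
  proof -
    have "iter k a \<in> ?h ` A" using a sub by (intro image_eqI[of _ _ a]) auto
    then obtain b where b: "b \<in> A" "iter k a = conj_by F g b" unfolding g(2) by (elim imageE)
    have "b \<in> carrier F" using b sub by blast
    then have "conj_by F g b = red (g @ b @ inv_word g)"
      using g(1) by (simp add: conj_by_apply m_assoc inv_free_group mult_free_group carrier_free_group)
    then have "conjugate_words {..<N} (iter k a) b"
      using b(2) g(1) unfolding conjugate_words_def carrier_free_group by (intro exI[of _ g]) simp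
    then show ?thesis using b by blast
  qed
  then show False using assms[OF k A] by blast
qed

lemma periodic_inverse:
  assumes "x \<in> carrier F" "conj_class F ((ext t ^^ n) x) = conj_class F x"
  shows "conj_class F (iter n x) = conj_class F x"
proof -
  interpret inv: inverse_substs N t s L by (rule inverse)
  have "conjugate_words {..<N} (inv.iter n x) x"
    using assms inv.iter_carrier by (intro class_conjugate_words)
  then have "conjugate_words {..<N} (iter n (inv.iter n x)) (iter n x)"
    by (rule conjugate_iter)
  then have "conjugate_words {..<N} x (iter n x)"
    using inv.inverse_iter assms(1) by (simp add: carrier_free_group)
  then show ?thesis using conjugate_words_class[OF _ iter_carrier[OF assms(1)]] by simp
qed

end

context train_track
begin

text \<open>Uniqueness in the definition of \<^const>\<open>stretch_factor\<close> requires at least one class that is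
  not periodic: without it every real number would qualify.\<close>
lemma stretch_factor_outer:
  assumes x: "x \<in> carrier F" "\<And>n. n \<ge> 1 \<Longrightarrow> conj_class F (iter n x) \<noteq> conj_class F x"
  shows "stretch_factor F outer = lam"
  unfolding stretch_factor_def
proof (rule the_equality)
  have periodic: "periodic_class F outer (conj_class F y) \<longleftrightarrow>
      (\<exists>n\<ge>1. conj_class F (iter n y) = conj_class F y)" if "y \<in> carrier F" for y
    using that by (simp add: periodic_class_def out_act_outer_pow)
  show *: "\<forall>X x. free_basis F X \<and> x \<in> carrier F \<and> \<not> periodic_class F outer (conj_class F x) \<longrightarrow>
     (\<lambda>n. root n (real (conj_length F X (out_act (outer [^]\<^bsub>Out F\<^esub> n) (conj_class F x)))))
       \<longlonglongrightarrow> lam"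
  proof (intro allI impI, elim conjE)
    fix X y
    assume X: "free_basis F X" and y: "y \<in> carrier F" "\<not> periodic_class F outer (conj_class F y)"
    show "(\<lambda>n. root n (real (conj_length F X (out_act (outer [^]\<^bsub>Out F\<^esub> n) (conj_class F y)))))
       \<longlonglongrightarrow> lam"
      using growth_rate[OF X y(1)] y periodic by (simp add: out_act_outer_pow)
  qed
  fix r
  assume r: "\<forall>X x. free_basis F X \<and> x \<in> carrier F \<and> \<not> periodic_class F outer (conj_class F x) \<longrightarrow>
     (\<lambda>n. root n (real (conj_length F X (out_act (outer [^]\<^bsub>Out F\<^esub> n) (conj_class F x)))))
       \<longlonglongrightarrow> r"
  have np: "\<not> periodic_class F outer (conj_class F x)" using x periodic by blast
  note prem = conjI[OF free_basis_free_group conjI[OF x(1) np]]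
  show "r = lam"
    by (rule LIMSEQ_unique[OF r[rule_format, OF prem] *[rule_format, OF prem]])
qed

end

text \<open>Homomorphisms to an abelian group, given by their values \<open>h\<close> on the generators.\<close>
definition signed_sum :: "('a \<Rightarrow> 'b::ab_group_add) \<Rightarrow> 'a letter list \<Rightarrow> 'b" where
  "signed_sum h w = (\<Sum>a\<leftarrow>w. if snd a then h (fst a) else - h (fst a))"

lemma signed_sum_simps [simp]:
  "signed_sum h [] = 0"
  "signed_sum h (a # w) = (if snd a then h (fst a) else - h (fst a)) + signed_sum h w"
  "signed_sum h (u @ v) = signed_sum h u + signed_sum h v"
  by (simp_all add: signed_sum_def)

lemma signed_sum_inv_word [simp]: "signed_sum h (inv_word w) = - signed_sum h w"
  by (induction w) (simp_all add: inv_letter_def)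

lemma signed_sum_red [simp]: "signed_sum h (red w) = signed_sum h w"
proof (induction w)
  case (Cons a w)
  have "signed_sum h (cancel_cons a v) = signed_sum h (a # v)" for v
    by (cases v) (auto simp: inv_letter_def)
  then show ?case using Cons by (simp add: red_def)
qed simp

lemma signed_sum_ext: "signed_sum h (ext s w) = signed_sum (\<lambda>i. signed_sum h (s i)) w"
proof -
  have "signed_sum h (subst s w) = signed_sum (\<lambda>i. signed_sum h (s i)) w"
    by (induction w) (simp_all add: subst_letter_def)
  then show ?thesis by (simp add: ext_def)
qed

lemma signed_sum_conjugate: "conjugate_words X x y \<Longrightarrow> signed_sum h x = signed_sum h y"
  by (auto simp: conjugate_words_def)


section \<open>Homomorphisms from free factors to the integers\<close>

text \<open>The Magnus representation sends the generator \<open>i\<close> to \<open>1 + X\<^sub>i\<close> in the ring of power series in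
  noncommuting variables. A power series is the function from monomials (lists of
  indices) to coefficients, \<open>magnus_letter a\<close> is left multiplication by the image of the letter \<open>a\<close>,
  and the recursion for an inverse letter solves \<open>(1 + X\<^sub>i) f = g\<close> for \<open>f\<close>.\<close>
fun magnus_letter :: "'a letter \<Rightarrow> ('a list \<Rightarrow> int) \<Rightarrow> 'a list \<Rightarrow> int" where
  "magnus_letter a g [] = g []"
| "magnus_letter (i, True) g (j # v) = g (j # v) + (if j = i then g v else 0)"
| "magnus_letter (i, False) g (j # v) = g (j # v) - (if j = i then magnus_letter (i, False) g v else 0)"

definition magnus :: "'a letter list \<Rightarrow> 'a list \<Rightarrow> int" where
  "magnus w = foldr magnus_letter w (\<lambda>u. if u = [] then 1 else 0)"

lemma magnus_letter_inverse: "magnus_letter a (magnus_letter (inv_letter a) g) = g"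
proof
  fix u
  show "magnus_letter a (magnus_letter (inv_letter a) g) u = g u"
  proof (cases a)
    case (Pair i b)
    have "magnus_letter (i, True) (magnus_letter (i, False) g) u = g u"
      by (cases u) auto
    moreover have "magnus_letter (i, False) (magnus_letter (i, True) g) u = g u"
    proof (induction u)
      case (Cons j v)
      then show ?case by auto
    qed simp
    ultimately show ?thesis by (cases b) (auto simp: Pair inv_letter_def)
  qed
qed

lemma magnus_red: "foldr magnus_letter (red w) g = foldr magnus_letter w g"
proof (induction w)
  case (Cons a w)
  have "foldr magnus_letter (cancel_cons a v) g = foldr magnus_letter (a # v) g" for v
    by (cases v) (auto simp: magnus_letter_inverse)
  then show ?case using Cons by (simp add: red_def)
qed simp

lemma magnus_letter_add:
  "magnus_letter a (\<lambda>u. g u + h u) u = magnus_letter a g u + magnus_letter a h u"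
  by (induction a g u rule: magnus_letter.induct) auto

lemma magnus_letter_lowest:
  assumes "\<And>u. length u < d \<Longrightarrow> r u = 0" "length u \<le> d"
  shows "magnus_letter a r u = r u"
proof -
  have *: "magnus_letter a r u = 0" if "length u < d" for u
    using assms(1) that by (induction a r u rule: magnus_letter.induct) auto
  show ?thesis
  proof (cases u)
    case (Cons j v)
    then have "length v < d" using assms(2) by simp
    then show ?thesis
      using Cons assms(1)[of v] *[of v] by (cases a; cases "snd a") auto
  qed simp
qed

text \<open>When power series with constant term 1 are multiplied, their nonconstant terms of lowest
  degree add up: all mixed products have higher degree.\<close>
lemma magnus_append:
  assumes low: "\<And>u. u \<noteq> [] \<Longrightarrow> length u < d \<Longrightarrow> magnus w u = 0" "magnus w [] = 1"
    and u: "u \<noteq> []" "length u \<le> d"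
  shows "magnus (v @ w) u = magnus v u + magnus w u"
proof -
  define e r where "e = (\<lambda>u. if u = [] then 1 else 0 :: int)" and "r = (\<lambda>u. magnus w u - e u)"
  have r: "r u = 0" if "length u < d" for u using low that by (auto simp: r_def e_def)
  have add: "foldr magnus_letter v (\<lambda>u. g u + h u) = (\<lambda>u. foldr magnus_letter v g u + foldr magnus_letter v h u)"
    for g h :: "'a list \<Rightarrow> int"
    by (induction v) (auto simp: magnus_letter_add)
  have lowest: "foldr magnus_letter v r u = r u" if "length u \<le> d" for u
    using that
  proof (induction v arbitrary: u)
    case (Cons a v)
    have "magnus_letter a (foldr magnus_letter v r) u = foldr magnus_letter v r u"
      using Cons.IH r Cons.prems by (intro magnus_letter_lowest[of d]) auto
    then show ?case using Cons by simp
  qed simp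
  have "magnus (v @ w) u = foldr magnus_letter v (\<lambda>u. e u + r u) u"
    by (simp add: magnus_def r_def)
  also have "\<dots> = magnus v u + r u"
    using lowest[OF u(2)] by (simp add: add) (simp add: magnus_def e_def)
  finally show ?thesis using u(1) by (simp add: r_def e_def)
qed

lemma magnus_Nil_coeff: "magnus w [] = 1"
  by (induction w) (simp_all add: magnus_def)

lemma magnus_Cons_neq: "j \<noteq> fst a \<Longrightarrow> magnus (a # w) (j # v) = magnus w (j # v)"
  by (cases a; cases "snd a") (simp_all add: magnus_def)

lemma magnus_Cons_eq:
  assumes "distinct_adj (fst a # v)"
  shows "magnus (a # w) (fst a # v) = magnus w (fst a # v) + (if snd a then 1 else - 1) * magnus w v"
proof -
  have "magnus_letter (fst a, False) g v = g v" for g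
    using assms by (cases v) auto
  then show ?thesis by (cases a; cases "snd a") (simp_all add: magnus_def)
qed

text \<open>The monomial listing the generators of the syllables of a reduced word has a nonzero
  coefficient: the product of the exponents of the syllables. The induction runs letter by letter.
  A letter either extends the first syllable, whose exponent \<open>k\<close> then increases by 1 in absolute
  value, or opens a new one. That longer monomials, and equally long ones with another first
  generator, have coefficient 0 if no two neighbours are equal keeps other contributions away.\<close>
lemma magnus_top:
  assumes "reduced (a # w)"
  defines "m \<equiv> remdups_adj (map fst (a # w))"
  shows "(\<forall>u. distinct_adj u \<longrightarrow> length u > length m \<longrightarrow> magnus (a # w) u = 0) \<and>
    (\<forall>u. distinct_adj u \<longrightarrow> length u \<ge> length m \<longrightarrow> hd u \<noteq> fst a \<longrightarrow> magnus (a # w) u = 0) \<and>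
    (\<exists>v k. m = fst a # v \<and> k \<ge> 1 \<and> magnus (a # w) v \<noteq> 0 \<and>
      magnus (a # w) m = (if snd a then 1 else - 1) * k * magnus (a # w) v)"
  using assms(1) unfolding m_def
proof (induction w arbitrary: a)
  case Nil
  have one: "magnus [] u = 0" if "u \<noteq> []" for u :: "'a list"
    using that by (simp add: magnus_def)
  have zero: "magnus [a] u = 0" if "distinct_adj u" "u \<noteq> []" "u \<noteq> [fst a]" for u
  proof (cases u)
    case (Cons j v)
    show ?thesis
    proof (cases "j = fst a")
      case True
      then have "v \<noteq> []" using Cons that by auto
      then show ?thesis
        using magnus_Cons_eq[of a v "[]"] Cons True that one by simp
    qed (use Cons magnus_Cons_neq[of j a "[]" v] one in simp)
  qed (use that in simp)
  have 1: "magnus [a] u = 0" if "distinct_adj u" "length u > 1" for u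
    by (rule zero) (use that in auto)
  have 2: "magnus [a] u = 0" if "distinct_adj u" "length u \<ge> 1" "hd u \<noteq> fst a" for u
    by (rule zero) (use that in auto)
  have "magnus [a] [fst a] = (if snd a then 1 else - 1)"
    using magnus_Cons_eq[of a "[]" "[]"] one by (simp add: magnus_Nil_coeff)
  then show ?case
    using 1 2 by (auto simp: magnus_Nil_coeff intro!: exI[of _ 1])
next
  case (Cons b w)
  let ?i = "fst a" and ?u = "remdups_adj (map fst (b # w))" and ?e = "if snd a then 1 else - 1 :: int"
  have red: "reduced (b # w)" "b \<noteq> inv_letter a" using Cons.prems by (auto simp: reduced_Cons)
  note IH = Cons.IH[OF red(1)]
  have IH1: "magnus (b # w) u = 0" if "distinct_adj u" "length u > length ?u" for u
    using IH that by blast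
  have IH2: "magnus (b # w) u = 0" if "distinct_adj u" "length u \<ge> length ?u" "hd u \<noteq> fst b" for u
    using IH that by blast
  obtain v k where IH3: "?u = fst b # v" "k \<ge> 1" "magnus (b # w) v \<noteq> 0"
    "magnus (b # w) ?u = (if snd b then 1 else - 1) * k * magnus (b # w) v"
    using IH by blast
  have neq: "magnus (a # b # w) u = magnus (b # w) u" if "hd u \<noteq> ?i \<or> u = []" for u
    using that by (cases u) (auto simp: magnus_Cons_neq magnus_Nil_coeff)
  have eq: "magnus (a # b # w) (?i # v) = magnus (b # w) (?i # v) + ?e * magnus (b # w) v"
    if "distinct_adj (?i # v)" for v
    using magnus_Cons_eq[OF that] .
  have dist: "distinct_adj ?u" by simp
  show ?case
  proof (cases "fst b = ?i")
    case True
    then have b: "b = a" using red(2) by (cases a; cases b) (auto simp: inv_letter_def)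
    have m: "remdups_adj (map fst (a # b # w)) = ?u" using b by simp
    have len: "length ?u \<ge> 1" by (simp add: Suc_leI)
    have hdv: "hd v \<noteq> ?i \<or> v = []" using dist unfolding IH3(1) True by (cases v) auto
    have 1: "magnus (a # b # w) u = 0" if u: "distinct_adj u" "length u > length ?u" for u
    proof (cases "u \<noteq> [] \<and> hd u = ?i")
      case True
      then obtain v where v: "u = ?i # v" by (cases u) auto
      have "v \<noteq> []" using u len v by auto
      then have "hd v \<noteq> ?i" using u(1) v by (cases v) auto
      then have "magnus (b # w) v = 0" using u v b by (intro IH2) (auto simp: distinct_adj_Cons)
      then show ?thesis using eq[of v] u IH1[of u] v by simp
    qed (use neq[of u] IH1[OF u] in auto)
    have 2: "magnus (a # b # w) u = 0" if u: "distinct_adj u" "length u \<ge> length ?u" "hd u \<noteq> ?i" for u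
      using neq[of u] IH2[OF u(1,2)] u(3) b by simp
    have "magnus (a # b # w) ?u = ?e * (k + 1) * magnus (b # w) v"
    proof -
      have "distinct_adj (?i # v)" using dist unfolding IH3(1) True .
      then show ?thesis using eq[of v] IH3(1,4) b by (simp add: algebra_simps)
    qed
    then have "\<exists>v k. ?u = ?i # v \<and> k \<ge> 1 \<and> magnus (a # b # w) v \<noteq> 0 \<and>
        magnus (a # b # w) ?u = ?e * k * magnus (a # b # w) v"
      using IH3 neq[OF hdv] True by (intro exI[of _ v] exI[of _ "k + 1"]) auto
    then show ?thesis unfolding m using 1 2 by blast
  next
    case False
    have m: "remdups_adj (map fst (a # b # w)) = ?i # ?u" using False by simp
    have nz: "magnus (b # w) ?u \<noteq> 0" using IH3 by auto
    have hdu: "hd ?u \<noteq> ?i \<or> ?u = []" using False IH3(1) by simp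
    have dist': "distinct_adj (?i # ?u)" using False dist by (simp add: distinct_adj_Cons)
    have 1: "magnus (a # b # w) u = 0" if u: "distinct_adj u" "length u > length (?i # ?u)" for u
    proof (cases "u \<noteq> [] \<and> hd u = ?i")
      case True
      then obtain v where v: "u = ?i # v" by (cases u) auto
      have "magnus (b # w) v = 0" using u v by (intro IH1) (auto simp: distinct_adj_Cons)
      then show ?thesis using eq[of v] u IH1[of u] v by simp
    qed (use neq[of u] IH1[of u] u in auto)
    have 2: "magnus (a # b # w) u = 0" if u: "distinct_adj u" "length u \<ge> length (?i # ?u)" "hd u \<noteq> ?i" for u
      using neq[of u] IH1[OF u(1)] u(2,3) by simp
    have "magnus (a # b # w) (?i # ?u) = ?e * 1 * magnus (a # b # w) ?u"
      using eq[OF dist'] IH1[OF dist'] neq[OF hdu] by simp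
    then have "\<exists>v k. ?i # ?u = ?i # v \<and> k \<ge> 1 \<and> magnus (a # b # w) v \<noteq> 0 \<and>
        magnus (a # b # w) (?i # ?u) = ?e * k * magnus (a # b # w) v"
      using nz neq[OF hdu] by (intro exI[of _ ?u] exI[of _ 1]) simp
    then show ?thesis unfolding m using 1 2 by blast
  qed
qed

lemma magnus_faithful:
  assumes "reduced w" "w \<noteq> []"
  obtains u where "u \<noteq> []" "magnus w u \<noteq> 0"
proof -
  obtain a v where w: "w = a # v" using assms(2) by (cases w) auto
  let ?u = "remdups_adj (map fst w)"
  obtain v' k where *: "?u = fst a # v'" "(k::int) \<ge> 1" "magnus w v' \<noteq> 0"
    "magnus w ?u = (if snd a then 1 else - 1) * k * magnus w v'"
    using magnus_top[of a v] assms(1) unfolding w by blast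
  have "magnus w ?u \<noteq> 0" unfolding *(4) using *(2,3) by simp
  moreover have "?u \<noteq> []" using *(1) by simp
  ultimately show ?thesis using that by blast
qed

text \<open>In the lowest degree where some element of \<open>B\<close> has a nonconstant term, each Magnus coefficient
  is additive on \<open>B\<close>.\<close>
lemma subgroup_nontrivial_hom:
  assumes B: "subgroup B (free_group N)" "B \<noteq> {\<one>\<^bsub>free_group N\<^esub>}"
  shows "\<exists>\<chi> :: nat letter list \<Rightarrow> int.
    (\<forall>x\<in>B. \<forall>y\<in>B. \<chi> (x \<otimes>\<^bsub>free_group N\<^esub> y) = \<chi> x + \<chi> y) \<and> (\<exists>b\<in>B. \<chi> b \<noteq> 0)"
proof -
  have one: "[] \<in> B" using subgroup.one_closed[OF B(1)] by (simp add: one_free_group)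
  have red: "reduced x" if "x \<in> B" for x
    using subgroup.mem_carrier[OF B(1) that] by (simp add: carrier_free_group)
  let ?P = "\<lambda>d. \<exists>u b. u \<noteq> [] \<and> length u = d \<and> b \<in> B \<and> magnus b u \<noteq> 0"
  obtain b0 where b0: "b0 \<in> B" "b0 \<noteq> []" using B(2) one by (auto simp: one_free_group)
  obtain u0 where "u0 \<noteq> []" "magnus b0 u0 \<noteq> 0" by (rule magnus_faithful[OF red[OF b0(1)] b0(2)])
  then have "?P (length u0)" using b0 by blast
  define d where "d = (LEAST d. ?P d)"
  have "?P d" unfolding d_def using \<open>?P (length u0)\<close> by (rule LeastI)
  then obtain u b where u: "u \<noteq> []" "length u = d" "b \<in> B" "magnus b u \<noteq> 0" by blast
  have least: "magnus x v = 0" if "x \<in> B" "v \<noteq> []" "length v < d" for x v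
    using not_less_Least[of "length v" ?P] that unfolding d_def by blast
  have "magnus (x \<otimes>\<^bsub>free_group N\<^esub> y) u = magnus x u + magnus y u" if xy: "x \<in> B" "y \<in> B" for x y
  proof -
    have "magnus (x \<otimes>\<^bsub>free_group N\<^esub> y) u = magnus (x @ y) u"
      by (simp add: mult_free_group red[OF xy(2)] magnus_def magnus_red del: foldr_append)
    also have "\<dots> = magnus x u + magnus y u"
      by (rule magnus_append[of d]) (use least xy(2) u magnus_Nil_coeff in auto)
    finally show ?thesis .
  qed
  then show ?thesis using u(3,4) by (intro exI[of _ "\<lambda>x. magnus x u"]) blast
qed

context group
begin

text \<open>This is the universal property of the free product for homomorphisms to the integers. The
  extension \<open>l\<close> sums the values on the syllables of the normal form. It suffices to multiply by a
  single syllable, where the normal form gets a syllable prepended, or its first syllable changes or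
  disappears.\<close>
lemma free_product_extend:
  fixes \<chi> :: "bool \<Rightarrow> 'a \<Rightarrow> int"
  assumes fp: "free_product_of G A B"
    and hom: "\<And>t x y. x \<in> (if t then A else B) \<Longrightarrow> y \<in> (if t then A else B) \<Longrightarrow>
      \<chi> t (x \<otimes> y) = \<chi> t x + \<chi> t y"
  shows "\<exists>l. (\<forall>x\<in>carrier G. \<forall>y\<in>carrier G. l (x \<otimes> y) = l x + l y) \<and>
    (\<forall>t. \<forall>x\<in>if t then A else B. l x = \<chi> t x)"
proof -
  let ?C = "\<lambda>t. if t then A else B"
  let ?val = "\<lambda>w. foldr (\<lambda>p y. snd p \<otimes> y) w \<one>" and ?W = "alternating_words G A B"
  have sub: "subgroup (?C t) G" for t using fp by (simp add: free_product_of_def)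
  have bij: "bij_betw ?val ?W (carrier G)" using fp by (simp add: free_product_of_def)
  have mem: "x \<in> carrier G" if "x \<in> ?C t" for x t using subgroup.mem_carrier[OF sub that] .
  have W_iff: "w \<in> ?W \<longleftrightarrow> (\<forall>p\<in>set w. snd p \<in> ?C (fst p) \<and> snd p \<noteq> \<one>) \<and>
      successively (\<lambda>p q. fst p \<noteq> fst q) w" for w
    unfolding alternating_words_def by (simp add: case_prod_beta)
  define S where "S = (\<lambda>w. \<Sum>p\<leftarrow>w. \<chi> (fst p) (snd p))"
  define l where "l = (\<lambda>g. S (the_inv_into ?W ?val g))"
  have l_val: "l (?val w) = S w" if "w \<in> ?W" for w
    unfolding l_def by (subst the_inv_into_f_f[OF bij_betw_imp_inj_on[OF bij] that]) (rule refl)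
  have val_closed: "?val w \<in> carrier G" if "w \<in> ?W" for w
    using bij_betwE[OF bij] that by blast
  have surj: "\<exists>w\<in>?W. g = ?val w" if "g \<in> carrier G" for g
  proof -
    have "g \<in> ?val ` ?W" using that by (simp only: bij_betw_imp_surj_on[OF bij])
    then show ?thesis by (elim imageE) (rule bexI)
  qed
  have \<chi>_one: "\<chi> t \<one> = 0" for t
    using hom[OF subgroup.one_closed[OF sub] subgroup.one_closed[OF sub], of t] by simp
  have step: "l (x \<otimes> g) = \<chi> t x + l g" if x: "x \<in> ?C t" and g: "g \<in> carrier G" for x t g
  proof (cases "x = \<one>")
    case True
    then show ?thesis using g \<chi>_one by simp
  next
    case False
    obtain w where w: "w \<in> ?W" "g = ?val w" using surj[OF g] by blast
    show ?thesis
    proof (cases "w \<noteq> [] \<and> fst (hd w) = t")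
      case False
      then have "(t, x) # w \<in> ?W"
        using w(1) x \<open>x \<noteq> \<one>\<close> by (cases w) (auto simp: W_iff)
      then have "l (?val ((t, x) # w)) = S ((t, x) # w)" by (rule l_val)
      then show ?thesis using l_val[OF w(1)] w(2) by (simp add: S_def)
    next
      case True
      then obtain y r where wr: "w = (t, y) # r" by (cases w) auto
      have y: "y \<in> ?C t" and r: "r \<in> ?W" using w(1) wr by (auto simp: W_iff successively_Cons)
      have g': "x \<otimes> g = (x \<otimes> y) \<otimes> ?val r"
        using val_closed[OF r] mem[OF x] mem[OF y] by (simp add: w(2) wr m_assoc)
      have lg: "l g = \<chi> t y + S r" using l_val[OF w(1)] by (simp add: w(2) wr S_def)
      have xy: "\<chi> t (x \<otimes> y) = \<chi> t x + \<chi> t y" by (rule hom[OF x y])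
      show ?thesis
      proof (cases "x \<otimes> y = \<one>")
        case True
        then have "l (x \<otimes> g) = S r" using g' val_closed[OF r] l_val[OF r] by simp
        then show ?thesis using lg xy True \<chi>_one[of t] by simp
      next
        case False
        have "x \<otimes> y \<in> ?C t" using subgroup.m_closed[OF sub x y] .
        then have "(t, x \<otimes> y) # r \<in> ?W"
          using w(1) wr False by (cases r) (auto simp: W_iff)
        then have "l (?val ((t, x \<otimes> y) # r)) = S ((t, x \<otimes> y) # r)" by (rule l_val)
        then show ?thesis using g' lg xy by (simp add: S_def)
      qed
    qed
  qed
  have words: "l (?val w \<otimes> h) = S w + l h" if "w \<in> ?W" "h \<in> carrier G" for w h
    using that(1)
  proof (induction w)
    case Nil
    then show ?case using that(2) by (simp add: S_def)
  next
    case (Cons p w)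
    then have p: "snd p \<in> ?C (fst p)" and w: "w \<in> ?W" by (auto simp: W_iff successively_Cons)
    have "l (?val (p # w) \<otimes> h) = l (snd p \<otimes> (?val w \<otimes> h))"
      using mem[OF p] val_closed[OF w] that(2) by (simp add: m_assoc)
    also have "\<dots> = \<chi> (fst p) (snd p) + l (?val w \<otimes> h)"
      using step[OF p] val_closed[OF w] that(2) by simp
    finally show ?case using Cons.IH[OF w] by (simp add: S_def)
  qed
  have l_one: "l \<one> = 0" using l_val[of "[]"] by (simp add: W_iff S_def)
  have "l (x \<otimes> y) = l x + l y" if xy: "x \<in> carrier G" "y \<in> carrier G" for x y
  proof -
    obtain w where w: "w \<in> ?W" "x = ?val w" using surj[OF xy(1)] by blast
    show ?thesis using words[OF w(1) xy(2)] l_val[OF w(1)] w(2) by simp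
  qed
  moreover have "l x = \<chi> t x" if "x \<in> ?C t" for t x
    using step[OF that, of \<one>] mem[OF that] l_one by simp
  ultimately show ?thesis by (intro exI[of _ l] conjI ballI allI)
qed

lemma free_product_second_nontrivial:
  assumes fp: "free_product_of G A B" and "A \<noteq> carrier G"
  shows "B \<noteq> {\<one>}"
proof
  assume B: "B = {\<one>}"
  have sub: "subgroup A G" using fp by (simp add: free_product_of_def)
  have "carrier G \<subseteq> A"
  proof
    fix g assume "g \<in> carrier G"
    then have "g \<in> (\<lambda>w. foldr (\<lambda>p y. snd p \<otimes> y) w \<one>) ` alternating_words G A B"
      using fp by (simp add: free_product_of_def bij_betw_def)
    then obtain w where w: "w \<in> alternating_words G A B" "g = foldr (\<lambda>p y. snd p \<otimes> y) w \<one>"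
      by (elim imageE)
    have "snd p \<in> A" if p: "p \<in> set w" for p
    proof -
      have "snd p \<in> (if fst p then A else B) - {\<one>}"
        using w(1) p unfolding alternating_words_def by (simp add: case_prod_beta)
      then show ?thesis using B by (cases "fst p") simp_all
    qed
    then have "foldr (\<lambda>p y. snd p \<otimes> y) w \<one> \<in> A"
      by (induction w) (simp_all add: subgroup.one_closed[OF sub] subgroup.m_closed[OF sub])
    then show "g \<in> A" using w(2) by simp
  qed
  then show False using assms(2) subgroup.subset[OF sub] by blast
qed

end

lemma hom_signed_sum:
  fixes l :: "nat letter list \<Rightarrow> int"
  assumes hom: "\<And>x y. x \<in> carrier (free_group N) \<Longrightarrow> y \<in> carrier (free_group N) \<Longrightarrow>
      l (x \<otimes>\<^bsub>free_group N\<^esub> y) = l x + l y"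
    and "w \<in> carrier (free_group N)"
  shows "l w = signed_sum (\<lambda>i. l [(i, True)]) w"
  using assms(2)
proof (induction w)
  case Nil
  have "[] \<in> carrier (free_group N)" by (simp add: carrier_free_group)
  then show ?case using hom[of "[]" "[]"] by (simp add: mult_free_group)
next
  case (Cons a w)
  have a: "[a] \<in> carrier (free_group N)" and w: "w \<in> carrier (free_group N)"
    using Cons.prems by (auto simp: carrier_free_group reduced_Cons)
  have nil: "[] \<in> carrier (free_group N)" by (simp add: carrier_free_group)
  have letter: "l [a] = (if snd a then l [(fst a, True)] else - l [(fst a, True)])"
  proof (cases "snd a")
    case True
    then show ?thesis by (cases a) simp
  next
    case False
    have b: "[inv_letter a] \<in> carrier (free_group N)"
      using a by (cases a) (simp add: carrier_free_group inv_letter_def reduced_Cons)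
    have "l [] = 0" using hom[OF nil nil] by (simp add: mult_free_group)
    moreover have "[a] \<otimes>\<^bsub>free_group N\<^esub> [inv_letter a] = []"
      using red_inv_word_cancel_Nil(2)[of "[a]"] by (simp add: mult_free_group reduced_Cons)
    ultimately have "l [a] + l [inv_letter a] = 0" using hom[OF a b] by simp
    then show ?thesis using False by (cases a) (simp add: inv_letter_def)
  qed
  have "l (a # w) = l ([a] \<otimes>\<^bsub>free_group N\<^esub> w)"
    using Cons.prems w by (simp add: mult_free_group carrier_free_group red_id)
  then show ?case using hom[OF a w] Cons.IH[OF w] letter by simp
qed

text \<open>The form \<open>g\<close> extends a nontrivial homomorphism on \<open>A\<close>, so it detects an element of \<open>A\<close> that is
  nontrivial in the abelianization of the group. The form \<open>h\<close> extends a nontrivial homomorphism on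
  the complementary factor by 0 on \<open>A\<close>.\<close>
lemma proper_free_factor_homs:
  assumes "proper_free_factor (free_group N) A"
  obtains a g h i where "a \<in> A" "a \<in> carrier (free_group N)" "signed_sum (g :: nat \<Rightarrow> int) a \<noteq> 0"
    "i < N" "(h :: nat \<Rightarrow> int) i \<noteq> 0" "\<And>x. x \<in> A \<Longrightarrow> signed_sum h x = 0"
proof -
  let ?G = "free_group N"
  interpret group ?G by (rule group_free_group)
  obtain B where B: "free_product_of ?G A B" and A: "A \<noteq> {\<one>\<^bsub>?G\<^esub>}" "A \<noteq> carrier ?G"
    using assms by (auto simp: proper_free_factor_def)
  have sub: "subgroup A ?G" "subgroup B ?G" using B by (auto simp: free_product_of_def)
  have B1: "B \<noteq> {\<one>\<^bsub>?G\<^esub>}" by (rule free_product_second_nontrivial[OF B A(2)])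
  obtain \<alpha> a where \<alpha>: "\<forall>x\<in>A. \<forall>y\<in>A. \<alpha> (x \<otimes>\<^bsub>?G\<^esub> y) = \<alpha> x + \<alpha> y" "a \<in> A" "\<alpha> a \<noteq> (0::int)"
    using subgroup_nontrivial_hom[OF sub(1) A(1)] by blast
  obtain \<beta> b where \<beta>: "\<forall>x\<in>B. \<forall>y\<in>B. \<beta> (x \<otimes>\<^bsub>?G\<^esub> y) = \<beta> x + \<beta> y" "b \<in> B" "\<beta> b \<noteq> (0::int)"
    using subgroup_nontrivial_hom[OF sub(2) B1] by blast
  have "\<exists>l. (\<forall>x\<in>carrier ?G. \<forall>y\<in>carrier ?G. l (x \<otimes>\<^bsub>?G\<^esub> y) = l x + l y) \<and>
      (\<forall>t. \<forall>x\<in>if t then A else B. l x = (if t then \<alpha> else (\<lambda>_. 0)) x)"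
  proof (rule free_product_extend[OF B])
    fix t x y
    assume "x \<in> (if t then A else B)" "y \<in> (if t then A else B)"
    then show "(if t then \<alpha> else (\<lambda>_. 0)) (x \<otimes>\<^bsub>?G\<^esub> y)
        = (if t then \<alpha> else (\<lambda>_. 0)) x + (if t then \<alpha> else (\<lambda>_. 0)) y"
      using \<alpha>(1) by (cases t) simp_all
  qed
  then obtain l where
    l: "\<forall>x\<in>carrier ?G. \<forall>y\<in>carrier ?G. l (x \<otimes>\<^bsub>?G\<^esub> y) = l x + l y"
      "\<forall>t. \<forall>x\<in>if t then A else B. l x = (if t then \<alpha> else (\<lambda>_. 0)) x"
    by (elim exE conjE) (rule that)
  have "\<exists>l. (\<forall>x\<in>carrier ?G. \<forall>y\<in>carrier ?G. l (x \<otimes>\<^bsub>?G\<^esub> y) = l x + l y) \<and>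
      (\<forall>t. \<forall>x\<in>if t then A else B. l x = (if t then (\<lambda>_. 0) else \<beta>) x)"
  proof (rule free_product_extend[OF B])
    fix t x y
    assume "x \<in> (if t then A else B)" "y \<in> (if t then A else B)"
    then show "(if t then (\<lambda>_. 0) else \<beta>) (x \<otimes>\<^bsub>?G\<^esub> y)
        = (if t then (\<lambda>_. 0) else \<beta>) x + (if t then (\<lambda>_. 0) else \<beta>) y"
      using \<beta>(1) by (cases t) simp_all
  qed
  then obtain m where
    m: "\<forall>x\<in>carrier ?G. \<forall>y\<in>carrier ?G. m (x \<otimes>\<^bsub>?G\<^esub> y) = m x + m y"
      "\<forall>t. \<forall>x\<in>if t then A else B. m x = (if t then (\<lambda>_. 0) else \<beta>) x"
    by (elim exE conjE) (rule that)
  have l_hom: "l (x \<otimes>\<^bsub>?G\<^esub> y) = l x + l y" and m_hom: "m (x \<otimes>\<^bsub>?G\<^esub> y) = m x + m y"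
    if "x \<in> carrier ?G" "y \<in> carrier ?G" for x y
    by (rule l(1)[rule_format, OF that], rule m(1)[rule_format, OF that])
  have la: "l a = \<alpha> a" using l(2)[rule_format, of a True] \<alpha>(2) by simp
  have mA: "m x = 0" if "x \<in> A" for x using m(2)[rule_format, of x True] that by simp
  have mb: "m b = \<beta> b" using m(2)[rule_format, of b False] \<beta>(2) by simp
  let ?g = "\<lambda>i. l [(i, True)]" and ?h = "\<lambda>i. m [(i, True)]"
  have a: "a \<in> carrier ?G" and b: "b \<in> carrier ?G"
    by (rule subgroup.mem_carrier[OF sub(1) \<alpha>(2)], rule subgroup.mem_carrier[OF sub(2) \<beta>(2)])
  have 1: "signed_sum ?g a \<noteq> 0"
    proof -
    have "l a = signed_sum ?g a" by (rule hom_signed_sum[OF l_hom a])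
    then show ?thesis using la \<alpha>(3) by metis
  qed
  have 2: "signed_sum ?h x = 0" if "x \<in> A" for x
    proof -
    have "m x = signed_sum ?h x" by (rule hom_signed_sum[OF m_hom subgroup.mem_carrier[OF sub(1) that]])
    then show ?thesis using mA[OF that] by metis
  qed
  have "signed_sum ?h b \<noteq> 0"
    proof -
    have "m b = signed_sum ?h b" by (rule hom_signed_sum[OF m_hom b])
    then show ?thesis using mb \<beta>(3) by (metis)
  qed
  moreover have "signed_sum ?h b = 0" if "\<forall>i<N. ?h i = 0"
  proof -
    have "set b \<subseteq> {..<N} \<times> UNIV" using b by (simp add: carrier_free_group)
    then show ?thesis using that by (induction b) auto
  qed
  ultimately obtain i where i: "i < N" "?h i \<noteq> 0" by blast
  show ?thesis by (rule that[of a ?g i ?h, OF \<alpha>(2) a 1 i 2])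
qed


section \<open>A recurrence with a Pisot root\<close>

text \<open>The polynomial \<open>f(x) = x ^ (M + 1) - 2 x ^ M - 1\<close> is the characteristic polynomial of
  the action on the abelianization. Among its roots only \<open>lam\<close> lies outside the unit disc, but the
  other roots never appear explicitly: everything is done with the quotient \<open>f(x) / (x - lam)\<close>.\<close>
locale pisot_recurrence =
  fixes M :: nat and lam :: real
  assumes M_pos: "M > 0" and lam_gt: "lam > 2" and lam_eq: "lam ^ Suc M = 2 * lam ^ M + 1"
begin

definition solution :: "(nat \<Rightarrow> 'b::comm_ring_1) \<Rightarrow> bool" where
  "solution z \<longleftrightarrow> (\<forall>n. z (n + Suc M) = 2 * z (n + M) + z n)"

text \<open>Up to the factor \<open>lam ^ M\<close>, this applies the quotient of the characteristic polynomial by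
  \<open>x - lam\<close>, as a polynomial in the shift, to \<open>z\<close>. The result is therefore a geometric sequence, and it
  vanishes if and only if \<open>z\<close> has no component along \<open>lam ^ n\<close>.\<close>
definition dominant :: "(nat \<Rightarrow> real) \<Rightarrow> nat \<Rightarrow> real" where
  "dominant z n = lam ^ M * z (n + M) + (\<Sum>i<M. lam ^ i * z (n + (M - 1 - i)))"

lemma dominant_Suc:
  assumes "solution z"
  shows "dominant z (Suc n) = lam * dominant z n"
proof -
  obtain m where m: "M = Suc m" using M_pos gr0_implies_Suc by blast
  have "(\<Sum>i<M. lam ^ i * z (Suc n + (M - 1 - i))) + lam ^ M * z n
      = (\<Sum>i<Suc M. lam ^ i * z (n + (M - i)))"
  proof -
    have "(\<Sum>i<M. lam ^ i * z (Suc n + (M - 1 - i))) = (\<Sum>i<M. lam ^ i * z (n + (M - i)))"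
      by (rule sum.cong) (auto simp: Suc_diff_Suc)
    then show ?thesis by simp
  qed
  also have "\<dots> = z (n + M) + lam * (\<Sum>i<M. lam ^ i * z (n + (M - 1 - i)))"
    by (subst sum.lessThan_Suc_shift) (simp add: sum_distrib_left mult_ac)
  finally have "dominant z (Suc n) = lam ^ M * z (n + Suc M) - lam ^ M * z n + z (n + M)
      + lam * (\<Sum>i<M. lam ^ i * z (n + (M - 1 - i)))"
    by (simp add: dominant_def)
  also have "z (n + Suc M) = 2 * z (n + M) + z n" using assms unfolding solution_def by blast
  also have "lam ^ M * (2 * z (n + M) + z n) - lam ^ M * z n + z (n + M)
      = lam ^ Suc M * z (n + M)"
    unfolding lam_eq by (simp add: algebra_simps)
  finally show ?thesis by (simp add: dominant_def algebra_simps)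
qed

lemma dominant_eq: "solution z \<Longrightarrow> dominant z n = lam ^ n * dominant z 0"
  by (induction n) (simp_all add: dominant_Suc)

lemma coefficient_sum: "(\<Sum>i<M. lam ^ i) \<le> lam ^ M / (lam - 1)"
  using geometric_sum[of lam M] lam_gt by (simp add: divide_right_mono)

text \<open>Without dominant part, each term is a combination of the preceding \<open>M\<close> terms whose
  coefficients have absolute sum less than 1.\<close>
lemma solution_tendsto_0:
  assumes z: "solution z" and "dominant z 0 = 0"
  shows "z \<longlonglongrightarrow> 0"
proof -
  define q where "q = 1 / (lam - 1)"
  define C where "C = (\<Sum>n<M. \<bar>z n\<bar>)"
  have q: "q \<ge> 0" "q < 1" using lam_gt by (auto simp: q_def)
  have C: "C \<ge> 0" by (simp add: C_def sum_nonneg)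
  have bound: "\<bar>z n\<bar> \<le> C * q ^ (n div M)" for n
  proof (induction n rule: less_induct)
    case (less n)
    show ?case
    proof (cases "n < M")
      case True
      then show ?thesis using member_le_sum[of n "{..<M}" "\<lambda>n. \<bar>z n\<bar>"] by (simp add: C_def)
    next
      case False
      define k where "k = n - M"
      have n: "n = k + M" using False by (simp add: k_def)
      have "\<bar>lam ^ M * z n\<bar> = \<bar>\<Sum>i<M. lam ^ i * z (k + (M - 1 - i))\<bar>"
        using dominant_eq[OF z, of k] assms(2) by (simp add: dominant_def n)
      also have "\<dots> \<le> (\<Sum>i<M. \<bar>lam ^ i * z (k + (M - 1 - i))\<bar>)" by (rule sum_abs)
      also have "\<dots> \<le> (\<Sum>i<M. lam ^ i * (C * q ^ (k div M)))"
      proof (rule sum_mono)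
        fix i assume i: "i \<in> {..<M}"
        let ?j = "k + (M - 1 - i)"
        have "\<bar>z ?j\<bar> \<le> C * q ^ (?j div M)" using less[of ?j] i n by simp
        also have "\<dots> \<le> C * q ^ (k div M)"
          using q C by (intro mult_left_mono power_decreasing div_le_mono) auto
        finally show "\<bar>lam ^ i * z ?j\<bar> \<le> lam ^ i * (C * q ^ (k div M))"
          using lam_gt by (simp add: abs_mult mult_left_mono)
      qed
      also have "\<dots> = (\<Sum>i<M. lam ^ i) * (C * q ^ (k div M))" by (simp add: sum_distrib_right)
      also have "\<dots> \<le> (lam ^ M / (lam - 1)) * (C * q ^ (k div M))"
        using coefficient_sum C q by (intro mult_right_mono) auto
      also have "\<dots> = lam ^ M * (C * q ^ (n div M))"
        using M_pos by (simp add: n q_def)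
      finally have "lam ^ M * \<bar>z n\<bar> \<le> lam ^ M * (C * q ^ (n div M))"
        using lam_gt by (simp add: abs_mult)
      then show ?thesis using lam_gt by simp
    qed
  qed
  have "filterlim (\<lambda>n. n div M) at_top sequentially"
    unfolding filterlim_at_top
  proof
    fix Z
    show "\<forall>\<^sub>F n in sequentially. Z \<le> n div M"
      using eventually_ge_at_top[of "Z * M"]
      by eventually_elim (use M_pos in \<open>simp add: less_eq_div_iff_mult_less_eq\<close>)
  qed
  then have "(\<lambda>n. q ^ (n div M)) \<longlonglongrightarrow> 0"
    by (rule filterlim_compose[rotated]) (rule LIMSEQ_power_zero, use q in simp)
  then have "(\<lambda>n. C * q ^ (n div M)) \<longlonglongrightarrow> 0" by (rule tendsto_mult_right_zero)
  then show ?thesis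
    by (rule tendsto_0_le[where K = 1]) (use bound q C in \<open>simp add: abs_mult\<close>)
qed

lemma solution_asymptotics:
  fixes z :: "nat \<Rightarrow> real"
  assumes z: "solution z"
  obtains D y where "\<And>n. z n = D * lam ^ n + y n" "y \<longlonglongrightarrow> 0" "D = 0 \<longleftrightarrow> dominant z 0 = 0"
proof -
  define G where "G = dominant (\<lambda>n. lam ^ n) 0"
  have G: "G > 0"
    unfolding G_def dominant_def using lam_gt by (intro add_pos_nonneg sum_nonneg) auto
  define D where "D = dominant z 0 / G"
  define y where "y = (\<lambda>n. z n - D * lam ^ n)"
  have "lam ^ (n + Suc M) = 2 * lam ^ (n + M) + lam ^ n" for n
  proof -
    have "lam ^ (n + Suc M) = lam ^ n * lam ^ Suc M" by (rule power_add)
    then show ?thesis unfolding lam_eq by (simp add: algebra_simps power_add)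
  qed
  then have "solution y"
    using z by (simp add: solution_def y_def algebra_simps del: add_Suc_right power_Suc)
  moreover have "dominant y 0 = dominant z 0 - D * G"
    by (simp add: dominant_def y_def G_def algebra_simps sum_subtractf sum_distrib_left)
  then have "dominant y 0 = 0" using G by (simp add: D_def)
  ultimately have "y \<longlonglongrightarrow> 0" by (rule solution_tendsto_0)
  moreover have "z n = D * lam ^ n + y n" for n by (simp add: y_def)
  moreover have "D = 0 \<longleftrightarrow> dominant z 0 = 0" using G by (simp add: D_def)
  ultimately show ?thesis using that by blast
qed

text \<open>A null sequence of integers is eventually zero, and the recurrence runs backwards.\<close>
lemma integer_solution_zero:
  fixes z :: "nat \<Rightarrow> int"
  assumes z: "solution z" and dom: "dominant (\<lambda>n. z n) 0 = 0"
  shows "z n = 0"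
proof -
  have sol: "solution (\<lambda>n. real_of_int (z n))"
    unfolding solution_def
  proof
    fix n
    have "z (n + Suc M) = 2 * z (n + M) + z n" using z unfolding solution_def by blast
    then show "real_of_int (z (n + Suc M)) = 2 * real_of_int (z (n + M)) + real_of_int (z n)"
      by (metis of_int_add of_int_mult of_int_numeral)
  qed
  have "(\<lambda>n. real_of_int (z n)) \<longlonglongrightarrow> 0" by (rule solution_tendsto_0[OF sol dom])
  then have "\<forall>\<^sub>F n in sequentially. norm (real_of_int (z n)) < 1"
    by (rule order_tendstoD[OF tendsto_norm_zero]) simp
  then obtain n0 where n0: "\<And>n. n \<ge> n0 \<Longrightarrow> norm (real_of_int (z n)) < 1"
    unfolding eventually_sequentially by blast
  have "\<forall>n\<ge>n0. z n = 0"
  proof (intro allI impI)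
    fix n assume "n \<ge> n0"
    then have "\<bar>real_of_int (z n)\<bar> < 1" using n0[of n] by simp
    then show "z n = 0" by linarith
  qed
  then have "\<forall>n\<ge>0. z n = 0"
  proof (induction n0)
    case (Suc k)
    have "z (k + Suc M) = 0" "z (k + M) = 0" using Suc.prems M_pos by simp_all
    moreover have "z (k + Suc M) = 2 * z (k + M) + z k" using z unfolding solution_def by blast
    ultimately have "z k = 0" by simp
    then have "\<forall>n\<ge>k. z n = 0" using Suc.prems by (metis le_eq_less_or_eq Suc_leI)
    then show ?case by (rule Suc.IH)
  qed simp
  then show ?thesis by simp
qed

fun extend_solution :: "(nat \<Rightarrow> int) \<Rightarrow> nat \<Rightarrow> int" where
  "extend_solution f n =
     (if n \<le> M then f n else 2 * extend_solution f (n - 1) + extend_solution f (n - 1 - M))"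

declare extend_solution.simps [simp del]

text \<open>The powers of \<open>lam\<close> up to the exponent \<open>M\<close> are linearly independent over the integers: the
  coefficients of a relation, taken in a suitable order as initial values, give an integer solution whose
  dominant part is the value of the relation. This solution vanishes, and so do the coefficients.\<close>
lemma powers_independent:
  fixes x :: "nat \<Rightarrow> int"
  assumes eq: "(\<Sum>i\<le>M. x i * lam ^ i) = 0" and i: "i \<le> M"
  shows "x i = 0"
proof -
  \<comment> \<open>the order in which the initial values enter dominant z 0\<close>
  define f where "f = (\<lambda>n. if n = M then x M else x (M - 1 - n))"
  define z where "z = extend_solution f"
  have init: "z n = f n" if "n \<le> M" for n
    using that by (simp add: z_def extend_solution.simps)
  have "solution z"
    unfolding solution_def z_def by (subst extend_solution.simps) simp
  moreover have "dominant (\<lambda>n. z n) 0 = (\<Sum>i\<le>M. x i * lam ^ i)"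
  proof -
    have "(\<Sum>i<M. lam ^ i * z (M - 1 - i)) = (\<Sum>i<M. x i * lam ^ i)"
      by (rule sum.cong) (auto simp: init f_def)
    then show ?thesis
      by (simp add: dominant_def init f_def flip: lessThan_Suc_atMost)
  qed
  ultimately have zero: "z n = 0" for n using integer_solution_zero eq by simp
  show ?thesis
  proof (cases "i = M")
    case True
    then show ?thesis using zero[of M] init[of M] by (simp add: f_def)
  next
    case False
    then have "M - 1 - (M - 1 - i) = i" "M - 1 - i \<noteq> M" using i M_pos by linarith+
    then have "f (M - 1 - i) = x i" by (simp only: f_def if_False)
    then show ?thesis using zero[of "M - 1 - i"] init[of "M - 1 - i"] by simp
  qed
qed

text \<open>Writing \<open>s n = D * lam ^ n + y n\<close> with \<open>y\<close> tending to 0, the sums are asymptotic to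
  \<open>D * X * lam ^ (k * j)\<close>, where \<open>X\<close> is the value at \<open>lam\<close> of the polynomial with coefficients \<open>x\<close>.
  Both \<open>D\<close> and \<open>X\<close> are nonzero because everything is integral.\<close>
lemma no_periodic_zeros:
  fixes s x :: "nat \<Rightarrow> int"
  assumes s: "solution s" "s m \<noteq> 0" and x: "i \<le> M" "x i \<noteq> 0" and k: "k \<ge> 1"
  obtains j where "(\<Sum>i\<le>M. x i * s (k * j + i)) \<noteq> 0"
proof (rule ccontr)
  assume "\<not> thesis"
  then have zero: "(\<Sum>i\<le>M. x i * s (k * j + i)) = 0" for j using that by blast
  have sol: "solution (\<lambda>n. real_of_int (s n))"
    unfolding solution_def
  proof
    fix n
    have "s (n + Suc M) = 2 * s (n + M) + s n" using s unfolding solution_def by blast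
    then show "real_of_int (s (n + Suc M)) = 2 * real_of_int (s (n + M)) + real_of_int (s n)"
      by (metis of_int_add of_int_mult of_int_numeral)
  qed
  obtain D y where D: "\<And>n. real_of_int (s n) = D * lam ^ n + y n" "y \<longlonglongrightarrow> 0"
    "D = 0 \<longleftrightarrow> dominant (\<lambda>n. real_of_int (s n)) 0 = 0"
    by (rule solution_asymptotics[OF sol]) blast
  have D0: "D \<noteq> 0" using D(3) integer_solution_zero[OF s(1)] s(2) by blast
  define X where "X = (\<Sum>i\<le>M. x i * lam ^ i)"
  have X0: "X \<noteq> 0" using powers_independent[of x i] x unfolding X_def by blast
  define r where "r = (\<lambda>j. \<Sum>i\<le>M. x i * y (k * j + i))"
  have r: "r j = - (D * X) * lam ^ (k * j)" for j
  proof -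
    have "0 = real_of_int (\<Sum>i\<le>M. x i * s (k * j + i))" using zero by simp
    also have "\<dots> = (\<Sum>i\<le>M. x i * (D * lam ^ (k * j + i) + y (k * j + i)))"
      by (simp add: D(1))
    also have "\<dots> = D * lam ^ (k * j) * X + r j"
      by (simp add: X_def r_def distrib_left sum.distrib sum_distrib_left power_add mult_ac)
    finally show ?thesis by (simp add: algebra_simps)
  qed
  have "(\<lambda>j. y (k * j + i)) \<longlonglongrightarrow> 0" for i
  proof -
    have "strict_mono (\<lambda>j. k * j + i)" using k by (simp add: strict_mono_def)
    then show ?thesis using LIMSEQ_subseq_LIMSEQ[OF D(2)] by (simp add: o_def)
  qed
  then have "r \<longlonglongrightarrow> (\<Sum>i\<le>M. real_of_int (x i) * 0)"
    unfolding r_def by (intro tendsto_intros)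
  then have "(\<lambda>j. \<bar>r j\<bar>) \<longlonglongrightarrow> 0" using tendsto_rabs_zero by simp
  moreover have "\<bar>D * X\<bar> \<le> \<bar>r j\<bar>" for j
  proof -
    have "\<bar>D * X\<bar> * 1 \<le> \<bar>D * X\<bar> * lam ^ (k * j)"
      using lam_gt by (intro mult_left_mono one_le_power) auto
    then show ?thesis using lam_gt by (simp add: r abs_mult)
  qed
  ultimately have "\<bar>D * X\<bar> \<le> 0" by (intro LIMSEQ_le_const) auto
  then show False using D0 X0 by simp
qed

end


section \<open>Automorphisms with asymmetric stretch factors\<close>

text \<open>The substitutions of \<open>\<phi>\<close> and of its inverse. Letters beyond \<open>M\<close> are fixed, so that the
  two are inverse on all words.\<close>
definition rotation_subst :: "nat \<Rightarrow> nat \<Rightarrow> nat letter list" where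
  "rotation_subst M i =
     (if i < M then [(Suc i, True)]
      else if i = M then [(0, True), (M, True), (M, True)] else [(i, True)])"

definition rotation_subst_inv :: "nat \<Rightarrow> nat \<Rightarrow> nat letter list" where
  "rotation_subst_inv M i =
     (if i = 0 then [(M, True), (M - 1, False), (M - 1, False)]
      else if i \<le> M then [(i - 1, True)] else [(i, True)])"

lemma inverse_substs_rotation:
  assumes "M > 0"
  shows "inverse_substs (Suc M) (rotation_subst M) (rotation_subst_inv M) 3"
proof
  note defs = ext_def red_def rotation_subst_def rotation_subst_inv_def subst_letter_def inv_letter_def
  fix i
  show "ext (rotation_subst_inv M) (rotation_subst M i) = [(i, True)]"
    using assms by (simp add: defs)
  show "ext (rotation_subst M) (rotation_subst_inv M i) = [(i, True)]"
    using assms by (auto simp add: defs)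
qed (auto simp: rotation_subst_def rotation_subst_inv_def)

locale asymmetric_family =
  fixes M :: nat and lam mu :: real
  assumes M_pos: "M > 0"
    and lam: "lam > 2" "lam ^ Suc M = 2 * lam ^ M + 1"
    and mu: "mu > 1" "mu ^ Suc M = 2 * mu + 1"
begin

sublocale rot: inverse_substs "Suc M" "rotation_subst M" "rotation_subst_inv M" 3
  using M_pos by (rule inverse_substs_rotation)

sublocale rec: pisot_recurrence M lam
  by unfold_locales (use M_pos lam in auto)

text \<open>The substitution is positive, so a word is legal if its letters all have the same sign.\<close>
sublocale tt: train_track "Suc M" "rotation_subst M" "rotation_subst_inv M" 3
  "\<lambda>i. lam ^ i" lam "\<lambda>a b. snd a = snd b"
proof
  fix i assume i: "i < Suc M"
  show "wt (\<lambda>i. lam ^ i) (rotation_subst M i) = lam * lam ^ i"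
    using i lam(2) by (cases "i = M") (auto simp: rotation_subst_def)
  show "rotation_subst M i \<noteq> [] \<and> successively (\<lambda>a b. snd a = snd b) (rotation_subst M i)"
    by (simp add: rotation_subst_def)
next
  fix a b :: "nat letter"
  assume "snd a = snd b"
  then show "snd (last (subst_letter (rotation_subst M) a)) = snd (hd (subst_letter (rotation_subst M) b))"
    by (simp add: subst_letter_def rotation_subst_def inv_letter_def)
qed (use lam in \<open>auto simp: inv_letter_def\<close>)

definition succ_mod :: "nat \<Rightarrow> nat" where
  "succ_mod i = (if i = M then 0 else Suc i)"

text \<open>For the inverse automorphism, \<open>a\<^sub>0\<inverse>\<close> and \<open>a\<^sub>M\<close> are the only two letters whose images start with
  the same letter. A turn is illegal if some iterate folds it, hence the illegal turns
  are the preimages of this one: the word \<open>a\<^sub>j\<^sub>+\<^sub>1 a\<^sub>j\<close>, with indices modulo \<open>M + 1\<close>, or its inverse.\<close>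
definition legal_inv :: "nat letter \<Rightarrow> nat letter \<Rightarrow> bool" where
  "legal_inv a b \<longleftrightarrow> b \<noteq> inv_letter a \<and>
     \<not> (snd a \<and> snd b \<and> fst a = succ_mod (fst b)) \<and>
     \<not> (\<not> snd a \<and> \<not> snd b \<and> fst b = succ_mod (fst a))"

sublocale tt_inv: train_track "Suc M" "rotation_subst_inv M" "rotation_subst M" 3
  "\<lambda>i. mu ^ (M - i)" mu legal_inv
proof (unfold_locales)
  interpret inv: inverse_substs "Suc M" "rotation_subst_inv M" "rotation_subst M" 3
    by (rule rot.inverse)
  show "\<And>i. ext (rotation_subst M) (rotation_subst_inv M i) = [(i, True)]" by (rule rot.s_t)
  show "\<And>i. ext (rotation_subst_inv M) (rotation_subst M i) = [(i, True)]" by (rule rot.t_s)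
  show "\<And>i. length (rotation_subst_inv M i) \<le> 3" "\<And>i. length (rotation_subst M i) \<le> 3"
    by (rule rot.length_le)+
  show "\<And>i. i < Suc M \<Longrightarrow> set (rotation_subst_inv M i) \<subseteq> {..<Suc M} \<times> UNIV" by (rule rot.set_t)
  show "\<And>i. i < Suc M \<Longrightarrow> set (rotation_subst M i) \<subseteq> {..<Suc M} \<times> UNIV" by (rule rot.set_s)
  show "0 < Suc M" "1 < mu" using mu by simp_all
  show "\<And>i. i < Suc M \<Longrightarrow> 0 < mu ^ (M - i)" using mu by simp
  show "wt (\<lambda>i. mu ^ (M - i)) (rotation_subst_inv M i) = mu * mu ^ (M - i)" if "i < Suc M" for i
    using that mu(2) M_pos
    by (auto simp: rotation_subst_inv_def Suc_diff_le simp flip: power_Suc)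
  show "\<And>a b. legal_inv a b \<Longrightarrow> b \<noteq> inv_letter a" by (simp add: legal_inv_def)
  show "\<And>a b. legal_inv a b \<Longrightarrow> legal_inv (inv_letter b) (inv_letter a)"
    by (auto simp: legal_inv_def inv_letter_def)
  show "rotation_subst_inv M i \<noteq> [] \<and> successively legal_inv (rotation_subst_inv M i)"
    if "i < Suc M" for i
    using M_pos by (auto simp: rotation_subst_inv_def legal_inv_def inv_letter_def succ_mod_def)
  show "legal_inv (last (subst_letter (rotation_subst_inv M) a)) (hd (subst_letter (rotation_subst_inv M) b))"
    if "fst a < Suc M" "fst b < Suc M" "legal_inv a b" for a b
  proof -
    obtain i c where a: "a = (i, c)" by fastforce
    obtain j d where b: "b = (j, d)" by fastforce
    show ?thesis
      using that M_pos unfolding a b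
      by (cases c; cases d)
        (auto simp: rotation_subst_inv_def legal_inv_def inv_letter_def succ_mod_def subst_letter_def
          split: if_splits)
  qed
qed

abbreviation generator :: "nat letter list" where "generator \<equiv> [(0, True)]"

lemma generator: "generator \<in> carrier rot.F"
  by (simp add: carrier_free_group reduced_Cons)

lemma signed_sum_cong_words:
  "set w \<subseteq> X \<times> UNIV \<Longrightarrow> (\<And>i. i \<in> X \<Longrightarrow> g i = h i) \<Longrightarrow> signed_sum g w = signed_sum h w"
  by (induction w) auto

text \<open>The weighted exponent sum is a conjugacy invariant, and since the substitution is positive
  it multiplies this invariant by \<open>lam\<close>. Hence no class on which it is nonzero is periodic.\<close>
lemma signed_sum_iter_lam:
  "set w \<subseteq> {..<Suc M} \<times> UNIV \<Longrightarrow>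
    signed_sum (\<lambda>i. lam ^ i) (rot.iter n w) = lam ^ n * signed_sum (\<lambda>i. lam ^ i) w"
proof (induction n)
  case (Suc n)
  have scale: "signed_sum (\<lambda>i. lam * lam ^ i) v = lam * signed_sum (\<lambda>i. lam ^ i) v" for v
    by (induction v) (simp_all add: algebra_simps)
  have "signed_sum (\<lambda>i. lam ^ i) (rot.iter (Suc n) w)
      = signed_sum (\<lambda>i. signed_sum (\<lambda>i. lam ^ i) (rotation_subst M i)) (rot.iter n w)"
    by (simp add: signed_sum_ext)
  also have "\<dots> = signed_sum (\<lambda>i. lam * lam ^ i) (rot.iter n w)"
  proof (rule signed_sum_cong_words[OF rot.iter_in_words[OF Suc.prems]])
    fix i assume "i \<in> {..<Suc M}"
    then show "signed_sum (\<lambda>i. lam ^ i) (rotation_subst M i) = lam * lam ^ i"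
      using lam(2) by (cases "i = M") (auto simp: rotation_subst_def)
  qed
  finally show ?case using Suc by (simp add: scale)
qed simp

lemma generator_aperiodic:
  assumes "n \<ge> 1"
  shows "conj_class rot.F (rot.iter n generator) \<noteq> conj_class rot.F generator"
proof
  assume "conj_class rot.F (rot.iter n generator) = conj_class rot.F generator"
  then have "conjugate_words {..<Suc M} (rot.iter n generator) generator"
    by (intro class_conjugate_words rot.iter_carrier generator)
  then have "signed_sum (\<lambda>i. lam ^ i) (rot.iter n generator) = signed_sum (\<lambda>i. lam ^ i) generator"
    by (rule signed_sum_conjugate)
  then have "lam ^ n = 1" using signed_sum_iter_lam[of generator n] by simp
  moreover have "lam ^ n > 1" using lam(1) assms by (intro one_less_power) auto
  ultimately show False by simp
qed

lemma stretch_factor: "stretch_factor rot.F rot.outer = lam"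
  by (rule tt.stretch_factor_outer[OF generator]) (rule generator_aperiodic)

lemma stretch_factor_inv: "stretch_factor rot.F (inv\<^bsub>Out rot.F\<^esub> rot.outer) = mu"
  unfolding rot.inv_outer
proof (rule tt_inv.stretch_factor_outer[OF generator])
  fix n :: nat assume "n \<ge> 1"
  then show "conj_class rot.F (tt_inv.iter n generator) \<noteq> conj_class rot.F generator"
    using generator_aperiodic rot.periodic_inverse[OF generator] by blast
qed

text \<open>The orbit of one generator runs through the basis, so that a linear form on the
  abelianization is a single sequence satisfying the recurrence.\<close>
lemma iter_generator: "i \<le> M \<Longrightarrow> rot.iter i generator = [(i, True)]"
proof (induction i)
  case (Suc i)
  then show ?case
    by (simp add: ext_def subst_letter_def rotation_subst_def red_def)
qed simp

lemma signed_sum_iter: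
  "signed_sum h (rot.iter n w) = signed_sum (\<lambda>i. signed_sum h (rot.iter n [(i, True)])) w"
proof (induction w)
  case Nil
  have "rot.iter n [] = []" by (induction n) simp_all
  then show ?case by simp
next
  case (Cons a w)
  have letter: "signed_sum h (rot.iter n [a])
      = (if snd a then signed_sum h (rot.iter n [(fst a, True)]) else - signed_sum h (rot.iter n [(fst a, True)]))"
    using rot.iter_inv_word[of n "[(fst a, True)]"] by (cases a) (auto simp: inv_letter_def)
  have "signed_sum h (rot.iter n (a # w)) = signed_sum h (red (rot.iter n (a # w)))" by simp
  also have "red (rot.iter n (a # w)) = red (rot.iter n [a] @ rot.iter n w)"
    using rot.iter_red[of n "a # w"] rot.iter_red_append[of n "[a]" w] by simp
  finally show ?case using Cons letter by simp
qed

lemma signed_sum_coordinates: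
  fixes g :: "nat \<Rightarrow> int"
  assumes "set w \<subseteq> {..<Suc M} \<times> UNIV"
  shows "signed_sum g w = (\<Sum>i\<le>M. signed_sum (\<lambda>j. if j = i then 1 else 0) w * g i)"
  using assms
proof (induction w)
  case (Cons a w)
  have a: "fst a \<le> M" using Cons.prems by auto
  have "(\<Sum>i\<le>M. (if snd a then (if fst a = i then 1 else 0) else - (if fst a = i then 1 else 0)) * g i)
      = (\<Sum>i\<le>M. if fst a = i then (if snd a then g i else - g i) else 0)"
    by (rule sum.cong) auto
  also have "\<dots> = (if snd a then g (fst a) else - g (fst a))"
    using a by simp
  finally show ?case using Cons by (simp add: distrib_right sum.distrib)
qed simp

text \<open>Along the orbit of an element \<open>a\<close> of an invariant factor, a linear form vanishing on the
  factor would be zero at all multiples of \<open>k\<close>, contrary to \<open>no_periodic_zeros\<close>.\<close>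
lemma fully_irreducible: "fully_irreducible rot.F rot.outer"
proof (rule rot.fully_irreducibleI)
  fix k :: nat and A
  assume k: "k \<ge> 1" and A: "proper_free_factor rot.F A"
    and pres: "\<And>a. a \<in> A \<Longrightarrow> \<exists>b\<in>A. conjugate_words {..<Suc M} (rot.iter k a) b"
  obtain a g h m where a: "a \<in> A" "a \<in> carrier rot.F" "signed_sum (g :: nat \<Rightarrow> int) a \<noteq> 0"
    and m: "m < Suc M" "(h :: nat \<Rightarrow> int) m \<noteq> 0" and h: "\<And>x. x \<in> A \<Longrightarrow> signed_sum h x = 0"
    by (rule proper_free_factor_homs[OF A]) (rule that)
  define s where "s = (\<lambda>n. signed_sum h (rot.iter n generator))"
  define x where "x = (\<lambda>i. signed_sum (\<lambda>j. if j = i then 1 else 0 :: int) a)"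
  have words: "set a \<subseteq> {..<Suc M} \<times> UNIV" using a(2) by (simp add: carrier_free_group)
  have iter_gen: "rot.iter n [(i, True)] = rot.iter (n + i) generator" if "i \<le> M" for n i
    using iter_generator[OF that] by (simp add: funpow_add)
  have "s (n + Suc M) = 2 * s (n + M) + s n" for n
  proof -
    have "rot.iter (Suc M) generator = [(0, True), (M, True), (M, True)]"
      using M_pos by (simp add: iter_generator ext_def subst_letter_def rotation_subst_def red_def inv_letter_def)
    then have "rot.iter (n + Suc M) generator = rot.iter n [(0, True), (M, True), (M, True)]"
      by (simp add: funpow_add del: funpow.simps add_Suc_right)
    then show ?thesis
      using signed_sum_iter[of h n "[(0, True), (M, True), (M, True)]"] iter_gen[of M n]
      by (simp add: s_def)
  qed
  then have sol: "rec.solution s" by (simp add: rec.solution_def)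
  have "s m = h m" using m(1) by (simp add: s_def iter_generator)
  then have sm: "s m \<noteq> 0" using m(2) by simp
  have "\<exists>i\<le>M. x i \<noteq> 0"
  proof (rule ccontr)
    assume "\<not> (\<exists>i\<le>M. x i \<noteq> 0)"
    then have "(\<Sum>i\<le>M. x i * g i) = 0" by (intro sum.neutral) simp
    then show False using a(3) signed_sum_coordinates[OF words, of g] by (simp add: x_def)
  qed
  then obtain i where i: "i \<le> M" "x i \<noteq> 0" by blast
  have orbit: "\<exists>b\<in>A. conjugate_words {..<Suc M} (rot.iter (k * j) a) b" for j
  proof (induction j)
    case 0
    show ?case using a(1,2) conjugate_words_refl[of a] by (intro bexI[of _ a]) (simp_all add: carrier_free_group)
  next
    case (Suc j)
    then obtain b where b: "b \<in> A" "conjugate_words {..<Suc M} (rot.iter (k * j) a) b" by blast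
    obtain c where c: "c \<in> A" "conjugate_words {..<Suc M} (rot.iter k b) c" using pres b(1) by blast
    have "conjugate_words {..<Suc M} (rot.iter (k * Suc j) a) (rot.iter k b)"
      using rot.conjugate_iter[OF b(2), of k] by (simp add: funpow_add)
    then show ?case using c(1) conjugate_words_trans[OF _ c(2)] by (intro bexI[of _ c])
  qed
  have zero: "(\<Sum>i\<le>M. x i * s (k * j + i)) = 0" for j
  proof -
    obtain b where "b \<in> A" "conjugate_words {..<Suc M} (rot.iter (k * j) a) b" using orbit by blast
    then have "0 = signed_sum h (rot.iter (k * j) a)"
      using h[of b] signed_sum_conjugate[of "{..<Suc M}" "rot.iter (k * j) a" b h] by simp
    also have "\<dots> = signed_sum (\<lambda>i. signed_sum h (rot.iter (k * j) [(i, True)])) a"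
      by (rule signed_sum_iter)
    also have "\<dots> = (\<Sum>i\<le>M. x i * signed_sum h (rot.iter (k * j) [(i, True)]))"
      unfolding x_def by (rule signed_sum_coordinates[OF words])
    also have "\<dots> = (\<Sum>i\<le>M. x i * s (k * j + i))"
    proof (rule sum.cong)
      fix i assume "i \<in> {..M}"
      then have "rot.iter (k * j) [(i, True)] = rot.iter (k * j + i) generator"
        by (intro iter_gen) simp
      then show "x i * signed_sum h (rot.iter (k * j) [(i, True)]) = x i * s (k * j + i)"
        by (simp only: s_def)
    qed simp
    finally show ?thesis by simp
  qed
  show False
    by (rule rec.no_periodic_zeros[where s = s and m = m and x = x and i = i and k = k, OF sol sm i k]) (erule notE, rule zero)
qed

lemma stretch_asymmetry_ge: "ereal (M * (ln 2 / ln 3)) \<le> stretch_asymmetry (Suc M)"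
proof -
  have "ln mu > 0" using mu(1) by simp
  have "mu * mu ^ M \<le> mu * 3"
    using mu by (simp flip: power_Suc)
  then have "mu ^ M \<le> 3" using mu(1) by simp
  then have "ln (mu ^ M) \<le> ln 3" using mu(1) by (subst ln_le_cancel_iff) auto
  then have "M * ln mu \<le> ln 3" using mu(1) by (simp add: ln_realpow)
  moreover have "ln 2 \<le> ln lam" using lam(1) by simp
  ultimately have "(M * ln mu) * ln 2 \<le> ln 3 * ln lam"
    using \<open>ln mu > 0\<close> by (intro mult_mono) auto
  then have "M * (ln 2 / ln 3) \<le> ln lam / ln mu"
    using \<open>ln mu > 0\<close> by (simp add: field_simps)
  also have "ereal (ln lam / ln mu) \<le> stretch_asymmetry (Suc M)"
    unfolding stretch_asymmetry_def
    by (rule SUP_upper2[of rot.outer]) (simp_all add: fully_irreducible stretch_factor stretch_factor_inv)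
  finally show ?thesis by simp
qed

end

text \<open>Both eigenvalues exist by the intermediate value theorem, on \<open>[2, 3]\<close> and on \<open>[1, 3]\<close>.\<close>
lemma stretch_asymmetry_unbounded:
  assumes "M > 0"
  shows "ereal (M * (ln 2 / ln 3)) \<le> stretch_asymmetry (Suc M)"
proof -
  have "\<exists>x\<ge>2. x \<le> 3 \<and> x ^ Suc M - 2 * x ^ M - 1 = (0::real)"
    by (rule IVT') (auto intro!: continuous_intros)
  then obtain lam :: real where lam: "lam \<ge> 2" "lam ^ Suc M = 2 * lam ^ M + 1" by auto
  have "\<exists>x\<ge>1. x \<le> 3 \<and> x ^ Suc M - 2 * x - 1 = (0::real)"
  proof (rule IVT')
    have "(3::real) ^ 1 \<le> 3 ^ M" using assms by (intro power_increasing) auto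
    then show "(0::real) \<le> 3 ^ Suc M - 2 * 3 - 1" by simp
  qed (auto intro!: continuous_intros)
  then obtain mu :: real where mu: "mu \<ge> 1" "mu ^ Suc M = 2 * mu + 1" by auto
  have "lam \<noteq> 2" "mu \<noteq> 1" using lam(2) mu(2) by auto
  then have "asymmetric_family M lam mu"
    using assms lam mu by unfold_locales auto
  then show ?thesis by (rule asymmetric_family.stretch_asymmetry_ge)
qed

theorem theorem2:
  shows "limsup stretch_asymmetry = \<infinity>"
proof -
  let ?c = "ln 2 / ln 3 :: real" and ?u = "\<lambda>n. ereal (real (n - 1) * (ln 2 / ln 3))"
  have "?u \<longlonglongrightarrow> \<infinity>"
    unfolding tendsto_PInfty
  proof
    fix r
    have "\<forall>\<^sub>F n in sequentially. n \<ge> nat \<lceil>r / ?c\<rceil> + 2"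
      by (rule eventually_ge_at_top)
    then show "\<forall>\<^sub>F n in sequentially. ereal r < ?u n"
    proof eventually_elim
      case (elim n)
      then have "r / ?c < real (n - 1)" by linarith
      then have "r < real (n - 1) * ?c" by (simp only: pos_divide_less_eq[of ?c] divide_pos_pos ln_gt_zero)
      then show ?case by simp
    qed
  qed
  then have "limsup ?u = \<infinity>" by (rule lim_imp_Limsup[OF sequentially_bot])
  moreover have "limsup ?u \<le> limsup stretch_asymmetry"
  proof (rule Limsup_mono)
    show "\<forall>\<^sub>F n in sequentially. ?u n \<le> stretch_asymmetry n"
      using eventually_ge_at_top[of 2]
    proof eventually_elim
      case (elim n)
      then show ?case using stretch_asymmetry_unbounded[of "n - 1"] by simp
    qed
  qed
  ultimately show ?thesis by simp
qed

end
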